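(* Let $K$ be a field of characteristic $p>0$. (i) For each $n\ge1$, $$\mathrm{Aff}^{\mathrm g}_n(K)=\langle\mathrm{Aff}_n(K),\ \mathrm{BA}_n(K)\cap\mathrm{Aff}^{\mathrm g}_n(K)\rangle.$$ (ii) For $n=1,2$, $$\mathrm{Aff}^{\mathrm d}_n(K)=\langle\mathrm{Aff}_n(K),\ \mathrm{BA}_n(K)\cap\mathrm{Aff}^{\mathrm d}_n(K)\rangle.$$
   Context: All groups are subgroups of $\mathrm{Aut}_K K[x_1,\dots,x_n]$, the group (under composition) of $K$-algebra automorphisms of $K[x_1,\dots,x_n]$; $\langle\cdot\rangle$ denotes generated subgroup. $\mathrm{Aff}_n(K)$ is the group of affine automorphisms: $(\phi(x_1),\dots,\phi(x_n))=(x_1,\dots,x_n)M+(b_1,\dots,b_n)$ with $M\in\mathrm{GL}_n(K)$ and $b_i\in K$; translations are those with $M$ the identity. $\mathrm{BA}_n(K)$ is the set of $\phi$ with $\phi(x_i)\in K[x_i,\dots,x_n]$ for $i=1,\dots,n$. A polynomial $f\in K[x_1,\dots,x_n]$ is additive if $f(y_1+z_1,\dots,y_n+z_n)=f(y_1,\dots,y_n)+f(z_1,\dots,z_n)$ for indeterminates $y_i,z_i$ over $K$; $\mathrm{Add}_n(K)$ is the group of automorphisms $\phi$ with all $\phi(x_i)$ additive. $\mathrm{Aff}^{\mathrm g}_n(K)$ is the subgroup generated by all translations and $\mathrm{Add}_n(K)$. $\mathrm{Aff}^{\mathrm d}_n(K)=\{\phi\mid J\phi\in\mathrm{GL}_n(K)\}$,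 where $J\phi$ is the Jacobian matrix of $\phi$ (so the condition says that all partial derivatives $\partial\phi(x_i)/\partial x_j$ lie in $K$). *)

theory Defs
  imports
    "HOL-Library.Poly_Mapping"
    "HOL-Algebra.Bij"
    "HOL-Algebra.Generated_Groups"
    "Jordan_Normal_Form.Matrix"
begin

section \<open>Polynomials in finitely many variables\<close>

text \<open>
  The variables are $x_0, x_1, \dots$, so $K[x_1,\dots,x_n]$ appears here as
  $K[x_0,\dots,x_{n-1}] = {}$\<open>polys {..<n}\<close>. A monomial is its exponent function, a polynomial its
  coefficient function; the ring operations are those of \<^theory>\<open>HOL-Library.Poly_Mapping\<close>
  (convolution product).
\<close>

type_synonym 'k mpoly = "(nat \<Rightarrow>\<^sub>0 nat) \<Rightarrow>\<^sub>0 'k"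

definition Const :: "'k \<Rightarrow> 'k::field mpoly" where
  "Const c = Poly_Mapping.single 0 c"

definition X :: "nat \<Rightarrow> 'k::field mpoly" where
  "X i = Poly_Mapping.single (Poly_Mapping.single i 1) 1"

definition polys :: "nat set \<Rightarrow> 'k::field mpoly set" where
  "polys V = {f. \<forall>m \<in> Poly_Mapping.keys f. Poly_Mapping.keys m \<subseteq> V}"

definition subst :: "(nat \<Rightarrow> 'k mpoly) \<Rightarrow> 'k mpoly \<Rightarrow> 'k::field mpoly" where
  "subst s f = (\<Sum>m \<in> Poly_Mapping.keys f. Const (Poly_Mapping.lookup f m) *
     (\<Prod>i \<in> Poly_Mapping.keys m. s i ^ Poly_Mapping.lookup m i))"

text \<open>The subtraction of exponents is truncated, but where it truncates the coefficient is 0.\<close>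

definition pdiff :: "nat \<Rightarrow> 'k mpoly \<Rightarrow> 'k::field mpoly" where
  "pdiff j f = (\<Sum>m \<in> Poly_Mapping.keys f.
     Poly_Mapping.single (m - Poly_Mapping.single j 1)
       (of_nat (Poly_Mapping.lookup m j) * Poly_Mapping.lookup f m))"

section \<open>The automorphism group\<close>

text \<open>As in \<^const>\<open>Bij\<close>, automorphisms are \<^const>\<open>undefined\<close> outside \<open>polys {..<n}\<close>, which makes
  equality of automorphisms coincide with equality on the polynomial ring.\<close>

definition Aut_carrier :: "nat \<Rightarrow> ('k::field mpoly \<Rightarrow> 'k mpoly) set" where
  "Aut_carrier n = {\<phi> \<in> Bij (polys {..<n}).
     (\<forall>f \<in> polys {..<n}. \<forall>g \<in> polys {..<n}.
        \<phi> (f + g) = \<phi> f + \<phi> g \<and> \<phi> (f * g) = \<phi> f * \<phi> g) \<and>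
     (\<forall>c. \<phi> (Const c) = Const c)}"

definition Aut :: "nat \<Rightarrow> ('k::field mpoly \<Rightarrow> 'k mpoly) monoid" where
  "Aut n = (BijGroup (polys {..<n}))\<lparr>carrier := Aut_carrier n\<rparr>"

lemma polys_add: "f \<in> polys V \<Longrightarrow> g \<in> polys V \<Longrightarrow> f + g \<in> polys V"
  using Poly_Mapping.keys_add[of f g] by (auto simp: polys_def)

lemma polys_mult: "f \<in> polys V \<Longrightarrow> g \<in> polys V \<Longrightarrow> f * g \<in> polys V"
proof -
  assume f: "f \<in> polys V" and g: "g \<in> polys V"
  have "Poly_Mapping.keys m \<subseteq> V" if m: "m \<in> Poly_Mapping.keys (f * g)" for m
  proof -
    obtain a b where "m = a + b" "a \<in> Poly_Mapping.keys f" "b \<in> Poly_Mapping.keys g"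
      using m Poly_Mapping.keys_mult[of f g] by blast
    with f g Poly_Mapping.keys_add[of a b] show ?thesis by (simp add: polys_def) blast
  qed
  then show ?thesis by (auto simp: polys_def)
qed

lemma Const_in_polys: "Const c \<in> polys V"
  by (auto simp: polys_def Const_def)

lemma X_in_polys: "i \<in> V \<Longrightarrow> X i \<in> polys V"
  by (auto simp: polys_def X_def)

lemma subgroup_Aut: "subgroup (Aut_carrier n) (BijGroup (polys {..<n}))"
proof -
  let ?P = "polys {..<n} :: 'a mpoly set"
  interpret B: group "BijGroup ?P" by (rule group_BijGroup)
  show ?thesis
  proof (rule B.subgroupI)
    show "Aut_carrier n \<subseteq> carrier (BijGroup ?P)"
      by (auto simp: Aut_carrier_def BijGroup_def)
    have "(\<lambda>x\<in>?P. x) \<in> Aut_carrier n"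
      by (auto simp: Aut_carrier_def id_Bij polys_add polys_mult Const_in_polys)
    then show "Aut_carrier n \<noteq> ({} :: ('a mpoly \<Rightarrow> 'a mpoly) set)" by blast
  next
    fix f :: "'a mpoly \<Rightarrow> 'a mpoly" assume f: "f \<in> Aut_carrier n"
    then have fB: "f \<in> Bij ?P" by (simp add: Aut_carrier_def)
    then have bij: "bij_betw f ?P ?P" by (simp add: Bij_def)
    have "inv_into ?P f (g + h) = inv_into ?P f g + inv_into ?P f h"
      "inv_into ?P f (g * h) = inv_into ?P f g * inv_into ?P f h"
      if "g \<in> ?P" "h \<in> ?P" for g h
      using f that by (auto intro!: Bij_inv_into_lemma[OF _ fB] polys_add polys_mult
          simp: Aut_carrier_def)
    moreover have "inv_into ?P f (Const c) = Const c" for c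
      using f bij_betw_inv_into_left[OF bij Const_in_polys[of c]] by (simp add: Aut_carrier_def)
    ultimately have "restrict (inv_into ?P f) ?P \<in> Aut_carrier n"
      using restrict_inv_into_Bij[OF fB]
      by (simp add: Aut_carrier_def polys_add polys_mult Const_in_polys)
    then show "inv\<^bsub>BijGroup ?P\<^esub> f \<in> Aut_carrier n"
      by (simp add: inv_BijGroup[OF fB])
  next
    fix f g :: "'a mpoly \<Rightarrow> 'a mpoly" assume f: "f \<in> Aut_carrier n" and g: "g \<in> Aut_carrier n"
    then have B: "f \<in> Bij ?P" "g \<in> Bij ?P" by (auto simp: Aut_carrier_def)
    then have "g x \<in> ?P" if "x \<in> ?P" for x using that Bij_imp_funcset by blast
    with f g have "compose ?P f g \<in> Aut_carrier n"
      using compose_Bij[OF B]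
      by (simp add: Aut_carrier_def compose_eq polys_add polys_mult Const_in_polys)
    then show "f \<otimes>\<^bsub>BijGroup ?P\<^esub> g \<in> Aut_carrier n"
      using B by (simp add: BijGroup_def)
  qed
qed

lemma group_Aut: "group (Aut n)"
  unfolding Aut_def by (rule subgroup.subgroup_is_group[OF subgroup_Aut group_BijGroup])

definition GL :: "nat \<Rightarrow> 'k::field mat set" where
  "GL n = {M \<in> carrier_mat n n. invertible_mat M}"

text \<open>$(\phi(x_0),\dots,\phi(x_{n-1})) = (x_0,\dots,x_{n-1})M + (b_0,\dots,b_{n-1})$, with the
  variables forming a row vector.\<close>

definition affine_form ::
  "nat \<Rightarrow> ('k::field mpoly \<Rightarrow> 'k mpoly) \<Rightarrow> 'k mat \<Rightarrow> 'k vec \<Rightarrow> bool" where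
  "affine_form n \<phi> M b \<longleftrightarrow>
     (\<forall>j<n. \<phi> (X j) = (\<Sum>i<n. X i * Const (M $$ (i, j))) + Const (b $ j))"

definition Aff :: "nat \<Rightarrow> ('k::field mpoly \<Rightarrow> 'k mpoly) set" where
  "Aff n = {\<phi> \<in> carrier (Aut n). \<exists>M \<in> GL n. \<exists>b \<in> carrier_vec n. affine_form n \<phi> M b}"

definition Translations :: "nat \<Rightarrow> ('k::field mpoly \<Rightarrow> 'k mpoly) set" where
  "Translations n = {\<phi> \<in> carrier (Aut n). \<exists>b \<in> carrier_vec n. affine_form n \<phi> (1\<^sub>m n) b}"

definition BA :: "nat \<Rightarrow> ('k::field mpoly \<Rightarrow> 'k mpoly) set" where
  "BA n = {\<phi> \<in> carrier (Aut n). \<forall>i<n. \<phi> (X i) \<in> polys {i..<n}}"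

text \<open>The indeterminates $y_i$ and $z_i$ are \<open>X i\<close> and \<open>X (n + i)\<close> for \<open>i < n\<close>.\<close>

definition additive_poly :: "nat \<Rightarrow> 'k::field mpoly \<Rightarrow> bool" where
  "additive_poly n f \<longleftrightarrow> f \<in> polys {..<n} \<and>
     subst (\<lambda>i. X i + X (n + i)) f = subst (\<lambda>i. X i) f + subst (\<lambda>i. X (n + i)) f"

definition Add :: "nat \<Rightarrow> ('k::field mpoly \<Rightarrow> 'k mpoly) set" where
  "Add n = {\<phi> \<in> carrier (Aut n). \<forall>i<n. additive_poly n (\<phi> (X i))}"

definition Aff_g :: "nat \<Rightarrow> ('k::field mpoly \<Rightarrow> 'k mpoly) set" where
  "Aff_g n = generate (Aut n) (Translations n \<union> Add n)"

definition jacobian :: "nat \<Rightarrow> ('k::field mpoly \<Rightarrow> 'k mpoly) \<Rightarrow> 'k mpoly mat" where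
  "jacobian n \<phi> = mat n n (\<lambda>(i, j). pdiff j (\<phi> (X i)))"

definition Aff_d :: "nat \<Rightarrow> ('k::field mpoly \<Rightarrow> 'k mpoly) set" where
  "Aff_d n = {\<phi> \<in> carrier (Aut n). \<exists>M \<in> GL n. jacobian n \<phi> = map_mat Const M}"

end

theory Submission
  imports
    Defs
    "Jordan_Normal_Form.Determinant"
    "HOL-Computational_Algebra.Primes"
    "HOL-Combinatorics.Transposition"
begin

text \<open>
  Both equalities are reductions of an automorphism to triangular form. Composing \<open>\<phi>\<close> on the right
  with \<open>X i \<mapsto> X i + q\<close> replaces the component \<open>\<phi> (X i)\<close> by \<open>\<phi> (X i) + \<phi> q\<close>: a row operation on the
  tuple of components. The question is which row operations stay inside the group and how far they
  reach.

  In part (i) the monomials of an additive polynomial are the \<open>X i ^ (p ^ e)\<close>, so the part of a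
  component that involves \<open>X k\<close> is a polynomial in Frobenius with coefficients in \<open>K\<close>. Such
  polynomials admit division with remainder on one side over every field: the leading term of \<open>f\<close> is
  cancelled by \<open>c g ^ (p ^ e)\<close> (\<open>division_step\<close>), which is a row operation by an additive elementary
  automorphism. Euclid's algorithm, one column \<open>X k\<close> after the other, makes the tuple triangular, and
  a triangular tuple is an element of \<open>BA n\<close> (\<open>Add_triangularize\<close>).

  In part (ii) the case \<open>n = 1\<close> is trivial, since every automorphism is triangular. For \<open>n = 2\<close> the key is
  the theorem of Jung and van der Kulk in the form \<open>plane_automorphism_lead_terms\<close>: if the inverse of
  \<open>\<phi>\<close> is not affine, the leading term of one component is a constant times a power of the leading
  term of the other, so that one row operation lowers a degree. The proof works in every
  characteristic. Leading terms are taken with respect to the weights 1 and \<open>sqrt 2\<close>, for which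
  they are monomials \<open>F\<close>, \<open>G\<close>. Writing \<open>x\<close>, \<open>y\<close> as polynomials in the components, either there is no
  cancellation, and these polynomials are affine, or \<open>H (F, G) = 0\<close> for the leading form \<open>H\<close> of one
  of them; then \<open>F ^ q = c G ^ r\<close> with \<open>q\<close>, \<open>r\<close> coprime, and \<open>X 0 ^ q - c X 1 ^ r\<close> divides \<open>H\<close>. The
  automorphisms that translate the other coordinate and fix this one form a one-parameter family;
  the leading forms of its components are again such a family, and it fixes \<open>H\<close> and hence the
  divisor \<open>X 0 ^ q - c X 1 ^ r\<close> (\<open>homogeneous_family\<close>). But if \<open>q\<close>, \<open>r \<ge> 2\<close>, a comparison of degrees
  in the parameter shows that only a constant family with Jacobian determinant 1 fixes this binomial
  (\<open>family_constant\<close>). So \<open>q = 1\<close> or \<open>r = 1\<close>.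

  It remains to see that the row operations respect the constancy of the Jacobian matrix. A single
  degree reduction need not do so, but a complete one does: if \<open>f - q(g)\<close> has the least possible
  degree, then that degree is less than the degree of \<open>g\<close>, unless \<open>f - q(g)\<close> and \<open>g\<close> are affine. The
  derivatives \<open>q'(g) \<partial>g = \<partial>f - \<partial>(f - q(g))\<close> then have degree less than that of \<open>g\<close>, which
  forces \<open>q'\<close> to be constant (\<open>Aff_d_2_reduce\<close>).
\<close>

section \<open>Substitution and partial derivatives\<close>

abbreviation lookup :: "('a \<Rightarrow>\<^sub>0 'b::zero) \<Rightarrow> 'a \<Rightarrow> 'b" where "lookup \<equiv> Poly_Mapping.lookup"
abbreviation keys :: "('a \<Rightarrow>\<^sub>0 'b::zero) \<Rightarrow> 'a set" where "keys \<equiv> Poly_Mapping.keys"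
abbreviation single :: "'a \<Rightarrow> 'b \<Rightarrow> 'a \<Rightarrow>\<^sub>0 'b::zero" where "single \<equiv> Poly_Mapping.single"

lemma sum_single_lookup: "(\<Sum>k\<in>keys f. single k (lookup f k)) = f"
proof (rule poly_mapping_eqI)
  fix k
  show "lookup (\<Sum>k\<in>keys f. single k (lookup f k)) k = lookup f k"
    by (simp add: lookup_sum lookup_single when_def in_keys_iff)
qed

definition monom_eval :: "(nat \<Rightarrow> 'k mpoly) \<Rightarrow> (nat \<Rightarrow>\<^sub>0 nat) \<Rightarrow> 'k::field mpoly" where
  "monom_eval s m = (\<Prod>i\<in>keys m. s i ^ lookup m i)"

lemma monom_eval_superset:
  assumes "finite A" "keys m \<subseteq> A"
  shows "monom_eval s m = (\<Prod>i\<in>A. s i ^ lookup m i)"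
  unfolding monom_eval_def
  by (rule prod.mono_neutral_left) (use assms in \<open>auto simp: in_keys_iff\<close>)

lemma monom_eval_0 [simp]: "monom_eval s 0 = 1"
  by (simp add: monom_eval_def)

lemma monom_eval_single [simp]: "monom_eval s (single i e) = s i ^ e"
  by (simp add: monom_eval_def)

lemma monom_eval_add: "monom_eval s (m + m') = monom_eval s m * monom_eval s m'"
proof -
  let ?A = "keys m \<union> keys m'"
  have "monom_eval s (m + m') = (\<Prod>i\<in>?A. s i ^ lookup (m + m') i)"
    using Poly_Mapping.keys_add[of m m'] by (intro monom_eval_superset) auto
  also have "\<dots> = (\<Prod>i\<in>?A. s i ^ lookup m i) * (\<Prod>i\<in>?A. s i ^ lookup m' i)"
    by (simp add: lookup_add power_add prod.distrib)
  also have "\<dots> = monom_eval s m * monom_eval s m'"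
    by (simp add: monom_eval_superset[where A = ?A])
  finally show ?thesis .
qed

lemma Const_0 [simp]: "Const 0 = 0" by (simp add: Const_def)
lemma Const_1 [simp]: "Const 1 = 1" by (simp add: Const_def)
lemma Const_add: "Const (a + b) = Const a + Const b" by (simp add: Const_def single_add)
lemma Const_uminus: "Const (- a) = - Const a" by (simp add: Const_def single_uminus)
lemma Const_mult: "Const (a * b) = Const a * Const b" by (simp add: Const_def mult_single)
lemma Const_of_nat: "Const (of_nat k) = of_nat k"
  by (induction k) (simp_all add: Const_add)
lemma Const_power: "Const (a ^ e) = Const a ^ e"
  by (induction e) (simp_all add: Const_mult)
lemma Const_sum: "Const (sum a A) = (\<Sum>i\<in>A. Const (a i))"
  by (induction A rule: infinite_finite_induct) (simp_all add: Const_add)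
lemma lookup_Const: "lookup (Const c) m = (if m = 0 then c else 0)"
  by (auto simp: Const_def lookup_single when_def)
lemma Const_eq_iff [simp]: "Const a = Const b \<longleftrightarrow> a = b"
  by (metis lookup_Const)
lemma Const_eq_0_iff [simp]: "Const a = 0 \<longleftrightarrow> a = 0"
  using Const_eq_iff[of a 0] by simp

lemma Const_mult_single: "Const a * single m c = single m (a * c)"
  by (simp add: Const_def mult_single)

lemma X_power: "X i ^ e = single (single i e) 1"
  by (induction e) (simp_all add: X_def mult_single single_add[symmetric])

lemma X_neq_0 [simp]: "X i \<noteq> (0 :: 'k::field mpoly)"
  by (metis X_def lookup_single_eq lookup_zero one_neq_zero)

lemma monom_eval_X: "monom_eval X m = single m 1"
proof -
  have "(\<Prod>i\<in>A. (X i :: 'k::field mpoly) ^ e i) = single (\<Sum>i\<in>A. single i (e i)) 1" if "finite A" for A e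
    using that by (induction A rule: finite_induct) (simp_all add: X_power mult_single)
  from this[of "keys m" "lookup m"] show ?thesis
    by (simp add: monom_eval_def sum_single_lookup)
qed

lemma polys_mono: "V \<subseteq> W \<Longrightarrow> polys V \<subseteq> polys W"
  by (auto simp: polys_def)

lemma polys_0 [simp]: "0 \<in> polys V" by (simp add: polys_def)
lemma polys_1 [simp]: "1 \<in> polys V" by (simp add: polys_def)
lemma polys_sum: "(\<And>i. i \<in> A \<Longrightarrow> f i \<in> polys V) \<Longrightarrow> sum f A \<in> polys V"
  by (induction A rule: infinite_finite_induct) (auto intro: polys_add)
lemma polys_power: "f \<in> polys V \<Longrightarrow> f ^ e \<in> polys V"
  by (induction e) (auto intro: polys_mult)
lemma polys_uminus: "f \<in> polys V \<Longrightarrow> - f \<in> polys V"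
  by (auto simp: polys_def)
lemma polys_diff: "f \<in> polys V \<Longrightarrow> g \<in> polys V \<Longrightarrow> f - g \<in> polys V"
  using polys_add[of f V "- g"] by (simp add: polys_uminus)

lemmas polys_intros = polys_add polys_mult polys_diff polys_uminus polys_power polys_sum
  Const_in_polys X_in_polys

lemma polys_empty_iff: "f \<in> polys {} \<longleftrightarrow> (\<exists>c. f = Const c)"
proof
  assume "f \<in> polys {}"
  then have k: "keys f \<subseteq> {0}" by (auto simp: polys_def)
  have "f = Const (lookup f 0)"
    by (rule poly_mapping_eqI) (use k in \<open>auto simp: lookup_Const in_keys_iff\<close>)
  then show "\<exists>c. f = Const c" ..
qed (auto simp: Const_in_polys)

text \<open>Every polynomial is built from constants by addition and by multiplication by one
  variable at a time. This induction proves identities between homomorphisms and derivations.\<close>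

lemma polys_induct [consumes 1, case_names Const add X]:
  assumes f: "f \<in> polys V"
    and C: "\<And>c. P (Const c)"
    and A: "\<And>f g. \<lbrakk>f \<in> polys V; g \<in> polys V; P f; P g\<rbrakk> \<Longrightarrow> P (f + g)"
    and M: "\<And>f i. \<lbrakk>f \<in> polys V; i \<in> V; P f\<rbrakk> \<Longrightarrow> P (f * X i)"
  shows "P (f :: 'k::field mpoly)"
proof -
  have pow: "g * X i ^ e \<in> polys V \<and> P (g * X i ^ e)" if "g \<in> polys V" "P g" "i \<in> V" for g i e
  proof (induction e)
    case (Suc e)
    have *: "g * X i ^ Suc e = g * X i ^ e * X i" by (simp add: mult_ac)
    with Suc show ?case unfolding * using M[of "g * X i ^ e" i] that
      by (auto intro: polys_mult X_in_polys)
  qed (use that in auto)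
  have prod: "Const c * (\<Prod>i\<in>A. X i ^ e i) \<in> polys V \<and> P (Const c * (\<Prod>i\<in>A. X i ^ e i))"
    if "finite A" "A \<subseteq> V" for A c e
    using that
  proof (induction A rule: finite_induct)
    case (insert i A)
    then show ?case using pow[of "Const c * (\<Prod>i\<in>A. X i ^ e i)" i "e i"] by (simp add: mult_ac)
  qed (use C Const_in_polys in auto)
  have "P (\<Sum>m\<in>A. single m (lookup f m)) \<and> (\<Sum>m\<in>A. single m (lookup f m)) \<in> polys V"
    if "finite A" "A \<subseteq> keys f" for A
    using that
  proof (induction A rule: finite_induct)
    case empty
    then show ?case using C[of 0] by simp
  next
    case (insert m A)
    have "single m (lookup f m) = Const (lookup f m) * monom_eval X m"
      by (simp add: monom_eval_X Const_mult_single)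
    moreover have "keys m \<subseteq> V" using insert.prems f by (auto simp: polys_def)
    ultimately have "P (single m (lookup f m)) \<and> single m (lookup f m) \<in> polys V"
      using prod[of "keys m" "lookup f m" "lookup m"] by (simp add: monom_eval_def)
    with insert show ?case by (auto intro: A polys_add)
  qed
  from this[of "keys f"] show ?thesis by (simp add: sum_single_lookup)
qed

lemma polys_UNIV [simp]: "f \<in> polys UNIV" by (simp add: polys_def)

lemma subst_sum_monom_eval: "subst s f = (\<Sum>m\<in>keys f. Const (lookup f m) * monom_eval s m)"
  by (simp add: subst_def monom_eval_def)

lemma subst_single: "subst s (single m c) = Const c * monom_eval s m"
  by (auto simp: subst_sum_monom_eval)

lemma subst_add: "subst s (f + g) = subst s f + subst s g"
  unfolding subst_sum_monom_eval
  by (rule setsum_keys_plus_distrib) (simp_all add: Const_add algebra_simps)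

lemma subst_Const [simp]: "subst s (Const c) = Const c"
  by (simp add: Const_def subst_single) 

lemma subst_X [simp]: "subst s (X i) = s i"
  by (simp add: X_def subst_single)

lemma subst_0 [simp]: "subst s 0 = 0" using subst_Const[of s 0] by simp
lemma subst_1 [simp]: "subst s 1 = 1" using subst_Const[of s 1] by simp

lemma subst_sum: "subst s (sum f A) = (\<Sum>i\<in>A. subst s (f i))"
  by (induction A rule: infinite_finite_induct) (auto simp: subst_add)

lemma subst_mult: "subst s (f * g) = subst s f * subst s g"
proof -
  have single: "subst s (f * single m c) = subst s f * subst s (single m c)" for m c
  proof -
    have "f * single m c = (\<Sum>k\<in>keys f. single (k + m) (lookup f k * c))"
      by (subst sum_single_lookup[of f, symmetric]) (simp add: sum_distrib_right mult_single)
    moreover have "subst s f = (\<Sum>k\<in>keys f. Const (lookup f k) * monom_eval s k)"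
      by (rule subst_sum_monom_eval)
    ultimately show ?thesis
      by (simp add: subst_sum subst_single monom_eval_add Const_mult sum_distrib_left sum_distrib_right mult_ac)
  qed
  have "subst s (f * (\<Sum>m\<in>keys g. single m (lookup g m)))
      = subst s f * subst s (\<Sum>m\<in>keys g. single m (lookup g m))"
    by (simp only: sum_distrib_left subst_sum single)
  then show ?thesis by (simp only: sum_single_lookup)
qed

lemma subst_uminus: "subst s (- f) = - subst s f"
  using subst_add[of s f "- f"] by (simp add: eq_neg_iff_add_eq_0 add.commute)
lemma subst_diff: "subst s (f - g) = subst s f - subst s g"
  using subst_add[of s f "- g"] by (simp add: subst_uminus)
lemma subst_power: "subst s (f ^ e) = subst s f ^ e"
  by (induction e) (auto simp: subst_mult)
lemmas subst_simps = subst_add subst_diff subst_uminus subst_mult subst_power subst_sum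

lemma subst_cong:
  assumes "f \<in> polys V" "\<And>i. i \<in> V \<Longrightarrow> s i = t i"
  shows "subst s f = subst t f"
  using assms(1) by (induction rule: polys_induct) (auto simp: subst_simps assms(2))

lemma subst_subst: "subst s (subst t f) = subst (\<lambda>i. subst s (t i)) f"
proof -
  have "f \<in> polys UNIV" by simp
  then show ?thesis by (induction rule: polys_induct) (auto simp: subst_simps)
qed

lemma subst_ident: "subst X f = f"
proof -
  have "f \<in> polys UNIV" by simp
  then show ?thesis by (induction rule: polys_induct) (auto simp: subst_simps)
qed

lemma subst_ident_on: "f \<in> polys V \<Longrightarrow> (\<And>i. i \<in> V \<Longrightarrow> s i = X i) \<Longrightarrow> subst s f = f"
  using subst_cong[of f V s X] by (simp add: subst_ident)

lemma subst_in_polys: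
  assumes "f \<in> polys V" "\<And>i. i \<in> V \<Longrightarrow> s i \<in> polys W"
  shows "subst s f \<in> polys W"
  using assms(1)
  by (induction rule: polys_induct) (auto simp: subst_simps intro: polys_intros assms(2))

lemma pdiff_add: "pdiff j (f + g) = pdiff j f + pdiff j g"
  unfolding pdiff_def
  by (rule setsum_keys_plus_distrib) (simp_all add: single_add[symmetric] algebra_simps)

lemma pdiff_single: "pdiff j (single m c) = single (m - single j 1) (of_nat (lookup m j) * c)"
  by (auto simp: pdiff_def)

lemma pdiff_Const [simp]: "pdiff j (Const c) = 0"
  by (simp add: Const_def pdiff_single)
lemma pdiff_0 [simp]: "pdiff j 0 = 0" using pdiff_Const[of j 0] by simp
lemma pdiff_1 [simp]: "pdiff j 1 = 0" using pdiff_Const[of j 1] by simp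

lemma pdiff_X: "pdiff j (X i) = (if i = j then 1 else 0)"
  by (auto simp: X_def pdiff_single lookup_single when_def)

lemma pdiff_sum: "pdiff j (sum f A) = (\<Sum>i\<in>A. pdiff j (f i))"
  by (induction A rule: infinite_finite_induct) (auto simp: pdiff_add)

lemma pdiff_mult_X: "pdiff j (f * X i) = pdiff j f * X i + (if i = j then f else 0)"
proof -
  have single: "pdiff j (single m c * X i) = pdiff j (single m c) * X i
      + (if i = j then single m c else 0)" for m and c :: 'a
  proof (cases "i = j")
    case True
    have e: "m + single j (Suc 0) - single j (Suc 0) = m" by simp
    show ?thesis
    proof (cases "lookup m j = 0")
      case True
      with \<open>i = j\<close> e show ?thesis
        by (simp add: X_def pdiff_single mult_single lookup_add)
    next
      case False
      then have "m - single j (Suc 0) + single j (Suc 0) = m"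
        by (intro poly_mapping_eqI) (auto simp: lookup_add lookup_minus lookup_single when_def)
      with \<open>i = j\<close> e show ?thesis
        by (simp add: X_def pdiff_single mult_single lookup_add single_add[symmetric] algebra_simps)
    qed
  next
    case False
    show ?thesis
    proof (cases "lookup m j = 0")
      case True
      with False show ?thesis
        by (simp add: X_def pdiff_single mult_single lookup_add lookup_single)
    next
      case nz: False
      with False have "m + single i (Suc 0) - single j (Suc 0) = m - single j (Suc 0) + single i (Suc 0)"
        by (intro poly_mapping_eqI) (auto simp: lookup_add lookup_minus lookup_single when_def)
      with False nz show ?thesis
        by (simp add: X_def pdiff_single mult_single lookup_add lookup_single)
    qed
  qed
  have "pdiff j ((\<Sum>m\<in>keys f. single m (lookup f m)) * X i)
     = (\<Sum>m\<in>keys f. pdiff j (single m (lookup f m)) * X i + (if i = j then single m (lookup f m) else 0))"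
    by (simp only: sum_distrib_right pdiff_sum single)
  also have "\<dots> = pdiff j (\<Sum>m\<in>keys f. single m (lookup f m)) * X i
      + (if i = j then (\<Sum>m\<in>keys f. single m (lookup f m)) else 0)"
    by (simp add: sum.distrib sum_distrib_right pdiff_sum)
  finally show ?thesis by (simp only: sum_single_lookup)
qed

lemma pdiff_Const_mult: "pdiff j (Const c * f) = Const c * pdiff j f"
proof -
  have "f \<in> polys UNIV" by simp
  then show ?thesis
  proof (induction rule: polys_induct)
    case (Const d)
    have "pdiff j (Const c * Const d) = 0" by (simp only: Const_mult[symmetric] pdiff_Const)
    then show ?case by simp
  next
    case (add f g)
    then show ?case by (simp add: distrib_left pdiff_add)
  next
    case (X f i)
    have "pdiff j (Const c * (f * X i)) = pdiff j ((Const c * f) * X i)" by (simp add: mult_ac)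
    also have "\<dots> = Const c * pdiff j (f * X i)"
      using X by (simp only: pdiff_mult_X) (simp add: algebra_simps)
    finally show ?case .
  qed
qed

lemma pdiff_mult: "pdiff j (f * g) = pdiff j f * g + f * pdiff j g"
proof -
  have "g \<in> polys UNIV" by simp
  then show ?thesis
  proof (induction rule: polys_induct)
    case (Const c)
    then show ?case using pdiff_Const_mult[of j c f] by (simp add: mult_ac)
  next
    case (add g h)
    then show ?case by (simp add: distrib_left pdiff_add algebra_simps)
  next
    case (X g i)
    have "pdiff j (f * (g * X i)) = pdiff j ((f * g) * X i)" by (simp add: mult_ac)
    also have "\<dots> = pdiff j f * (g * X i) + f * pdiff j (g * X i)"
      using X by (simp only: pdiff_mult_X) (simp add: algebra_simps)
    finally show ?case .
  qed
qed

lemma pdiff_uminus: "pdiff j (- f) = - pdiff j f"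
  using pdiff_Const_mult[of j "-1" f] by (simp add: Const_uminus)
lemma pdiff_diff: "pdiff j (f - g) = pdiff j f - pdiff j g"
  using pdiff_add[of j f "- g"] by (simp add: pdiff_uminus)

lemma pdiff_power: "pdiff j (f ^ Suc e) = of_nat (Suc e) * f ^ e * pdiff j f"
proof (induction e)
  case (Suc e)
  then show ?case unfolding power_Suc[of f "Suc e"] pdiff_mult by (simp add: algebra_simps)
qed simp

lemma pdiff_in_polys: "f \<in> polys V \<Longrightarrow> pdiff j f \<in> polys V"
  by (induction rule: polys_induct)
    (auto simp: pdiff_add pdiff_mult_X intro: polys_intros)

lemma pdiff_eq_0: "f \<in> polys V \<Longrightarrow> j \<notin> V \<Longrightarrow> pdiff j f = 0"
  by (induction rule: polys_induct) (auto simp: pdiff_add pdiff_mult_X)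

lemma pdiff_subst:
  assumes "f \<in> polys V" "finite V"
  shows "pdiff j (subst s f) = (\<Sum>i\<in>V. subst s (pdiff i f) * pdiff j (s i))"
  using assms(1)
proof (induction rule: polys_induct)
  case (add f g)
  then show ?case by (simp add: subst_add pdiff_add sum.distrib distrib_right)
next
  case (X f k)
  have "(\<Sum>i\<in>V. subst s (pdiff i (f * X k)) * pdiff j (s i))
      = (\<Sum>i\<in>V. subst s (pdiff i f) * pdiff j (s i) * s k + (if i = k then subst s f * pdiff j (s k) else 0))"
    by (rule sum.cong) (auto simp: pdiff_mult_X subst_simps algebra_simps)
  also have "\<dots> = pdiff j (subst s (f * X k))"
    using X assms(2) by (simp add: sum.distrib sum_distrib_right subst_mult pdiff_mult)
  finally show ?case by simp
qed simp


section \<open>Weighted degrees and leading forms\<close>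

definition wt :: "(nat \<Rightarrow> real) \<Rightarrow> (nat \<Rightarrow>\<^sub>0 nat) \<Rightarrow> real" where
  "wt w m = (\<Sum>i\<in>keys m. real (lookup m i) * w i)"

text \<open>The weights are real numbers because they are compared and divided: one of them is
  irrational, another one is a minimum of quotients and possibly negative.\<close>

definition part :: "(nat \<Rightarrow> real) \<Rightarrow> real \<Rightarrow> 'k mpoly \<Rightarrow> 'k::field mpoly" where
  "part w N f = (\<Sum>m\<in>keys f. if wt w m = N then single m (lookup f m) else 0)"

text \<open>An upper bound \<open>wle w N f\<close> is kept apart from the degree \<open>wdeg w f\<close>: bounds hold for the zero
  polynomial too, and they pass to sums, products and substitutions even if leading terms cancel.\<close>

definition wle :: "(nat \<Rightarrow> real) \<Rightarrow> real \<Rightarrow> 'k::field mpoly \<Rightarrow> bool" where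
  "wle w N f \<longleftrightarrow> (\<forall>m\<in>keys f. wt w m \<le> N)"

definition wdeg :: "(nat \<Rightarrow> real) \<Rightarrow> 'k::field mpoly \<Rightarrow> real" where
  "wdeg w f = Max (wt w ` keys f)"

definition lead :: "(nat \<Rightarrow> real) \<Rightarrow> 'k::field mpoly \<Rightarrow> 'k mpoly" where
  "lead w f = part w (wdeg w f) f"

lemma wt_0 [simp]: "wt w 0 = 0" by (simp add: wt_def)
lemma wt_single [simp]: "wt w (single i e) = real e * w i" by (simp add: wt_def)
lemma wt_add: "wt w (m + m') = wt w m + wt w m'"
  unfolding wt_def
  by (rule setsum_keys_plus_distrib) (simp_all add: algebra_simps)

lemma wt_superset:
  assumes "finite A" "keys m \<subseteq> A"
  shows "wt w m = (\<Sum>i\<in>A. real (lookup m i) * w i)"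
  unfolding wt_def
  by (rule sum.mono_neutral_left) (use assms in \<open>auto simp: in_keys_iff\<close>)

lemma wt_cong: "(\<And>i. i \<in> keys m \<Longrightarrow> w i = v i) \<Longrightarrow> wt w m = wt v m"
  by (simp add: wt_def)

lemma wt_nonneg: "(\<And>i. w i \<ge> 0) \<Longrightarrow> wt w m \<ge> 0"
  by (auto simp: wt_def intro!: sum_nonneg)

lemma lookup_part: "lookup (part w N f) m = (if wt w m = N then lookup f m else 0)"
proof -
  have "lookup (part w N f) m = (\<Sum>k\<in>keys f. if k = m then (if wt w m = N then lookup f m else 0) else 0)"
    unfolding part_def lookup_sum by (rule sum.cong) (auto simp: lookup_single when_def)
  then show ?thesis by (simp add: in_keys_iff)
qed

lemma keys_part: "keys (part w N f) = {m \<in> keys f. wt w m = N}"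
  by (auto simp: in_keys_iff lookup_part split: if_splits)

lemma part_add: "part w N (f + g) = part w N f + part w N g"
  by (rule poly_mapping_eqI) (simp add: lookup_part lookup_add)
lemma part_minus: "part w N (f - g) = part w N f - part w N g"
  by (rule poly_mapping_eqI) (simp add: lookup_part lookup_minus)
lemma part_0 [simp]: "part w N 0 = 0"
  by (rule poly_mapping_eqI) (simp add: lookup_part)
lemma part_single: "part w N (single m c) = (if wt w m = N then single m c else 0)"
  by (rule poly_mapping_eqI) (auto simp: lookup_part lookup_single when_def)
lemma part_Const: "part w N (Const c) = (if N = 0 then Const c else 0)"
  by (auto simp: Const_def part_single)
lemma part_sum: "part w N (sum f A) = (\<Sum>i\<in>A. part w N (f i))"
  by (induction A rule: infinite_finite_induct) (auto simp: part_add)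
lemma part_in_polys: "f \<in> polys V \<Longrightarrow> part w N f \<in> polys V"
  by (auto simp: polys_def keys_part)

lemma wle_0 [simp]: "wle w N 0" by (simp add: wle_def)
lemma wle_add: "wle w N f \<Longrightarrow> wle w N g \<Longrightarrow> wle w N (f + g)"
  using Poly_Mapping.keys_add[of f g] by (auto simp: wle_def)
lemma wle_uminus: "wle w N f \<Longrightarrow> wle w N (- f)"
  by (simp add: wle_def)
lemma wle_diff: "wle w N f \<Longrightarrow> wle w N g \<Longrightarrow> wle w N (f - g)"
  using wle_add[of w N f "- g"] by (simp add: wle_uminus)
lemma wle_sum: "(\<And>i. i \<in> A \<Longrightarrow> wle w N (f i)) \<Longrightarrow> wle w N (sum f A)"
  by (induction A rule: infinite_finite_induct) (auto intro: wle_add)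
lemma wle_single: "wt w m \<le> N \<Longrightarrow> wle w N (single m c)"
  by (auto simp: wle_def)
lemma wle_Const: "0 \<le> N \<Longrightarrow> wle w N (Const c)"
  by (simp add: Const_def wle_single)
lemma wle_mono: "wle w N f \<Longrightarrow> N \<le> M \<Longrightarrow> wle w M f"
  by (force simp: wle_def)

lemma wle_mult: "wle w N f \<Longrightarrow> wle w M g \<Longrightarrow> wle w (N + M) (f * g)"
  using keys_mult[of f g] by (fastforce simp: wle_def wt_add intro: add_mono)

lemma part_mult:
  assumes "wle w N f" "wle w M g"
  shows "part w (N + M) (f * g) = part w N f * part w M g"
proof -
  have "f * g = (\<Sum>a\<in>keys f. single a (lookup f a)) * (\<Sum>b\<in>keys g. single b (lookup g b))"
    by (simp only: sum_single_lookup)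
  also have "part w (N + M) \<dots>
      = (\<Sum>a\<in>keys f. \<Sum>b\<in>keys g. part w (N + M) (single (a + b) (lookup f a * lookup g b)))"
    by (simp add: sum_product mult_single part_sum)
  also have "\<dots> = (\<Sum>a\<in>keys f. \<Sum>b\<in>keys g. (if wt w a = N then single a (lookup f a) else 0)
      * (if wt w b = M then single b (lookup g b) else 0))"
  proof (intro sum.cong refl)
    fix a b assume "a \<in> keys f" "b \<in> keys g"
    then have "wt w a \<le> N" "wt w b \<le> M" using assms by (auto simp: wle_def)
    then have "wt w (a + b) = N + M \<longleftrightarrow> wt w a = N \<and> wt w b = M"
      by (auto simp: wt_add)
    then show "part w (N + M) (single (a + b) (lookup f a * lookup g b))
        = (if wt w a = N then single a (lookup f a) else 0)
        * (if wt w b = M then single b (lookup g b) else 0)"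
      by (auto simp: part_single mult_single)
  qed
  also have "\<dots> = part w N f * part w M g"
    by (simp add: part_def sum_product)
  finally show ?thesis .
qed

lemma wle_part_power:
  assumes "wle w N f"
  shows "wle w (real e * N) (f ^ e) \<and> part w (real e * N) (f ^ e) = part w N f ^ e"
proof (induction e)
  case 0
  show ?case using wle_Const[of 0 w 1] part_Const[of w 0 1] by simp
next
  case (Suc e)
  then show ?case using wle_mult[OF assms, of "real e * N" "f ^ e"]
      part_mult[OF assms, of "real e * N" "f ^ e"] by (simp add: algebra_simps)
qed

lemma wle_part_monom_eval:
  assumes "\<And>i. i \<in> keys m \<Longrightarrow> wle w (v i) (s i)"
  shows "wle w (wt v m) (monom_eval s m)
    \<and> part w (wt v m) (monom_eval s m) = monom_eval (\<lambda>i. part w (v i) (s i)) m"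
proof -
  have "wle w (\<Sum>i\<in>A. real (lookup m i) * v i) (\<Prod>i\<in>A. s i ^ lookup m i)
    \<and> part w (\<Sum>i\<in>A. real (lookup m i) * v i) (\<Prod>i\<in>A. s i ^ lookup m i)
      = (\<Prod>i\<in>A. part w (v i) (s i) ^ lookup m i)" if "finite A" "A \<subseteq> keys m" for A
    using that
  proof (induction A rule: finite_induct)
    case empty
    show ?case using wle_Const[of 0 w 1] part_Const[of w 0 1] by simp
  next
    case (insert i A)
    then have "wle w (real (lookup m i) * v i) (s i ^ lookup m i)"
      "part w (real (lookup m i) * v i) (s i ^ lookup m i) = part w (v i) (s i) ^ lookup m i"
      using wle_part_power[OF assms[of i]] by auto
    with insert show ?case by (simp add: wle_mult part_mult)
  qed
  from this[of "keys m"] show ?thesis by (simp add: monom_eval_def wt_def)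
qed

text \<open>If \<open>s i\<close> has degree at most \<open>v i\<close>, then passing to leading forms commutes with substituting
  \<open>s\<close>, provided that the argument is graded by the weights \<open>v\<close>.\<close>

lemma wle_part_subst:
  assumes f: "f \<in> polys V" "wle v N f" and s: "\<And>i. i \<in> V \<Longrightarrow> wle w (v i) (s i)"
  shows wle_subst: "wle w N (subst s f)"
    and part_subst: "part w N (subst s f) = subst (\<lambda>i. part w (v i) (s i)) (part v N f)"
proof -
  have m: "wle w (wt v m) (monom_eval s m)"
    "part w (wt v m) (monom_eval s m) = monom_eval (\<lambda>i. part w (v i) (s i)) m"
    "wt v m \<le> N" if "m \<in> keys f" for m
  proof -
    have "keys m \<subseteq> V" "wt v m \<le> N" using that f by (auto simp: polys_def wle_def)
    then show "wle w (wt v m) (monom_eval s m)"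
      "part w (wt v m) (monom_eval s m) = monom_eval (\<lambda>i. part w (v i) (s i)) m" "wt v m \<le> N"
      using wle_part_monom_eval[of m w v s] s by auto
  qed
  have t: "wle w (wt v m) (Const c * monom_eval s m)" if "m \<in> keys f" for m c
    using wle_mult[OF wle_Const m(1)[OF that], of 0] by simp
  then show "wle w N (subst s f)"
    unfolding subst_sum_monom_eval by (intro wle_sum) (use m(3) in \<open>auto intro: wle_mono\<close>)
  have p: "part w N (Const c * monom_eval s m)
      = (if wt v m = N then Const c * monom_eval (\<lambda>i. part w (v i) (s i)) m else 0)"
    if "m \<in> keys f" for m c
  proof (cases "wt v m = N")
    case True
    then show ?thesis
      using part_mult[OF wle_Const m(1)[OF that], of 0 c] m(2)[OF that] by (simp add: part_Const)
  next
    case False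
    then have "wt v m < N" using m(3)[OF that] by simp
    then have "part w N (Const c * monom_eval s m) = 0"
      using t[OF that, of c] by (intro poly_mapping_eqI) (force simp: lookup_part wle_def in_keys_iff)
    with False show ?thesis by simp
  qed
  show "part w N (subst s f) = subst (\<lambda>i. part w (v i) (s i)) (part v N f)"
    unfolding subst_sum_monom_eval[of s] part_sum part_def[of v] subst_sum
    by (rule sum.cong) (auto simp: p subst_single)
qed

text \<open>For a homogeneous substitution the same holds in every degree, not only in the top one.\<close>

lemma part_subst_homogeneous:
  assumes s: "\<And>i. part w (v i) (s i) = s i"
  shows "part w N (subst s f) = subst s (part v N f)"
proof -
  have w: "wle w (v i) (s i)" for i
    by (subst s[symmetric]) (simp add: wle_def keys_part)
  have mono: "part w N (Const c * monom_eval s k)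
      = (if wt v k = N then Const c * monom_eval s k else 0)" for c k
  proof -
    have hk: "wle w (wt v k) (monom_eval s k)" "part w (wt v k) (monom_eval s k) = monom_eval s k"
      using wle_part_monom_eval[of k w v s] w s by simp_all
    have "part w (wt v k) (Const c * monom_eval s k) = Const c * monom_eval s k"
      using part_mult[OF wle_Const hk(1), of 0 c] hk(2) by (simp add: part_Const)
    then have hw: "wt w l = wt v k" if "l \<in> keys (Const c * monom_eval s k)" for l
      using that by (metis (mono_tags, lifting) keys_part mem_Collect_eq)
    show ?thesis
    proof (rule poly_mapping_eqI)
      fix l
      show "lookup (part w N (Const c * monom_eval s k)) l
          = lookup (if wt v k = N then Const c * monom_eval s k else 0) l"
        using hw[of l] by (cases "l \<in> keys (Const c * monom_eval s k)")
          (simp_all add: lookup_part in_keys_iff)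
    qed
  qed
  have "part w N (subst s f)
      = (\<Sum>k\<in>keys f. if wt v k = N then Const (lookup f k) * monom_eval s k else 0)"
    unfolding subst_sum_monom_eval part_sum by (simp only: mono)
  also have "\<dots> = subst s (part v N f)"
    unfolding part_def subst_sum by (rule sum.cong) (auto simp: subst_single)
  finally show ?thesis .
qed

lemma pdiff_sum_single: "pdiff j f = (\<Sum>m\<in>keys f. pdiff j (single m (lookup f m)))"
  by (subst sum_single_lookup[of f, symmetric]) (rule pdiff_sum)

lemma wle_part_pdiff:
  assumes "wle w N f"
  shows wle_pdiff: "wle w (N - w j) (pdiff j f)"
    and part_pdiff: "part w (N - w j) (pdiff j f) = pdiff j (part w N f)"
proof -
  have m: "wt w (m - single j 1) = wt w m - w j" if "lookup m j \<noteq> 0" for m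
  proof -
    have "m = m - single j 1 + single j 1"
      using that by (intro poly_mapping_eqI) (auto simp: lookup_add lookup_minus lookup_single when_def)
    then have "wt w m = wt w (m - single j 1) + wt w (single j 1)"
      by (metis wt_add)
    then show ?thesis by simp
  qed
  have "wle w (N - w j) (pdiff j (single m (lookup f m)))" if "m \<in> keys f" for m
    using that assms m[of m] by (cases "lookup m j = 0") (auto simp: pdiff_single wle_def)
  then show "wle w (N - w j) (pdiff j f)"
    by (subst pdiff_sum_single) (auto intro: wle_sum)
  have "part w (N - w j) (pdiff j (single m c)) = pdiff j (if wt w m = N then single m c else 0)" for m and c :: 'a
    using m[of m] by (cases "lookup m j = 0") (auto simp: pdiff_single part_single)
  then show "part w (N - w j) (pdiff j f) = pdiff j (part w N f)"
    by (subst pdiff_sum_single) (simp add: part_sum part_def[of w N] pdiff_sum)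
qed

lemma wle_wdeg: "wle w (wdeg w f) f"
  by (auto simp: wle_def wdeg_def)

lemma wdeg_attained:
  assumes "f \<noteq> 0"
  obtains m where "m \<in> keys f" "wt w m = wdeg w f"
proof -
  have "wdeg w f \<in> wt w ` keys f"
    unfolding wdeg_def using assms by (intro Max_in) auto
  then show thesis using that by auto
qed

lemma lead_neq_0: "f \<noteq> 0 \<Longrightarrow> lead w f \<noteq> 0"
  by (metis (mono_tags, lifting) keys_part lead_def mem_Collect_eq wdeg_attained empty_iff keys_zero)

lemma wdeg_le: "f \<noteq> 0 \<Longrightarrow> wle w N f \<Longrightarrow> wdeg w f \<le> N"
  by (metis wdeg_attained wle_def)

lemma wdeg_eqI: "wle w N f \<Longrightarrow> part w N f \<noteq> 0 \<Longrightarrow> wdeg w f = N"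
proof -
  assume a: "wle w N f" "part w N f \<noteq> 0"
  then obtain m where "m \<in> keys (part w N f)" by (metis keys_eq_empty ex_in_conv)
  then have "m \<in> keys f" "wt w m = N" by (auto simp: keys_part)
  with a show ?thesis using wle_wdeg[of w f] wdeg_le[of f w N]
    by (force simp: wle_def)
qed

lemma wdeg_less:
  assumes "wle w N f" "part w N f = 0" "f \<noteq> 0"
  shows "wdeg w f < N"
  using lead_neq_0[OF assms(3), of w] wdeg_le[OF assms(3,1)] assms(2)
  by (cases "wdeg w f = N") (auto simp: lead_def)

lemma wdeg_nonneg: "f \<noteq> 0 \<Longrightarrow> (\<And>i. w i \<ge> 0) \<Longrightarrow> wdeg w f \<ge> 0"
  by (metis wdeg_attained wt_nonneg)

lemma wdeg_mult_lead_mult: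
  assumes "f \<noteq> 0" "g \<noteq> 0"
  shows wdeg_mult: "wdeg w (f * g) = wdeg w f + wdeg w g"
    and lead_mult: "lead w (f * g) = lead w f * lead w g"
proof -
  have p: "part w (wdeg w f + wdeg w g) (f * g) = lead w f * lead w g"
    unfolding lead_def by (intro part_mult wle_wdeg)
  then show d: "wdeg w (f * g) = wdeg w f + wdeg w g"
    using lead_neq_0 assms by (intro wdeg_eqI wle_mult wle_wdeg) auto
  show "lead w (f * g) = lead w f * lead w g"
    using p by (simp add: lead_def[of w "f * g"] d)
qed

lemma wdeg_Const: "c \<noteq> 0 \<Longrightarrow> wdeg w (Const c) = 0"
  by (intro wdeg_eqI) (auto simp: wle_Const part_Const)

lemma wdeg_power_lead_power:
  assumes "f \<noteq> 0"
  shows wdeg_power: "wdeg w (f ^ e) = real e * wdeg w f"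
    and lead_power: "lead w (f ^ e) = lead w f ^ e"
proof -
  have p: "part w (real e * wdeg w f) (f ^ e) = lead w f ^ e" "wle w (real e * wdeg w f) (f ^ e)"
    using wle_part_power[OF wle_wdeg, of w e f] by (auto simp: lead_def)
  then show d: "wdeg w (f ^ e) = real e * wdeg w f"
    using lead_neq_0[OF assms] by (intro wdeg_eqI) auto
  show "lead w (f ^ e) = lead w f ^ e"
    using p by (simp add: lead_def[of w "f ^ e"] d)
qed

lemma wdeg_Const_mult: "c \<noteq> 0 \<Longrightarrow> f \<noteq> 0 \<Longrightarrow> wdeg w (Const c * f) = wdeg w f"
  by (simp add: wdeg_mult wdeg_Const)

text \<open>Weighing the variables outside \<open>V\<close> by 1 and those in \<open>V\<close> by 0 makes \<open>polys V\<close> the set of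
  polynomials of degree at most 0. As degrees add up, a factor of a nonzero polynomial in \<open>V\<close> is in \<open>V\<close>.\<close>

lemma polys_iff_wle: "f \<in> polys V \<longleftrightarrow> wle (\<lambda>i. if i \<in> V then 0 else 1) 0 f"
proof -
  have "keys m \<subseteq> V \<longleftrightarrow> wt (\<lambda>i. if i \<in> V then 0 else 1) m \<le> 0" for m :: "nat \<Rightarrow>\<^sub>0 nat"
  proof -
    have "wt (\<lambda>i. if i \<in> V then 0 else 1) m = real (\<Sum>i\<in>keys m. if i \<in> V then 0 else lookup m i)"
      unfolding wt_def of_nat_sum by (rule sum.cong) auto
    then have "wt (\<lambda>i. if i \<in> V then 0 else 1) m \<le> 0
        \<longleftrightarrow> (\<Sum>i\<in>keys m. if i \<in> V then 0 else lookup m i) = 0"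
      by (simp del: of_nat_sum)
    then show ?thesis by (auto simp: in_keys_iff)
  qed
  then show ?thesis by (simp add: polys_def wle_def)
qed

lemma polys_factor:
  assumes "f * g \<in> polys V" "f * g \<noteq> 0"
  shows "f \<in> polys V"
proof -
  let ?w = "\<lambda>i. if i \<in> V then 0 else (1::real)"
  have nz: "f \<noteq> 0" "g \<noteq> 0" using assms by auto
  then have "wdeg ?w f + wdeg ?w g \<le> 0"
    using wdeg_le[OF assms(2), of ?w 0] assms(1) by (simp add: polys_iff_wle wdeg_mult)
  moreover have "wdeg ?w g \<ge> 0" using nz by (intro wdeg_nonneg) auto
  ultimately show ?thesis using wle_mono[OF wle_wdeg, of ?w f 0] by (simp add: polys_iff_wle)
qed

lemma unit_is_Const:
  assumes "f * g = 1"
  obtains c where "f = Const c" "c \<noteq> 0"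
proof -
  have "f \<in> polys {}" by (rule polys_factor[of f g]) (simp_all add: assms)
  moreover have "f \<noteq> 0" using assms by auto
  ultimately show thesis using that by (auto simp: polys_empty_iff)
qed


section \<open>The group of polynomial automorphisms\<close>

lemma carrier_Aut [simp]: "carrier (Aut n) = Aut_carrier n" by (simp add: Aut_def)

interpretation Aut: group "Aut n" for n by (rule group_Aut)

lemma Aut_apply_in: "\<phi> \<in> Aut_carrier n \<Longrightarrow> f \<in> polys {..<n} \<Longrightarrow> \<phi> f \<in> polys {..<n}"
  using Bij_imp_funcset[of \<phi> "polys {..<n}"] by (auto simp: Aut_carrier_def)

lemma Aut_mult_apply:
  assumes "\<phi> \<in> Aut_carrier n" "\<psi> \<in> Aut_carrier n" "f \<in> polys {..<n}"
  shows "(\<phi> \<otimes>\<^bsub>Aut n\<^esub> \<psi>) f = \<phi> (\<psi> f)"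
  using assms by (simp add: Aut_def BijGroup_def Aut_carrier_def compose_def)

lemma Aut_one_apply: "f \<in> polys {..<n} \<Longrightarrow> \<one>\<^bsub>Aut n\<^esub> f = f"
  by (simp add: Aut_def BijGroup_def)

lemma Aut_inv_apply:
  assumes "\<phi> \<in> Aut_carrier n" "f \<in> polys {..<n}"
  shows "\<phi> ((inv\<^bsub>Aut n\<^esub> \<phi>) f) = f" "(inv\<^bsub>Aut n\<^esub> \<phi>) (\<phi> f) = f"
proof -
  have inv: "inv\<^bsub>Aut n\<^esub> \<phi> \<in> Aut_carrier n" using Aut.inv_closed[of \<phi> n] assms by simp
  show "\<phi> ((inv\<^bsub>Aut n\<^esub> \<phi>) f) = f"
    using Aut_mult_apply[OF assms(1) inv assms(2)] Aut.r_inv[of \<phi> n] assms Aut_one_apply[of f n] by simp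
  show "(inv\<^bsub>Aut n\<^esub> \<phi>) (\<phi> f) = f"
    using Aut_mult_apply[OF inv assms] Aut.l_inv[of \<phi> n] assms Aut_one_apply[of f n] by simp
qed

lemma Aut_eq_subst:
  assumes \<phi>: "\<phi> \<in> Aut_carrier n" and f: "f \<in> polys {..<n}"
  shows "\<phi> f = subst (\<lambda>i. \<phi> (X i)) f"
  using f
  by (induction rule: polys_induct)
    (use \<phi> in \<open>auto simp: Aut_carrier_def subst_simps X_in_polys\<close>)

lemma Aut_eqI:
  assumes "\<phi> \<in> Aut_carrier n" "\<psi> \<in> Aut_carrier n" "\<And>i. i < n \<Longrightarrow> \<phi> (X i) = \<psi> (X i)"
  shows "\<phi> = \<psi>"
proof
  fix f
  show "\<phi> f = \<psi> f"
  proof (cases "f \<in> polys {..<n}")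
    case True
    then have "subst (\<lambda>i. \<phi> (X i)) f = subst (\<lambda>i. \<psi> (X i)) f"
      by (rule subst_cong) (auto simp: assms)
    with True show ?thesis using assms by (simp add: Aut_eq_subst)
  next
    case False
    then show ?thesis
      using assms(1,2) by (auto simp: Aut_carrier_def Bij_def extensional_def)
  qed
qed

definition endo :: "nat \<Rightarrow> (nat \<Rightarrow> 'k mpoly) \<Rightarrow> 'k::field mpoly \<Rightarrow> 'k mpoly" where
  "endo n s = restrict (subst s) (polys {..<n})"

lemma endo_apply: "f \<in> polys {..<n} \<Longrightarrow> endo n s f = subst s f"
  by (simp add: endo_def)

lemma endo_X: "i < n \<Longrightarrow> endo n s (X i) = s i"
  by (simp add: endo_def X_in_polys)

lemma endo_in_Aut:
  assumes s: "\<And>i. i < n \<Longrightarrow> s i \<in> polys {..<n}" and t: "\<And>i. i < n \<Longrightarrow> t i \<in> polys {..<n}"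
    and st: "\<And>i. i < n \<Longrightarrow> subst s (t i) = X i" and ts: "\<And>i. i < n \<Longrightarrow> subst t (s i) = X i"
  shows "endo n s \<in> Aut_carrier n"
proof -
  have "subst s (subst t f) = f" "subst t (subst s f) = f" if "f \<in> polys {..<n}" for f
    using that by (auto simp: subst_subst st ts intro!: subst_ident_on)
  moreover have "subst s f \<in> polys {..<n}" "subst t f \<in> polys {..<n}" if "f \<in> polys {..<n}" for f
    using that by (auto intro: subst_in_polys s t)
  ultimately have "bij_betw (subst s) (polys {..<n}) (polys {..<n})"
    by (intro bij_betw_byWitness[where f' = "subst t"]) auto
  then have "endo n s \<in> Bij (polys {..<n})"
    by (simp add: Bij_def endo_def)
  then show ?thesis
    by (simp add: Aut_carrier_def endo_apply polys_add polys_mult Const_in_polys subst_simps)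
qed

lemma generate_Aut_eqI:
  assumes "subgroup S (Aut n)" "H \<subseteq> S" "\<And>\<phi>. \<phi> \<in> S \<Longrightarrow> \<phi> \<in> generate (Aut n) H"
  shows "S = generate (Aut n) H"
  using Aut.generate_subgroup_incl[OF assms(2,1)] assms(3) by blast

section \<open>Elementary automorphisms\<close>

definition elementary :: "nat \<Rightarrow> nat \<Rightarrow> 'k::field mpoly \<Rightarrow> 'k mpoly \<Rightarrow> 'k mpoly" where
  "elementary n i q = endo n (X(i := X i + q))"

lemma elementary_X:
  "j < n \<Longrightarrow> elementary n i q (X j) = (if j = i then X i + q else X j)"
  by (simp add: elementary_def endo_X)

lemma elementary_in_Aut:
  assumes i: "i < n" and q: "q \<in> polys ({..<n} - {i})"
  shows "elementary n i q \<in> Aut_carrier n"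
proof -
  have q': "q \<in> polys {..<n}" "- q \<in> polys {..<n}" using q polys_mono[of "{..<n} - {i}" "{..<n}"]
    by (auto intro: polys_uminus)
  have "subst (X(i := X i + q)) q = q" "subst (X(i := X i - q)) q = q"
    by (rule subst_ident_on[OF q]; simp)+
  then show ?thesis
    unfolding elementary_def using i q'
    by (intro endo_in_Aut[where t = "X(i := X i - q)"])
       (auto simp: subst_simps intro: polys_intros)
qed

definition swap :: "nat \<Rightarrow> nat \<Rightarrow> nat \<Rightarrow> 'k::field mpoly \<Rightarrow> 'k mpoly" where
  "swap n i j = endo n (X \<circ> transpose i j)"

lemma swap_X: "k < n \<Longrightarrow> swap n i j (X k) = X (transpose i j k)"
  by (simp add: swap_def endo_X)

lemma swap_in_Aut:
  assumes "i < n" "j < n"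
  shows "swap n i j \<in> Aut_carrier n"
proof -
  have "transpose i j k < n" if "k < n" for k
    using assms that by (auto simp: transpose_def)
  then show ?thesis
    unfolding swap_def
    by (intro endo_in_Aut[where t = "X \<circ> transpose i j"]) (auto intro: X_in_polys)
qed

section \<open>Automorphisms with constant Jacobian matrix\<close>

lemma pdiff_Aut_compose:
  assumes "\<phi> \<in> Aut_carrier n" "f \<in> polys {..<n}"
  shows "pdiff j (\<phi> f) = (\<Sum>k<n. \<phi> (pdiff k f) * pdiff j (\<phi> (X k)))"
proof -
  have "pdiff j (\<phi> f) = pdiff j (subst (\<lambda>i. \<phi> (X i)) f)"
    using assms by (simp add: Aut_eq_subst)
  also have "\<dots> = (\<Sum>k<n. subst (\<lambda>i. \<phi> (X i)) (pdiff k f) * pdiff j (\<phi> (X k)))"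
    using assms(2) by (rule pdiff_subst) simp
  also have "\<dots> = (\<Sum>k<n. \<phi> (pdiff k f) * pdiff j (\<phi> (X k)))"
    using Aut_eq_subst[OF assms(1) pdiff_in_polys[OF assms(2)]] by simp
  finally show ?thesis .
qed

lemma Aut_Const: "\<phi> \<in> Aut_carrier n \<Longrightarrow> \<phi> (Const c) = Const c"
  by (simp add: Aut_carrier_def)

lemma Aut_inv_in: "\<phi> \<in> Aut_carrier n \<Longrightarrow> inv\<^bsub>Aut n\<^esub> \<phi> \<in> Aut_carrier n"
  using Aut.inv_closed[of \<phi> n] by simp

lemma Aut_mult_in: "\<phi> \<in> Aut_carrier n \<Longrightarrow> \<psi> \<in> Aut_carrier n \<Longrightarrow> \<phi> \<otimes>\<^bsub>Aut n\<^esub> \<psi> \<in> Aut_carrier n"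
  using Aut.m_closed[of \<phi> n \<psi>] by simp

text \<open>The chain rule for \<open>\<phi> \<circ> inv \<phi> = id\<close>.\<close>

lemma Jacobian_inverse:
  assumes "\<phi> \<in> Aut_carrier n" "i < n"
  shows "(\<Sum>k<n. \<phi> (pdiff k ((inv\<^bsub>Aut n\<^esub> \<phi>) (X i))) * pdiff j (\<phi> (X k))) = (if i = j then 1 else 0)"
proof -
  have X: "X i \<in> polys {..<n}" using assms by (simp add: X_in_polys)
  have "(inv\<^bsub>Aut n\<^esub> \<phi>) (X i) \<in> polys {..<n}"
    using Aut_apply_in[OF Aut_inv_in[OF assms(1)] X] by simp
  from pdiff_Aut_compose[OF assms(1) this, of j] show ?thesis
    using Aut_inv_apply(1)[OF assms(1) X] by (simp add: pdiff_X)
qed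

lemma jacobian_entry:
  assumes "M \<in> GL n" "jacobian n \<phi> = map_mat Const M" "i < n" "j < n"
  shows "pdiff j (\<phi> (X i)) = Const (M $$ (i, j))"
proof -
  have "M \<in> carrier_mat n n" using assms(1) by (simp add: GL_def)
  then have "map_mat Const M $$ (i, j) = Const (M $$ (i, j))" using assms(3,4) by auto
  then show ?thesis using assms(3,4) unfolding assms(2)[symmetric] by (simp add: jacobian_def)
qed

text \<open>A constant Jacobian matrix of an automorphism is automatically invertible: the constant terms of
  the chain rule for the inverse automorphism provide an inverse matrix over the field.\<close>

lemma Aff_d_iff:
  assumes \<phi>: "\<phi> \<in> Aut_carrier n"
  shows "\<phi> \<in> Aff_d n \<longleftrightarrow> (\<forall>i<n. \<forall>j<n. \<exists>c. pdiff j (\<phi> (X i)) = Const c)" (is "_ \<longleftrightarrow> ?C")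
proof
  assume "\<phi> \<in> Aff_d n"
  then obtain M where M: "M \<in> GL n" "jacobian n \<phi> = map_mat Const M" by (auto simp: Aff_d_def)
  then show ?C using jacobian_entry by blast
next
  assume ?C
  then obtain c where c: "pdiff j (\<phi> (X i)) = Const (c i j)" if "i < n" "j < n" for i j by metis
  let ?\<psi> = "inv\<^bsub>Aut n\<^esub> \<phi>"
  define M where "M = mat n n (\<lambda>(i, j). c i j)"
  define N where "N = mat n n (\<lambda>(i, k). lookup (\<phi> (pdiff k (?\<psi> (X i)))) 0)"
  have [simp]: "M \<in> carrier_mat n n" "N \<in> carrier_mat n n" by (auto simp: M_def N_def)
  have lk: "lookup (f * Const a) 0 = lookup f 0 * a" for f and a :: 'a
  proof -
    have "lookup (f * Const a) 0 = lookup (\<Sum>m\<in>keys f. single m (lookup f m * a)) 0"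
      by (subst sum_single_lookup[of f, symmetric])
        (simp add: Const_def sum_distrib_right mult_single)
    also have "\<dots> = (\<Sum>m\<in>keys f. if m = 0 then lookup f m * a else 0)"
      unfolding lookup_sum by (rule sum.cong) (auto simp: lookup_single when_def)
    also have "\<dots> = lookup f 0 * a" by (simp add: in_keys_iff)
    finally show ?thesis .
  qed
  have "N * M = 1\<^sub>m n"
  proof (rule eq_matI)
    fix i j assume "i < dim_row (1\<^sub>m n)" "j < dim_col (1\<^sub>m n)"
    then have ij: "i < n" "j < n" by auto
    have "(N * M) $$ (i, j) = (\<Sum>k<n. lookup (\<phi> (pdiff k (?\<psi> (X i)))) 0 * c k j)"
      using ij by (simp add: scalar_prod_def M_def N_def atLeast0LessThan)
    also have "\<dots> = lookup (\<Sum>k<n. \<phi> (pdiff k (?\<psi> (X i))) * Const (c k j)) 0"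
      by (simp add: lookup_sum lk)
    also have "(\<Sum>k<n. \<phi> (pdiff k (?\<psi> (X i))) * Const (c k j))
        = (\<Sum>k<n. \<phi> (pdiff k (?\<psi> (X i))) * pdiff j (\<phi> (X k)))"
      by (intro sum.cong) (auto simp: c ij)
    also have "\<dots> = (if i = j then 1 else 0)" by (rule Jacobian_inverse[OF \<phi> ij(1)])
    also have "lookup \<dots> 0 = 1\<^sub>m n $$ (i, j)" using ij by (simp add: lookup_one)
    finally show "(N * M) $$ (i, j) = 1\<^sub>m n $$ (i, j)" .
  qed (auto simp: M_def N_def)
  moreover from this have "M * N = 1\<^sub>m n"
    by (rule mat_mult_left_right_inverse[rotated 2]) auto
  ultimately have "M \<in> GL n"
    by (auto simp: GL_def invertible_mat_def inverts_mat_def M_def N_def)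
  moreover have "jacobian n \<phi> = map_mat Const M"
    by (rule eq_matI) (auto simp: jacobian_def M_def c)
  ultimately show "\<phi> \<in> Aff_d n" using \<phi> by (auto simp: Aff_d_def)
qed

text \<open>For closure under inverses, multiply the chain rule for \<open>\<phi> \<circ> inv \<phi> = id\<close> by the inverse of the
  constant Jacobian matrix of \<open>\<phi>\<close>.\<close>

lemma subgroup_Aff_d: "subgroup (Aff_d n) (Aut n)"
proof (rule Aut.subgroupI)
  show sub: "Aff_d n \<subseteq> carrier (Aut n)" by (auto simp: Aff_d_def)
  have "\<one>\<^bsub>Aut n\<^esub> \<in> Aff_d n"
  proof -
    have "pdiff j (\<one>\<^bsub>Aut n\<^esub> (X i)) = Const (if i = j then 1 else 0)" if "i < n" for i j
      using that by (simp add: Aut_one_apply X_in_polys pdiff_X)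
    then show ?thesis using Aut.one_closed[of n] by (subst Aff_d_iff) auto
  qed
  then show "Aff_d n \<noteq> {}" by blast
next
  fix \<phi> :: "'a mpoly \<Rightarrow> 'a mpoly" assume d: "\<phi> \<in> Aff_d n"
  then have \<phi>: "\<phi> \<in> Aut_carrier n" by (auto simp: Aff_d_def)
  let ?\<psi> = "inv\<^bsub>Aut n\<^esub> \<phi>"
  obtain M where M: "M \<in> GL n" "jacobian n \<phi> = map_mat Const M" using d by (auto simp: Aff_d_def)
  note J = jacobian_entry[OF M]
  obtain B where MB: "M * B = 1\<^sub>m n" and B: "B \<in> carrier_mat n n"
  proof -
    from M(1) obtain B where "inverts_mat M B" "inverts_mat B M" "M \<in> carrier_mat n n"
      by (auto simp: GL_def invertible_mat_def)
    then have "M * B = 1\<^sub>m n" "B * M = 1\<^sub>m (dim_row B)" by (auto simp: inverts_mat_def)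
    moreover from this have "dim_col B = n" "dim_row B = n"
      using \<open>M \<in> carrier_mat n n\<close>
      by (metis index_mult_mat(3) index_one_mat(3) carrier_matD)+
    ultimately show thesis using that by blast
  qed
  have "pdiff l (?\<psi> (X i)) = Const (B $$ (i, l))" if il: "i < n" "l < n" for i l
  proof -
    let ?r = "\<lambda>k. \<phi> (pdiff k (?\<psi> (X i)))"
    have "Const (B $$ (i, l)) = (\<Sum>j<n. (if i = j then 1 else 0) * Const (B $$ (j, l)))"
      using il by (simp add: if_distrib[of "\<lambda>x. x * _"] cong: if_cong)
    also have "\<dots> = (\<Sum>j<n. (\<Sum>k<n. ?r k * Const (M $$ (k, j))) * Const (B $$ (j, l)))"
    proof (rule sum.cong)
      fix j assume "j \<in> {..<n}"
      then have "(\<Sum>k<n. ?r k * Const (M $$ (k, j))) = (\<Sum>k<n. ?r k * pdiff j (\<phi> (X k)))"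
        by (intro sum.cong) (auto simp: J)
      then show "(if i = j then 1 else 0) * Const (B $$ (j, l))
          = (\<Sum>k<n. ?r k * Const (M $$ (k, j))) * Const (B $$ (j, l))"
        using Jacobian_inverse[OF \<phi> il(1), of j] by simp
    qed simp
    also have "\<dots> = (\<Sum>k<n. ?r k * Const (\<Sum>j<n. M $$ (k, j) * B $$ (j, l)))"
      unfolding sum_distrib_right Const_sum sum_distrib_left Const_mult
      by (subst sum.swap) (simp add: mult_ac)
    also have "\<dots> = (\<Sum>k<n. ?r k * Const ((M * B) $$ (k, l)))"
      using B M(1) il by (intro sum.cong) (auto simp: GL_def scalar_prod_def atLeast0LessThan)
    also have "\<dots> = (\<Sum>k<n. if k = l then ?r k else 0)"
      using il by (intro sum.cong) (auto simp: MB)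
    also have "\<dots> = ?r l" using il by simp
    finally have "?\<psi> (?r l) = ?\<psi> (Const (B $$ (i, l)))" by simp
    moreover have "pdiff l (?\<psi> (X i)) \<in> polys {..<n}"
      using il by (intro pdiff_in_polys Aut_apply_in[OF Aut_inv_in[OF \<phi>]] X_in_polys) simp
    ultimately show ?thesis
      using Aut_inv_apply(2)[OF \<phi>] Aut_Const[OF Aut_inv_in[OF \<phi>]] by simp
  qed
  then show "?\<psi> \<in> Aff_d n" by (subst Aff_d_iff) (auto intro: Aut_inv_in \<phi>)
next
  fix \<phi> \<psi> :: "'a mpoly \<Rightarrow> 'a mpoly" assume d: "\<phi> \<in> Aff_d n" "\<psi> \<in> Aff_d n"
  then have c: "\<phi> \<in> Aut_carrier n" "\<psi> \<in> Aut_carrier n" by (auto simp: Aff_d_def)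
  from d obtain a b where
    a: "pdiff j (\<phi> (X i)) = Const (a i j)" and b: "pdiff j (\<psi> (X i)) = Const (b i j)"
    if "i < n" "j < n" for i j
    using Aff_d_iff[OF c(1)] Aff_d_iff[OF c(2)] by metis
  have "pdiff j ((\<phi> \<otimes>\<^bsub>Aut n\<^esub> \<psi>) (X i)) = Const (\<Sum>k<n. b i k * a k j)" if "i < n" "j < n" for i j
  proof -
    have X: "X i \<in> polys {..<n}" using that by (simp add: X_in_polys)
    have "pdiff j (\<phi> (\<psi> (X i))) = (\<Sum>k<n. \<phi> (pdiff k (\<psi> (X i))) * pdiff j (\<phi> (X k)))"
      by (rule pdiff_Aut_compose[OF c(1) Aut_apply_in[OF c(2) X]])
    also have "\<dots> = (\<Sum>k<n. Const (b i k * a k j))"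
      using that by (intro sum.cong) (auto simp: a b Aut_Const[OF c(1)] Const_mult)
    finally show ?thesis using Aut_mult_apply[OF c X] by (simp add: Const_sum)
  qed
  then show "\<phi> \<otimes>\<^bsub>Aut n\<^esub> \<psi> \<in> Aff_d n" by (subst Aff_d_iff) (auto intro: Aut_mult_in c)
qed

lemma pdiff_affine:
  assumes "j < n"
  shows "pdiff j ((\<Sum>i<n. X i * Const (a i)) + Const b) = Const (a j)"
proof -
  have "pdiff j ((\<Sum>i<n. X i * Const (a i)) + Const b) = (\<Sum>i<n. if i = j then Const (a i) else 0)"
    unfolding pdiff_add pdiff_sum pdiff_Const add_0_right
    by (rule sum.cong) (auto simp: pdiff_mult pdiff_X)
  then show ?thesis using assms by simp
qed

lemma Aff_subset_Aff_d: "Aff n \<subseteq> Aff_d n"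
proof
  fix \<phi> :: "'a mpoly \<Rightarrow> 'a mpoly" assume "\<phi> \<in> Aff n"
  then obtain M b where \<phi>: "\<phi> \<in> Aut_carrier n" "affine_form n \<phi> M b" by (auto simp: Aff_def)
  then show "\<phi> \<in> Aff_d n"
    by (subst Aff_d_iff) (auto simp: affine_form_def pdiff_affine)
qed

lemma wle_one_affine:
  assumes f: "f \<in> polys {..<n}" "wle (\<lambda>_. 1) 1 f"
  shows "f = (\<Sum>i<n. X i * Const (lookup f (single i 1))) + Const (lookup f 0)"
proof (rule poly_mapping_eqI)
  fix m
  have XC: "lookup (X i * Const c) m = (if m = single i 1 then c else 0)" for i m and c :: 'a
    by (simp add: X_def Const_def mult_single lookup_single when_def eq_commute)
  have inj: "single i (1::nat) = single j 1 \<longleftrightarrow> i = j" for i j :: nat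
    by (metis keys_single one_neq_zero singleton_inject)
  have nz: "single i (1::nat) \<noteq> 0" for i :: nat
    by (metis lookup_single_eq lookup_zero one_neq_zero)
  show "lookup f m = lookup ((\<Sum>i<n. X i * Const (lookup f (single i 1))) + Const (lookup f 0)) m"
  proof (cases "m = 0 \<or> (\<exists>i<n. m = single i 1)")
    case True
    then show ?thesis
    proof
      assume "m = 0"
      then show ?thesis by (simp add: lookup_add lookup_sum XC lookup_Const nz[symmetric] del: One_nat_def)
    next
      assume "\<exists>i<n. m = single i 1"
      then obtain i where i: "i < n" "m = single i 1" by blast
      then show ?thesis
        by (simp add: lookup_add lookup_sum XC lookup_Const inj nz del: One_nat_def)
    qed
  next
    case False
    have "lookup f m = 0"
    proof (rule ccontr)
      assume "lookup f m \<noteq> 0"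
      then have m: "keys m \<subseteq> {..<n}" "wt (\<lambda>_. 1) m \<le> 1"
        using f by (auto simp: polys_def wle_def in_keys_iff)
      from False obtain i where i: "i \<in> keys m" by (metis keys_eq_empty ex_in_conv)
      have s: "(\<Sum>k\<in>keys m. lookup m k) \<le> 1" using m(2) by (simp add: wt_def flip: of_nat_sum)
      have "lookup m i + (\<Sum>k\<in>keys m - {i}. lookup m k) \<le> 1" using s i
        by (simp add: sum.remove)
      moreover have "lookup m i > 0" using i by (simp add: in_keys_iff)
      ultimately have "lookup m i = 1" "(\<Sum>k\<in>keys m - {i}. lookup m k) = 0" by linarith+
      then have "lookup m i = 1" "\<And>k. k \<in> keys m - {i} \<Longrightarrow> lookup m k = 0" by auto
      then have "m = single i 1"
        by (intro poly_mapping_eqI) (metis Diff_iff lookup_single_eq lookup_single_not_eq in_keys_iff singletonD)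
      with False m(1) i show False by auto
    qed
    moreover have "lookup (\<Sum>i<n. X i * Const (lookup f (single i 1))) m = 0"
      unfolding lookup_sum by (rule sum.neutral) (use False in \<open>auto simp: XC\<close>)
    ultimately show ?thesis using False by (simp add: lookup_add lookup_Const)
  qed
qed

text \<open>The linear part of an automorphism of degree one is its Jacobian matrix, up to transposition, so
  its invertibility follows from \<open>Aff_d_iff\<close>.\<close>

lemma degree_one_in_Aff:
  assumes \<phi>: "\<phi> \<in> Aut_carrier n" and deg: "\<And>i. i < n \<Longrightarrow> wle (\<lambda>_. 1) 1 (\<phi> (X i))"
  shows "\<phi> \<in> Aff n"
proof -
  let ?a = "\<lambda>i j. lookup (\<phi> (X i)) (single j 1)"
  let ?b = "\<lambda>i. lookup (\<phi> (X i)) 0"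
  have eq: "\<phi> (X i) = (\<Sum>j<n. X j * Const (?a i j)) + Const (?b i)" if "i < n" for i
    using that by (intro wle_one_affine deg Aut_apply_in[OF \<phi>] X_in_polys) auto
  have J: "pdiff j (\<phi> (X i)) = Const (?a i j)" if "i < n" "j < n" for i j
    by (subst eq[OF that(1)]) (rule pdiff_affine[OF that(2)])
  then have "\<phi> \<in> Aff_d n" using \<phi> by (subst Aff_d_iff) blast+
  then obtain M where M: "M \<in> GL n" "jacobian n \<phi> = map_mat Const M" by (auto simp: Aff_d_def)
  have Ma: "M $$ (i, j) = ?a i j" if "i < n" "j < n" for i j
    using jacobian_entry[OF M that] J[OF that] by simp
  have "transpose_mat M \<in> GL n"
  proof -
    from M(1) obtain B where B: "inverts_mat M B" "inverts_mat B M" and Mc: "M \<in> carrier_mat n n"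
      by (auto simp: GL_def invertible_mat_def)
    then have e: "M * B = 1\<^sub>m n" "B * M = 1\<^sub>m (dim_row B)" by (auto simp: inverts_mat_def)
    then have Bc: "B \<in> carrier_mat n n"
      using Mc by (metis index_mult_mat(3) index_one_mat(3) carrier_matD carrier_matI)
    with e have e': "M * B = 1\<^sub>m n" "B * M = 1\<^sub>m n" by auto
    have "transpose_mat B * transpose_mat M = 1\<^sub>m n"
      using transpose_mult[OF Mc Bc, symmetric] unfolding e'(1) by simp
    moreover have "transpose_mat M * transpose_mat B = 1\<^sub>m n"
      using transpose_mult[OF Bc Mc, symmetric] unfolding e'(2) by simp
    ultimately have "transpose_mat B * transpose_mat M = 1\<^sub>m n" "transpose_mat M * transpose_mat B = 1\<^sub>m n"
      by blast+
    then show ?thesis using Mc Bc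
      by (auto simp: GL_def invertible_mat_def inverts_mat_def)
  qed
  moreover have "affine_form n \<phi> (transpose_mat M) (vec n ?b)"
    unfolding affine_form_def
  proof (intro allI impI)
    fix j assume "j < n"
    moreover have "(\<Sum>i<n. X i * Const (transpose_mat M $$ (i, j))) = (\<Sum>i<n. X i * Const (?a j i))"
      using M(1) \<open>j < n\<close> by (intro sum.cong) (auto simp: GL_def Ma)
    ultimately show "\<phi> (X j) = (\<Sum>i<n. X i * Const (transpose_mat M $$ (i, j))) + Const (vec n ?b $ j)"
      using eq[of j] by simp
  qed
  moreover have "vec n ?b \<in> carrier_vec n" by simp
  ultimately show ?thesis using \<phi> unfolding Aff_def carrier_Aut by blast
qed

lemma wle_one_X: "wle (\<lambda>_. 1) 1 (X i)"
  by (simp add: X_def wle_single)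

lemma swap_in_Aff: "i < n \<Longrightarrow> j < n \<Longrightarrow> swap n i j \<in> Aff n"
  by (intro degree_one_in_Aff swap_in_Aut) (simp_all add: swap_X wle_one_X)

section \<open>Relations between leading monomials in two variables\<close>

lemma wt_pair:
  assumes "keys m \<subseteq> {0, 1}"
  shows "wt w m = real (lookup m 0) * w 0 + real (lookup m 1) * w 1"
  using wt_superset[OF _ assms, of w] by simp

lemma wt_triple:
  assumes "keys m \<subseteq> {0, 1, 2}"
  shows "wt w m = real (lookup m 0) * w 0 + real (lookup m 1) * w 1 + real (lookup m 2) * w 2"
  using wt_superset[OF _ assms, of w] by simp

lemma pair_eqI:
  assumes "keys m \<subseteq> {0, 1}" "keys m' \<subseteq> {0, 1}"
    and "lookup m 0 = lookup m' 0" "lookup m 1 = lookup m' (1::nat)"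
  shows "m = m'"
proof (rule poly_mapping_eqI)
  fix i :: nat
  show "lookup m i = lookup m' i"
  proof (cases "i = 0 \<or> i = 1")
    case False
    then have "i \<notin> keys m" "i \<notin> keys m'" using assms(1,2) by auto
    then show ?thesis by (simp add: in_keys_iff)
  qed (use assms in auto)
qed

lemma single_pair:
  assumes "keys m \<subseteq> {0, 1}"
  shows "single m c = Const c * (X 0 ^ lookup m 0 * X 1 ^ lookup m 1)"
proof -
  have "single m c = Const c * monom_eval X m" by (simp add: monom_eval_X Const_mult_single)
  also have "monom_eval X m = (\<Prod>i\<in>{0, 1}. X i ^ lookup m i)"
    by (rule monom_eval_superset) (use assms in auto)
  finally show ?thesis by simp
qed

lemma sqrt_2_irrational: "sqrt 2 \<notin> \<rat>"
proof
  assume "sqrt 2 \<in> \<rat>"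
  then obtain m n :: nat where n: "n \<noteq> 0" and "\<bar>sqrt 2\<bar> = real m / real n" and cop: "coprime m n"
    by (rule Rats_abs_nat_div_natE)
  then have "real m = sqrt 2 * real n" by simp
  then have "real (m\<^sup>2) = real (2 * n\<^sup>2)" by (simp add: power_mult_distrib)
  then have eq: "m\<^sup>2 = 2 * n\<^sup>2" using of_nat_eq_iff by blast
  then have "2 dvd m\<^sup>2" by simp
  then have m2: "2 dvd m" by simp
  then obtain k where "m = 2 * k" ..
  with eq have "n\<^sup>2 = 2 * k\<^sup>2" by (simp add: power2_eq_square)
  then have "2 dvd n\<^sup>2" by simp
  then have "2 dvd n" by simp
  with m2 cop show False by (metis coprime_common_divisor_nat dvd_refl numeral_eq_one_iff one_eq_numeral_iff semiring_norm(85))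
qed

lemma sqrt_2_independent:
  assumes "real a + real b * sqrt 2 = real a' + real b' * sqrt 2"
  shows "a = a' \<and> b = b'"
proof (cases "b = b'")
  case False
  then have "sqrt 2 = (real a - real a') / (real b' - real b)"
    using assms by (simp add: field_simps)
  then have "sqrt 2 \<in> \<rat>" by (metis Rats_diff Rats_divide Rats_of_nat)
  then show ?thesis using sqrt_2_irrational by blast
qed (use assms in auto)

text \<open>As 1 and \<open>sqrt 2\<close> are linearly independent over the rationals, different monomials in \<open>X 0\<close> and
  \<open>X 1\<close> have different weights. Leading forms for these weights are therefore monomials.\<close>

definition irr_weight :: "nat \<Rightarrow> real" where
  "irr_weight i = (if i = 0 then 1 else sqrt 2)"

lemma irr_weight_ge_1: "irr_weight i \<ge> 1" by (simp add: irr_weight_def)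

lemma wt_irr_weight_inj:
  assumes "keys m \<subseteq> {0, 1}" "keys m' \<subseteq> {0, 1}" "wt irr_weight m = wt irr_weight m'"
  shows "m = m'"
  using sqrt_2_independent[of "lookup m 0" "lookup m 1" "lookup m' 0" "lookup m' 1"] assms
  by (intro pair_eqI) (auto simp: wt_pair irr_weight_def)

lemma lead_irr_weight:
  assumes "f \<in> polys {0, 1}" "f \<noteq> 0"
  obtains m c where "lead irr_weight f = single m c" "c \<noteq> 0" "keys m \<subseteq> {0, 1}" "wt irr_weight m = wdeg irr_weight f"
proof -
  obtain m where m: "m \<in> keys f" "wt irr_weight m = wdeg irr_weight f" using wdeg_attained[OF assms(2)] by blast
  have "lead irr_weight f = single m (lookup f m)"
  proof (rule poly_mapping_eqI)
    fix m'
    have "m = m'" if "m' \<in> keys f" "wt irr_weight m' = wdeg irr_weight f"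
      using assms(1) m that by (intro wt_irr_weight_inj) (auto simp: polys_def)
    then show "lookup (lead irr_weight f) m' = lookup (single m (lookup f m)) m'"
      using m by (auto simp: lead_def lookup_part lookup_single when_def in_keys_iff)
  qed
  with m assms(1) show thesis by (intro that) (auto simp: polys_def in_keys_iff)
qed

lemma power_single:
  obtains m' where "single m c ^ e = (single m' (c ^ e) :: 'k::field mpoly)" "keys m' \<subseteq> keys m"
    "\<And>w. wt w m' = real e * wt w m"
proof -
  have "\<exists>m'. single m c ^ e = (single m' (c ^ e) :: 'k mpoly) \<and> keys m' \<subseteq> keys m
      \<and> (\<forall>w. wt w m' = real e * wt w m)"
  proof (induction e)
    case 0
    have "(1 :: 'k mpoly) = single 0 1" by simp
    then show ?case by (intro exI[of _ 0]) simp
  next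
    case (Suc e)
    then obtain m' where "single m c ^ e = (single m' (c ^ e) :: 'k mpoly)" "keys m' \<subseteq> keys m"
      "\<forall>w. wt w m' = real e * wt w m" by blast
    then show ?case using Poly_Mapping.keys_add[of m m']
      by (intro exI[of _ "m + m'"]) (auto simp: mult_single wt_add algebra_simps)
  qed
  then show thesis using that by blast
qed

text \<open>Since \<open>q\<close> and \<open>r\<close> are coprime, the exponents of two monomials of \<open>H\<close> differ by a multiple of
  \<open>(q, -r)\<close>. So modulo \<open>X 0 ^ q - c X 1 ^ r\<close> they are multiples of one and the same monomial, and
  \<open>H\<close> is a multiple \<open>C\<close> of that monomial. Evaluating at \<open>(F, G)\<close> gives \<open>C = 0\<close>.\<close>

lemma binomial_divides:
  fixes H :: "'k::field mpoly"
  assumes H: "H \<in> polys {0, 1}" "H \<noteq> 0" and hom: "\<And>m. m \<in> keys H \<Longrightarrow> wt v m = N"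
    and v: "v 0 > 0" "v 1 > 0" and qr: "coprime q r" "q > 0" "real q * v 0 = real r * v 1"
    and FG: "F ^ q = Const c * G ^ r" "F \<noteq> 0" "G \<noteq> 0"
    and zero: "subst (\<lambda>i. if i = 0 then F else G) H = 0"
  shows "X 0 ^ q - Const c * X 1 ^ r dvd H"
proof -
  let ?P = "X 0 ^ q - Const c * X 1 ^ r :: 'k mpoly"
  have k: "keys m \<subseteq> {0, 1}" if "m \<in> keys H" for m using H that by (auto simp: polys_def)
  have "keys H \<noteq> {}" using H by simp
  then obtain n where n: "n \<in> keys H" "\<And>m. m \<in> keys H \<Longrightarrow> lookup n 0 \<le> lookup m 0"
    using ex_min_if_finite[of "(\<lambda>m. lookup m 0) ` keys H"]
    by (metis (no_types, lifting) arg_min_if_finite(1) arg_min_least finite_keys)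
  \<comment> \<open>the monomial of \<open>H\<close> with the smallest exponent of \<open>X 0\<close>, to which all others reduce\<close>
  let ?M = "X 0 ^ lookup n 0 * X 1 ^ lookup n 1 :: 'k mpoly"
  have "\<exists>C. ?P dvd single m (lookup H m) - Const C * ?M" if m: "m \<in> keys H" for m
  proof -
    let ?a = "lookup m 0 - lookup n 0" and ?b = "lookup n 1 - lookup m 1"
    have le: "lookup n 0 \<le> lookup m 0" using n m by simp
    have "real (lookup m 0) * v 0 + real (lookup m 1) * v 1
        = real (lookup n 0) * v 0 + real (lookup n 1) * v 1"
      using hom[OF m] hom[OF n(1)] wt_pair[OF k[OF m]] wt_pair[OF k[OF n(1)]] by simp
    then have eq: "(real (lookup m 0) - real (lookup n 0)) * v 0
        = (real (lookup n 1) - real (lookup m 1)) * v 1"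
      by (simp add: algebra_simps)
    have "(real (lookup m 0) - real (lookup n 0)) * real r * v 1
        = (real (lookup m 0) - real (lookup n 0)) * v 0 * real q"
      using qr(3) by (simp add: mult_ac)
    also have "\<dots> = (real (lookup n 1) - real (lookup m 1)) * real q * v 1"
      by (simp add: eq)
    finally have eq': "(real (lookup m 0) - real (lookup n 0)) * real r
        = (real (lookup n 1) - real (lookup m 1)) * real q"
      using v by simp
    have "0 \<le> (real (lookup n 1) - real (lookup m 1)) * real q"
      unfolding eq'[symmetric] using le by simp
    then have le': "lookup m 1 \<le> lookup n 1"
      using qr(2) by (simp add: zero_le_mult_iff)
    have "real (?a * r) = real (?b * q)" using eq' le le' by (simp add: of_nat_diff)
    then have nat: "?a * r = ?b * q" using of_nat_eq_iff by blast
    then have "q dvd ?a * r" by simp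
    then have "q dvd ?a" using qr(1) by (simp add: coprime_dvd_mult_left_iff)
    then obtain j where j: "?a = q * j" ..
    with nat qr(2) have j': "?b = r * j" by (simp add: mult_ac)
    have e: "lookup m 0 = lookup n 0 + q * j" "lookup n 1 = lookup m 1 + r * j"
      using j j' le le' by linarith+
    have "?P dvd (X 0 ^ q) ^ j - (Const c * X 1 ^ r) ^ j"
      unfolding power_diff_sumr2 by (rule dvd_triv_left)
    then have "?P dvd Const (lookup H m) * X 0 ^ lookup n 0 * X 1 ^ lookup m 1
        * ((X 0 ^ q) ^ j - (Const c * X 1 ^ r) ^ j)" by (rule dvd_mult)
    also have "\<dots> = single m (lookup H m) - Const (lookup H m * c ^ j) * ?M"
      unfolding single_pair[OF k[OF m]] e power_add power_mult power_mult_distrib Const_mult Const_power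
      by (simp add: algebra_simps)
    finally show ?thesis by blast
  qed
  then obtain C where C: "?P dvd single m (lookup H m) - Const (C m) * ?M" if "m \<in> keys H" for m
    by metis
  have "?P dvd (\<Sum>m\<in>keys H. single m (lookup H m) - Const (C m) * ?M)"
    by (rule dvd_sum) (rule C)
  then have dvd: "?P dvd H - Const (\<Sum>m\<in>keys H. C m) * ?M"
    by (simp add: sum_subtractf sum_single_lookup Const_sum sum_distrib_right)
  let ?s = "\<lambda>i::nat. if i = 0 then F else G"
  from dvd obtain R where "H - Const (\<Sum>m\<in>keys H. C m) * ?M = ?P * R" ..
  then have "subst ?s (H - Const (\<Sum>m\<in>keys H. C m) * ?M) = subst ?s (?P * R)" by simp
  then have "Const (\<Sum>m\<in>keys H. C m) * (F ^ lookup n 0 * G ^ lookup n 1) = 0"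
    by (simp add: subst_simps zero FG(1))
  then have "(\<Sum>m\<in>keys H. C m) = 0" using FG(2,3) by simp
  with dvd show ?thesis by simp
qed

text \<open>A form \<open>H\<close> that vanishes at two monomials has at least two terms. Comparing the weights of two of
  them shows that the weights \<open>d\<close> and \<open>k\<close> of the monomials \<open>F\<close> and \<open>G\<close> are commensurable, so \<open>F ^ q\<close> and
  \<open>G ^ r\<close> have the same weight for suitable coprime \<open>q\<close>, \<open>r\<close>. Being monomials, they are proportional.\<close>

lemma monomials_dependent:
  assumes F: "F = single mF cF" "cF \<noteq> 0" "keys mF \<subseteq> {0, 1}" "wt irr_weight mF = d" "d > 0"
    and G: "G = single mG cG" "cG \<noteq> 0" "keys mG \<subseteq> {0, 1}" "wt irr_weight mG = k" "k > 0"
    and H: "H \<in> polys {0, 1}" "H \<noteq> (0 :: 'k::field mpoly)"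
    and hom: "\<And>m. m \<in> keys H \<Longrightarrow> wt (\<lambda>i. if i = 0 then d else k) m = N"
    and zero: "subst (\<lambda>i. if i = 0 then F else G) H = 0"
  obtains q r c where "q > 0" "r > 0" "coprime q r" "c \<noteq> 0" "F ^ q = Const c * G ^ r"
    "X 0 ^ q - Const c * X 1 ^ r dvd H"
proof -
  let ?s = "\<lambda>i::nat. if i = 0 then F else G"
  have kH: "keys m \<subseteq> {0, 1}" if "m \<in> keys H" for m using H that by (auto simp: polys_def)
  have nz: "F \<noteq> 0" "G \<noteq> 0" using F G by (auto simp flip: keys_eq_empty)
  obtain m where m: "m \<in> keys H" using H by (metis keys_eq_empty ex_in_conv)
  have "\<exists>m'. m' \<in> keys H \<and> m' \<noteq> m"
  proof (rule ccontr)
    assume "\<not> ?thesis"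
    then have "keys H = {m}" using m by blast
    then have "subst ?s H = Const (lookup H m) * monom_eval ?s m"
      by (simp add: subst_sum_monom_eval)
    moreover have "monom_eval ?s m \<noteq> 0" using nz by (simp add: monom_eval_def)
    ultimately show False using zero m by (simp add: in_keys_iff)
  qed
  then obtain m' where m': "m' \<in> keys H" "m' \<noteq> m" by blast
  have "\<exists>m m'. m \<in> keys H \<and> m' \<in> keys H \<and> lookup m 0 > lookup m' 0"
  proof (rule ccontr)
    assume "\<not> ?thesis"
    then have e: "lookup m 0 = lookup m' 0" using m m' by (metis linorder_neqE_nat)
    have "real (lookup m 0) * d + real (lookup m 1) * k = real (lookup m' 0) * d + real (lookup m' 1) * k"
      using hom[OF m] hom[OF m'(1)] kH[OF m] kH[OF m'(1)] by (simp add: wt_pair)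
    with e G(5) have "lookup m 1 = lookup m' 1" by simp
    then show False using pair_eqI[OF kH[OF m] kH[OF m'(1)] e] m' by simp
  qed
  then obtain m m' where m: "m \<in> keys H" and m': "m' \<in> keys H" and lt: "lookup m 0 > lookup m' 0"
    by blast
  define x where "x = lookup m 0 - lookup m' 0"
  define y where "y = lookup m' 1 - lookup m 1"
  have "real (lookup m 0) * d + real (lookup m 1) * k = real (lookup m' 0) * d + real (lookup m' 1) * k"
    using hom[OF m] hom[OF m'] kH[OF m] kH[OF m'] by (simp add: wt_pair)
  then have eq: "real x * d = (real (lookup m' 1) - real (lookup m 1)) * k"
    using lt by (simp add: x_def of_nat_diff algebra_simps)
  moreover have "real x * d > 0" using lt F(5) by (simp add: x_def)
  ultimately have "real (lookup m' 1) - real (lookup m 1) > 0" using G(5)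
    by (simp add: zero_less_mult_iff)
  then have xy: "x > 0" "y > 0" "real x * d = real y * k"
    using lt eq by (auto simp: x_def y_def of_nat_diff)
  define q where "q = x div gcd x y"
  define r where "r = y div gcd x y"
  have g: "x = q * gcd x y" "y = r * gcd x y" by (simp_all add: q_def r_def)
  have cop: "coprime q r" unfolding q_def r_def by (rule div_gcd_coprime) (use xy in auto)
  have pos: "q > 0" "r > 0" using g xy by (metis gr0I mult_zero_left less_numeral_extra(3))+
  have "real q * d * real (gcd x y) = real x * d" by (subst (2) g(1)) simp
  also have "\<dots> = real r * k * real (gcd x y)" unfolding xy(3) by (subst g(2)) simp
  finally have qr: "real q * d = real r * k" using xy by simp
  obtain a where a: "F ^ q = single a (cF ^ q)" "keys a \<subseteq> {0, 1}" "wt irr_weight a = real q * d"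
    using power_single[of mF cF q] F by (metis order_trans)
  obtain b where b: "G ^ r = single b (cG ^ r)" "keys b \<subseteq> {0, 1}" "wt irr_weight b = real r * k"
    using power_single[of mG cG r] G by (metis order_trans)
  have "a = b" using a b qr by (intro wt_irr_weight_inj) auto
  define c where "c = cF ^ q / cG ^ r"
  have FG: "F ^ q = Const c * G ^ r"
    using G(2) by (simp add: a b \<open>a = b\<close> c_def Const_mult_single)
  have "X 0 ^ q - Const c * X 1 ^ r dvd H"
    by (rule binomial_divides[where v = "\<lambda>i. if i = 0 then d else k" and N = N and F = F and G = G])
      (use H hom F G cop pos qr FG nz zero in auto)
  moreover have "c \<noteq> 0" using F(2) G(2) by (simp add: c_def)
  ultimately show thesis using that pos cop FG by blast
qed

section \<open>One-parameter families\<close>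

definition Jac :: "'k mpoly \<Rightarrow> 'k mpoly \<Rightarrow> 'k::field mpoly" where
  "Jac f g = pdiff 0 f * pdiff 1 g - pdiff 1 f * pdiff 0 g"

lemma Jac_subst:
  assumes "f \<in> polys {0, 1}" "g \<in> polys {0, 1}"
  shows "Jac (subst s f) (subst s g) = subst s (Jac f g) * Jac (s 0) (s 1)"
proof -
  have "pdiff j (subst s h) = subst s (pdiff 0 h) * pdiff j (s 0) + subst s (pdiff 1 h) * pdiff j (s 1)"
    if "h \<in> polys {0, 1}" for h j
    using pdiff_subst[OF that, of j s] by simp
  with assms show ?thesis by (simp add: Jac_def subst_simps algebra_simps)
qed

lemma Jac_X: "Jac (X 0) (X 1) = 1" by (simp add: Jac_def pdiff_X)

text \<open>Below, \<open>X 2\<close> is the parameter of a family of endomorphisms \<open>(U, V)\<close> of the polynomial ring in \<open>X 0\<close>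
  and \<open>X 1\<close>; so \<open>polys (- {2})\<close> contains the constant families.\<close>

lemma free_of_2_iff: "f \<in> polys (- {2}) \<longleftrightarrow> wle (\<lambda>i. if i = 2 then 1 else 0) 0 f"
proof -
  have "(\<lambda>i::nat. if i \<in> - {2} then 0 else (1::real)) = (\<lambda>i. if i = 2 then 1 else 0)" by auto
  then show ?thesis by (simp only: polys_iff_wle[of f "- {2}"])
qed

text \<open>Let \<open>D\<close> and \<open>E\<close> be the degrees of \<open>U\<close> and \<open>V\<close> in the parameter. The fixed binomial gives
  \<open>q D = r E\<close>. Solving its two partial derivatives for \<open>q U ^ (q - 1)\<close> by Cramer's rule gives
  \<open>(q - 1) D \<le> E\<close>, unless the characteristic divides \<open>q\<close>; likewise \<open>(r - 1) E \<le> D\<close>, unless it divides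
  \<open>r\<close>. As it cannot divide both of the coprime numbers, one inequality holds, and for \<open>q, r \<ge> 2\<close> it
  contradicts \<open>q D = r E\<close> if \<open>D > 0\<close>.\<close>

lemma family_constant:
  fixes U V :: "'k::field mpoly"
  assumes Jac: "Jac U V = 1"
    and eq: "U ^ q - Const c * V ^ r = X 0 ^ q - Const c * X 1 ^ r"
    and c: "c \<noteq> 0" and qr: "coprime q r" "q \<ge> 2" "r \<ge> 2"
  shows "U \<in> polys (- {2}) \<and> V \<in> polys (- {2})"
proof -
  note jac = Jac[unfolded Jac_def]
  let ?t = "\<lambda>i::nat. if i = 2 then 1 else (0::real)"
  obtain q' where q': "q = Suc q'" using qr by (cases q) auto
  obtain r' where r': "r = Suc r'" using qr by (cases r) auto
  have nz: "U \<noteq> 0" "V \<noteq> 0" using jac by auto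
  define D where "D = wdeg ?t U"
  define E where "E = wdeg ?t V"
  have DE: "D \<ge> 0" "E \<ge> 0" unfolding D_def E_def using nz by (auto intro!: wdeg_nonneg)
  have wU: "wle ?t D U" "wle ?t E V" by (simp_all add: D_def E_def wle_wdeg)
  have wX: "wle ?t 0 (X 0 ^ a)" "wle ?t 0 (X 1 ^ a)" for a
    by (simp_all add: X_power wle_single)
  have wC: "wle ?t 0 (Const a)" for a by (simp add: wle_Const)
  have wU': "wle ?t D (pdiff 0 U)" "wle ?t D (pdiff 1 U)" "wle ?t E (pdiff 0 V)" "wle ?t E (pdiff 1 V)"
    using wle_pdiff[OF wU(1), of 0] wle_pdiff[OF wU(1), of 1]
      wle_pdiff[OF wU(2), of 0] wle_pdiff[OF wU(2), of 1] by simp_all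
  let ?q = "Const (of_nat q) :: 'k mpoly" and ?r = "Const (of_nat r) :: 'k mpoly"
  have p: "pdiff j (U ^ q) = ?q * U ^ q' * pdiff j U" "pdiff j (V ^ r) = ?r * V ^ r' * pdiff j V"
    "pdiff j (X 0 ^ q) = ?q * X 0 ^ q' * pdiff j (X 0)" "pdiff j (X 1 ^ r) = ?r * X 1 ^ r' * pdiff j (X 1)" for j
    by (simp_all add: q' r' pdiff_power Const_of_nat del: power_Suc of_nat_Suc)
  have A: "?q * U ^ q' * pdiff j U - Const c * (?r * V ^ r' * pdiff j V)
      = ?q * X 0 ^ q' * pdiff j (X 0) - Const c * (?r * X 1 ^ r' * pdiff j (X 1))" for j
    using arg_cong[OF eq, of "pdiff j"] by (simp only: pdiff_diff pdiff_Const_mult p)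
  note A0 = A[of 0] and A1 = A[of 1]
  have B1: "?q * U ^ q' = ?q * X 0 ^ q' * pdiff 1 V + Const c * ?r * X 1 ^ r' * pdiff 0 V"
  proof -
    have "?q * U ^ q' * (pdiff 0 U * pdiff 1 V - pdiff 1 U * pdiff 0 V)
      = (?q * U ^ q' * pdiff 0 U - Const c * (?r * V ^ r' * pdiff 0 V)) * pdiff 1 V
      - (?q * U ^ q' * pdiff 1 U - Const c * (?r * V ^ r' * pdiff 1 V)) * pdiff 0 V"
      by (simp add: algebra_simps)
    also have "\<dots> = ?q * X 0 ^ q' * pdiff 1 V + Const c * ?r * X 1 ^ r' * pdiff 0 V"
      unfolding A0 A1 by (simp add: pdiff_X algebra_simps)
    finally show ?thesis by (simp only: jac mult_1_right)
  qed
  have B2: "Const c * ?r * V ^ r' = ?q * X 0 ^ q' * pdiff 1 U + Const c * ?r * X 1 ^ r' * pdiff 0 U"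
  proof -
    have "Const c * ?r * V ^ r' * (pdiff 0 U * pdiff 1 V - pdiff 1 U * pdiff 0 V)
      = (?q * U ^ q' * pdiff 0 U - Const c * (?r * V ^ r' * pdiff 0 V)) * pdiff 1 U
      - (?q * U ^ q' * pdiff 1 U - Const c * (?r * V ^ r' * pdiff 1 V)) * pdiff 0 U"
      by (simp add: algebra_simps)
    also have "\<dots> = ?q * X 0 ^ q' * pdiff 1 U + Const c * ?r * X 1 ^ r' * pdiff 0 U"
      unfolding A0 A1 by (simp add: pdiff_X algebra_simps)
    finally show ?thesis by (simp only: jac mult_1_right)
  qed
  have mult0: "wle ?t e (f * g)" if "wle ?t 0 f" "wle ?t e g" for e f g
    using wle_mult[OF that] by simp
  have deg1: "real q' * D \<le> E" if "of_nat q \<noteq> (0::'k)"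
  proof -
    have "wle ?t E (?q * U ^ q')" unfolding B1
      by (intro wle_add mult0 wU' wX wC mult0[of _ 0])
    then have "wdeg ?t (?q * U ^ q') \<le> E" using that nz by (intro wdeg_le) auto
    then show ?thesis using that nz by (simp add: wdeg_Const_mult wdeg_power D_def del: of_nat_Suc)
  qed
  have deg2: "real r' * E \<le> D" if "of_nat r \<noteq> (0::'k)"
  proof -
    have "wle ?t D (Const c * ?r * V ^ r')" unfolding B2
      by (intro wle_add mult0 wU' wX wC mult0[of _ 0])
    then have "wdeg ?t (Const (c * of_nat r) * V ^ r') \<le> D" using that nz c
      by (intro wdeg_le) (auto simp: Const_mult)
    then show ?thesis using that nz c by (simp add: wdeg_Const_mult wdeg_power E_def del: of_nat_Suc)
  qed
  have deg: "real q * D = real r * E"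
  proof (rule antisym)
    have e1: "U ^ q = Const c * V ^ r + (X 0 ^ q - Const c * X 1 ^ r)"
      using eq by (simp add: algebra_simps)
    have "wle ?t (real r * E) (U ^ q)" unfolding e1
    proof (intro wle_add)
      show "wle ?t (real r * E) (Const c * V ^ r)"
        using wle_part_power[OF wU(2), of r] by (intro mult0 wC) auto
      show "wle ?t (real r * E) (X 0 ^ q - Const c * X 1 ^ r)"
        using DE by (intro wle_mono[of _ 0, OF wle_diff] mult0 wX wC) simp
    qed
    then show "real q * D \<le> real r * E"
      using wdeg_le[of "U ^ q"] nz by (auto simp: wdeg_power D_def)
    have e2: "Const c * V ^ r = U ^ q - (X 0 ^ q - Const c * X 1 ^ r)"
      using eq by (simp add: algebra_simps)
    have "wle ?t (real q * D) (Const c * V ^ r)" unfolding e2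
    proof (intro wle_diff[of _ _ "U ^ q"])
      show "wle ?t (real q * D) (U ^ q)"
        using wle_part_power[OF wU(1), of q] by auto
      show "wle ?t (real q * D) (X 0 ^ q - Const c * X 1 ^ r)"
        using DE by (intro wle_mono[of _ 0, OF wle_diff] mult0 wX wC) simp
    qed
    then have "wdeg ?t (Const c * V ^ r) \<le> real q * D" using nz c by (intro wdeg_le) auto
    then show "real r * E \<le> real q * D"
      using nz c by (simp add: wdeg_Const_mult wdeg_power E_def)
  qed
  have no: "D = 0" if "of_nat a \<noteq> (0::'k)" "coprime a b" "a \<ge> 2" "b \<ge> 2" "(real a - 1) * D \<le> E"
    "real a * D = real b * E" "D \<ge> 0" for a b :: nat and D E :: real
  proof (rule ccontr)
    assume "D \<noteq> 0"
    with that have D: "D > 0" by simp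
    have "real b * ((real a - 1) * D) \<le> real b * E" using that by (intro mult_left_mono) auto
    also have "\<dots> = real a * D" using that by simp
    finally have "(real b * (real a - 1)) * D \<le> real a * D" by (simp add: mult_ac)
    then have le: "real b * (real a - 1) \<le> real a" using D by simp
    have "2 * (real a - 1) \<le> real b * (real a - 1)" using that by (intro mult_right_mono) auto
    from order_trans[OF this le] have "real a \<le> 2" by simp
    then have "a = 2" using that by simp
    with le have "real b \<le> 2" by simp
    then have "b = 2" using that by simp
    with \<open>a = 2\<close> that(2) show False by simp
  qed
  have "D = 0 \<and> E = 0"
  proof (cases "of_nat q = (0::'k)")
    case False
    have "real q - 1 = real q'" by (simp add: q')
    with deg1[OF False] have "D = 0" using no[OF False qr _ deg] DE by simp
    with deg qr show ?thesis by simp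
  next
    case True
    have "of_nat r \<noteq> (0::'k)"
    proof
      assume "of_nat r = (0::'k)"
      with True have "CHAR('k) dvd q" "CHAR('k) dvd r" by (simp_all add: of_nat_eq_0_iff_char_dvd)
      with qr(1) have "is_unit (CHAR('k))" by (rule coprime_common_divisor)
      then show False by simp
    qed
    moreover have "real r - 1 = real r'" by (simp add: r')
    ultimately have "E = 0" using no[of r q E D] qr deg deg2 DE by (simp add: coprime_commute)
    with deg qr show ?thesis by simp
  qed
  then show ?thesis using wU by (simp add: free_of_2_iff)
qed

text \<open>This keeps the variable \<open>X 1\<close> from being rewritten to \<open>X (Suc 0)\<close>.\<close>

declare One_nat_def [simp del]

lemma lessThan_2: "{..<2} = {0, 1::nat}" by auto

lemma less_2_iff: "i < 2 \<longleftrightarrow> i = 0 \<or> i = (1::nat)" by auto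

lemma lookup_subst_zero:
  "lookup (subst (X(j := 0)) f) m = (if lookup m j = 0 then lookup f m else 0)"
proof -
  have mono: "monom_eval (X(j := 0)) k = (if lookup k j = 0 then single k 1 else (0 :: 'a mpoly))" for k
  proof (cases "lookup k j = 0")
    case True
    then have "monom_eval (X(j := 0)) k = (monom_eval X k :: 'a mpoly)"
      unfolding monom_eval_def by (intro prod.cong) (auto simp: in_keys_iff)
    with True show ?thesis by (simp add: monom_eval_X)
  next
    case False
    then have "j \<in> keys k" by (simp add: in_keys_iff)
    then have "monom_eval (X(j := 0)) k = (0 :: 'a mpoly)"
      unfolding monom_eval_def using False by (intro prod_zero) (auto intro!: bexI[of _ j])
    with False show ?thesis by simp
  qed
  have "lookup (subst (X(j := 0)) f) m
      = (\<Sum>k\<in>keys f. if k = m then (if lookup m j = 0 then lookup f m else 0) else 0)"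
    unfolding subst_sum_monom_eval lookup_sum
    by (rule sum.cong) (auto simp: mono Const_mult_single lookup_single when_def)
  then show ?thesis by (auto simp: in_keys_iff)
qed

section \<open>Leading terms of plane automorphisms\<close>

lemma Jac_Aut:
  assumes \<phi>: "\<phi> \<in> Aut_carrier 2" and \<psi>: "\<psi> = inv\<^bsub>Aut 2\<^esub> \<phi>"
  obtains a where "Jac (\<phi> (X 0)) (\<phi> (X 1)) = Const a"
    "Const a * Jac (\<psi> (X 0)) (\<psi> (X 1)) = 1"
proof -
  have inv: "\<psi> \<in> Aut_carrier 2" using \<psi> \<phi> Aut_inv_in by simp
  have X: "X i \<in> polys {..<2}" if "i < 2" for i using that by (simp add: X_in_polys)
  have pol: "\<phi> (X i) \<in> polys {0, 1}" "\<psi> (X i) \<in> polys {0, 1}" if "i < 2" for i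
    using Aut_apply_in[OF \<phi> X[OF that]] Aut_apply_in[OF inv X[OF that]] by (simp_all add: lessThan_2)
  have eq: "subst (\<lambda>i. \<phi> (X i)) (\<psi> (X i)) = X i" "subst (\<lambda>i. \<psi> (X i)) (\<phi> (X i)) = X i" if "i < 2" for i
    using Aut_eq_subst[OF \<phi> Aut_apply_in[OF inv X[OF that]]] Aut_eq_subst[OF inv Aut_apply_in[OF \<phi> X[OF that]]]
      Aut_inv_apply[OF \<phi> X[OF that]] \<psi> by simp_all
  let ?J = "Jac (\<phi> (X 0)) (\<phi> (X 1))" and ?I = "Jac (\<psi> (X 0)) (\<psi> (X 1))"
  have 1: "subst (\<lambda>i. \<phi> (X i)) ?I * ?J = 1"
    using Jac_subst[OF pol(2)[of 0] pol(2)[of 1], of "\<lambda>i. \<phi> (X i)"]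
    unfolding eq(1)[of 0, simplified] eq(1)[of 1, simplified] Jac_X by simp
  have 2: "subst (\<lambda>i. \<psi> (X i)) ?J * ?I = 1"
    using Jac_subst[OF pol(1)[of 0] pol(1)[of 1], of "\<lambda>i. \<psi> (X i)"]
    unfolding eq(2)[of 0, simplified] eq(2)[of 1, simplified] Jac_X by simp
  have "?J * subst (\<lambda>i. \<phi> (X i)) ?I = 1" using 1 by (simp add: mult.commute)
  then obtain a where a: "?J = Const a" by (rule unit_is_Const)
  with 2 show thesis by (intro that[of a]) simp_all
qed

text \<open>Let \<open>h = \<psi> (X e)\<close>. In the coordinates \<open>\<psi> (X 0)\<close>, \<open>\<psi> (X 1)\<close> of the plane, translation of the
  coordinate other than \<open>h\<close> by the parameter is a nonconstant family with Jacobian determinant 1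
  that fixes \<open>h\<close>. Give the parameter the weight \<open>s\<close> for which the components just keep the degrees \<open>v 0\<close>
  and \<open>v 1\<close> that they have at parameter 0. The leading forms of the components then still depend on
  the parameter, and they inherit all the identities: they fix the leading form of \<open>h\<close>.\<close>

lemma homogeneous_family:
  fixes \<phi> :: "'k::field mpoly \<Rightarrow> 'k mpoly" and v :: "nat \<Rightarrow> real"
  assumes \<phi>: "\<phi> \<in> Aut_carrier 2" and e: "e < 2" and \<psi>: "\<psi> = inv\<^bsub>Aut 2\<^esub> \<phi>"
  obtains U V where "subst (X(2 := 0)) U = X 0" "subst (X(2 := 0)) V = X 1"
    "Jac U V = 1"
    "subst (\<lambda>i. if i = 0 then U else V) (lead v (\<psi> (X e))) = lead v (\<psi> (X e))"
    "\<not> (U \<in> polys (- {2}) \<and> V \<in> polys (- {2}))"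
proof -
  have inv: "\<psi> \<in> Aut_carrier 2" using \<psi> \<phi> Aut_inv_in by simp
  have X: "X i \<in> polys {..<2}" if "i < 2" for i using that by (simp add: X_in_polys)
  have pol: "\<phi> (X i) \<in> polys {0, 1}" "\<psi> (X i) \<in> polys {0, 1}" if "i < 2" for i
    using Aut_apply_in[OF \<phi> X[OF that]] Aut_apply_in[OF inv X[OF that]] by (simp_all add: lessThan_2)
  have eq: "subst (\<lambda>i. \<phi> (X i)) (\<psi> (X i)) = X i" "subst (\<lambda>i. \<psi> (X i)) (\<phi> (X i)) = X i" if "i < 2" for i
    using Aut_eq_subst[OF \<phi> Aut_apply_in[OF inv X[OF that]]] Aut_eq_subst[OF inv Aut_apply_in[OF \<phi> X[OF that]]]
      Aut_inv_apply[OF \<phi> X[OF that]] \<psi> by simp_all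
  let ?z = "X(2 := 0) :: nat \<Rightarrow> 'k mpoly"
  define \<sigma> where "\<sigma> i = (if i = e then \<psi> (X i) else \<psi> (X i) + X 2)" for i
  define U where "U = subst \<sigma> (\<phi> (X 0))"
  define V where "V = subst \<sigma> (\<phi> (X 1))"
  let ?UV = "\<lambda>i::nat. if i = 0 then U else V"
  have UVi: "?UV i = subst \<sigma> (\<phi> (X i))" if "i < 2" for i
    using that by (auto simp: U_def V_def less_2_iff)
  have \<sigma>_pol: "\<sigma> i \<in> polys {0, 1, 2}" if "i < 2" for i
  proof -
    have "\<psi> (X i) \<in> polys {0, 1, 2}" using pol(2)[OF that] polys_mono[of "{0, 1}" "{0, 1, 2::nat}"] by auto
    then show ?thesis by (auto simp: \<sigma>_def intro!: polys_add X_in_polys)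
  qed
  have UV_pol: "U \<in> polys {0, 1, 2}" "V \<in> polys {0, 1, 2}"
    unfolding U_def V_def using pol(1) \<sigma>_pol by (auto intro!: subst_in_polys[where V = "{0, 1}"])
  have z\<sigma>: "subst ?z (\<sigma> i) = \<psi> (X i)" if "i < 2" for i
  proof -
    have "subst ?z (\<psi> (X i)) = \<psi> (X i)" by (rule subst_ident_on[OF pol(2)[OF that]]) auto
    then show ?thesis by (auto simp: \<sigma>_def subst_add)
  qed
  have zUV: "subst ?z (?UV i) = X i" if "i < 2" for i
  proof -
    have "subst ?z (?UV i) = subst (\<lambda>i. subst ?z (\<sigma> i)) (\<phi> (X i))"
      unfolding UVi[OF that] subst_subst ..
    also have "\<dots> = subst (\<lambda>i. \<psi> (X i)) (\<phi> (X i))"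
      by (rule subst_cong[OF pol(1)[OF that]]) (use z\<sigma> in auto)
    finally show ?thesis using eq(2)[OF that] by simp
  qed
  have \<psi>UV: "subst ?UV (\<psi> (X i)) = \<sigma> i" if "i < 2" for i
  proof -
    have "subst ?UV (\<psi> (X i)) = subst (\<lambda>i. subst \<sigma> (\<phi> (X i))) (\<psi> (X i))"
      by (rule subst_cong[OF pol(2)[OF that]]) (auto simp: U_def V_def)
    also have "\<dots> = \<sigma> i" by (simp add: subst_subst[symmetric] eq(1)[OF that])
    finally show ?thesis .
  qed
  have jac: "Jac U V = 1"
  proof -
    obtain a where a: "Jac (\<phi> (X 0)) (\<phi> (X 1)) = Const a" "Const a * Jac (\<psi> (X 0)) (\<psi> (X 1)) = 1"
      using Jac_Aut[OF \<phi> \<psi>] .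
    have "pdiff j (\<sigma> i) = pdiff j (\<psi> (X i))" if "j < 2" for i j
      using that by (simp add: \<sigma>_def pdiff_add pdiff_X)
    then have "Jac (\<sigma> 0) (\<sigma> 1) = Jac (\<psi> (X 0)) (\<psi> (X 1))" by (simp add: Jac_def)
    with a show ?thesis
      using Jac_subst[OF pol(1)[of 0] pol(1)[of 1], of \<sigma>] by (simp add: U_def V_def)
  qed
  have moves: "\<not> (U \<in> polys (- {2}) \<and> V \<in> polys (- {2}))"
  proof
    assume "U \<in> polys (- {2}) \<and> V \<in> polys (- {2})"
    then have "subst ?UV (\<psi> (X (1 - e))) \<in> polys (- {2})"
      using e pol(2)[of "1 - e"] by (intro subst_in_polys[where V = "{0, 1}"]) auto
    moreover have "1 - e \<noteq> e" using e by arith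
    ultimately have "\<psi> (X (1 - e)) + X 2 \<in> polys (- {2})" using e \<psi>UV[of "1 - e"] by (simp add: \<sigma>_def)
    moreover have "\<psi> (X (1 - e)) \<in> polys (- {2})"
      using pol(2)[of "1 - e"] e polys_mono[of "{0, 1}" "- {2::nat}"] by auto
    ultimately have "\<psi> (X (1 - e)) + X 2 - \<psi> (X (1 - e)) \<in> polys (- {2})" by (rule polys_diff)
    then have "(X 2 :: 'k mpoly) \<in> polys (- {2})" by simp
    then show False by (simp add: polys_def X_def)
  qed
  \<comment> \<open>Weigh the parameter \<open>X 2\<close> as heavily as possible without raising the degrees of the family.\<close>
  let ?rat = "\<lambda>i m. (v i - (real (lookup m 0) * v 0 + real (lookup m 1) * v 1)) / real (lookup m 2)"
  define S where "S = ?rat 0 ` {m \<in> keys U. lookup m 2 > 0} \<union> ?rat 1 ` {m \<in> keys V. lookup m 2 > 0}"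
  have fin: "finite S" by (simp add: S_def)
  have ne: "S \<noteq> {}"
  proof
    assume "S = {}"
    then have "lookup m 2 = 0" if "m \<in> keys U \<union> keys V" for m using that by (auto simp: S_def)
    then have "U \<in> polys (- {2}) \<and> V \<in> polys (- {2})" by (auto simp: polys_def in_keys_iff)
    with moves show False ..
  qed
  define s where "s = Min S"
  define w where "w = v(2 := s)"
  have wt_w: "wt w m = real (lookup m 0) * v 0 + real (lookup m 1) * v 1 + real (lookup m 2) * s"
    if "keys m \<subseteq> {0, 1, 2}" for m
    using wt_triple[OF that, of w] by (simp add: w_def)
  have kUV: "keys m \<subseteq> {0, 1, 2}" if "m \<in> keys (?UV i)" for i m
    using UV_pol that by (auto simp: polys_def split: if_splits)
  have le: "wle w (v i) (?UV i)" if i: "i < 2" for i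
    unfolding wle_def
  proof
    fix m assume m: "m \<in> keys (?UV i)"
    show "wt w m \<le> v i"
    proof (cases "lookup m 2 = 0")
      case True
      then have "lookup (X i :: 'k mpoly) m = lookup (?UV i) m"
        using zUV[OF i] lookup_subst_zero[of 2 "?UV i" m] by simp
      with m have "lookup (X i :: 'k mpoly) m \<noteq> 0" by (simp add: in_keys_iff)
      then have "m = single i 1" by (simp add: X_def lookup_single when_def split: if_splits)
      with i show ?thesis by (simp add: w_def)
    next
      case False
      have "?rat i m \<in> S" using m False i by (auto simp: S_def less_2_iff)
      then have "s \<le> ?rat i m" unfolding s_def using fin by (rule Min_le[rotated])
      then have "s * real (lookup m 2) \<le> v i - (real (lookup m 0) * v 0 + real (lookup m 1) * v 1)"
        using False by (simp add: pos_le_divide_eq)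
      then show ?thesis using wt_w[OF kUV[OF m]] by (simp add: mult.commute)
    qed
  qed
  let ?U = "part w (v 0) U" and ?V = "part w (v 1) V"
  have zpart: "subst ?z (part w (v i) (?UV i)) = X i" if i: "i < 2" for i
  proof (rule poly_mapping_eqI)
    fix m
    have "lookup (X i :: 'k mpoly) m = (if lookup m 2 = 0 then lookup (?UV i) m else 0)"
      using zUV[OF i] lookup_subst_zero[of 2 "?UV i" m] by simp
    moreover have "wt w m = v i" if "lookup (X i :: 'k mpoly) m \<noteq> 0"
    proof -
      have "m = single i 1" using that by (simp add: X_def lookup_single when_def split: if_splits)
      with i show ?thesis by (simp add: w_def)
    qed
    ultimately show "lookup (subst ?z (part w (v i) (?UV i))) m = lookup (X i) m"
      by (cases "lookup (X i :: 'k mpoly) m = 0") (auto simp: lookup_subst_zero lookup_part)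
  qed
  have "?rat 0 m = s \<Longrightarrow> lookup m 2 > 0 \<Longrightarrow> m \<in> keys U \<Longrightarrow> m \<in> keys ?U"
    "?rat 1 m = s \<Longrightarrow> lookup m 2 > 0 \<Longrightarrow> m \<in> keys V \<Longrightarrow> m \<in> keys ?V" for m
    using wt_w[of m] kUV[of m 0] kUV[of m 1] by (auto simp: keys_part field_simps)
  moreover have "s \<in> S" unfolding s_def using fin ne by (rule Min_in)
  ultimately have "\<exists>m. m \<in> keys ?U \<union> keys ?V \<and> lookup m 2 > 0"
    unfolding S_def by blast
  then have moves': "\<not> (?U \<in> polys (- {2}) \<and> ?V \<in> polys (- {2}))"
    by (auto simp: polys_def in_keys_iff)
  have U: "wle w (v 0) U" and V: "wle w (v 1) V" using le[of 0] le[of 1] by simp_all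
  have dU: "wle w 0 (pdiff 0 U)" "part w 0 (pdiff 0 U) = pdiff 0 ?U"
      "wle w (v 0 - v 1) (pdiff 1 U)" "part w (v 0 - v 1) (pdiff 1 U) = pdiff 1 ?U"
    using wle_part_pdiff[OF U, of 0] wle_part_pdiff[OF U, of 1] by (simp_all add: w_def)
  have dV: "wle w 0 (pdiff 1 V)" "part w 0 (pdiff 1 V) = pdiff 1 ?V"
      "wle w (v 1 - v 0) (pdiff 0 V)" "part w (v 1 - v 0) (pdiff 0 V) = pdiff 0 ?V"
    using wle_part_pdiff[OF V, of 1] wle_part_pdiff[OF V, of 0] by (simp_all add: w_def)
  have "pdiff 0 ?U * pdiff 1 ?V - pdiff 1 ?U * pdiff 0 ?V = part w 0 (Jac U V)"
    using part_mult[OF dU(1) dV(1)] part_mult[OF dU(3) dV(3)]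
    by (simp add: Jac_def part_minus dU dV)
  also have "\<dots> = 1" using part_Const[of w 0 1] by (simp add: jac)
  finally have jac': "pdiff 0 ?U * pdiff 1 ?V - pdiff 1 ?U * pdiff 0 ?V = 1" .
  let ?h = "\<psi> (X e)"
  let ?N = "wdeg v ?h"
  have wv: "wt w m = wt v m" if "m \<in> keys ?h" for m
  proof -
    have "keys m \<subseteq> {0, 1}" using pol(2)[OF e] that by (simp add: polys_def)
    then show ?thesis by (intro wt_cong) (auto simp: w_def)
  qed
  have p: "part w ?N ?h = part v ?N ?h"
  proof (rule poly_mapping_eqI)
    fix m
    show "lookup (part w ?N ?h) m = lookup (part v ?N ?h) m"
      using wv[of m] by (cases "m \<in> keys ?h") (simp_all add: lookup_part in_keys_iff)
  qed
  have "subst ?UV ?h = ?h" using \<psi>UV[OF e] by (simp add: \<sigma>_def)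
  then have "part w ?N ?h = part w ?N (subst ?UV ?h)" by simp
  also have "\<dots> = subst (\<lambda>i. part w (v i) (?UV i)) (part v ?N ?h)"
    by (rule part_subst[OF pol(2)[OF e] wle_wdeg le]) auto
  also have "\<dots> = subst (\<lambda>i. if i = 0 then ?U else ?V) (part v ?N ?h)"
    by (rule subst_cong[OF part_in_polys[OF pol(2)[OF e]]]) auto
  finally have "subst (\<lambda>i. if i = 0 then ?U else ?V) (lead v ?h) = lead v ?h"
    unfolding lead_def using p by (rule trans[OF sym])
  then show thesis
    using that[of ?U ?V] zpart[of 0] zpart[of 1] jac' moves' by (simp add: Jac_def)
qed

lemma irr_weight_nonneg: "irr_weight i \<ge> 0" by (simp add: irr_weight_def)

text \<open>Components of automorphisms are not constant, and all variables weigh at least 1.\<close>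

lemma wdeg_Aut_ge_1:
  assumes \<phi>: "\<phi> \<in> Aut_carrier n" and i: "i < n"
  shows "wdeg irr_weight (\<phi> (X i)) \<ge> 1" "\<phi> (X i) \<noteq> 0"
proof -
  have X: "X i \<in> polys {..<n}" using i by (simp add: X_in_polys)
  have nc: "\<phi> (X i) \<noteq> Const c" for c
  proof
    assume "\<phi> (X i) = Const c"
    then have "X i = Const c"
      using Aut_inv_apply(2)[OF \<phi> X] Aut_inv_apply(2)[OF \<phi> Const_in_polys[of c]] Aut_Const[OF \<phi>, of c] by simp
    then have "lookup (X i) 0 = c \<and> lookup (X i) (single i 1) = lookup (Const c) (single i 1)"
      by (simp add: lookup_Const)
    then show False by (auto simp: X_def lookup_Const lookup_single when_def split: if_splits dest: arg_cong[where f = keys])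
  qed
  show nz: "\<phi> (X i) \<noteq> 0" using nc[of 0] by simp
  have "\<exists>m\<in>keys (\<phi> (X i)). m \<noteq> 0"
  proof (rule ccontr)
    assume "\<not> ?thesis"
    then have "\<phi> (X i) \<in> polys {}" by (auto simp: polys_def)
    with nc show False by (auto simp: polys_empty_iff)
  qed
  then obtain m j where m: "m \<in> keys (\<phi> (X i))" "j \<in> keys m" by (metis keys_eq_empty ex_in_conv)
  have "1 * 1 \<le> real (lookup m j) * irr_weight j"
    using m(2) irr_weight_ge_1[of j] by (intro mult_mono) (auto simp: in_keys_iff)
  also have "\<dots> \<le> wt irr_weight m" unfolding wt_def
    using m(2) irr_weight_nonneg by (intro member_le_sum) auto
  also have "\<dots> \<le> wdeg irr_weight (\<phi> (X i))" using wle_wdeg[of irr_weight "\<phi> (X i)"] m(1) by (simp add: wle_def)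
  finally show "wdeg irr_weight (\<phi> (X i)) \<ge> 1" by simp
qed

text \<open>The theorem of Jung and van der Kulk. Consider the inverse \<open>\<psi>\<close> of \<open>\<phi>\<close> and give \<open>X 0\<close>, \<open>X 1\<close> the
  degrees \<open>d\<close>, \<open>k\<close> of the components of \<open>\<phi>\<close>. Substituting these components into \<open>\<psi> (X e)\<close> yields
  \<open>X e\<close>. If the leading forms do not cancel, \<open>\<psi> (X e)\<close> has degree at most \<open>sqrt 2 < 2\<close> for weights
  \<open>d, k \<ge> 1\<close>, so it is affine. If they cancel, the leading form of \<open>\<psi> (X e)\<close> is divisible by a binomial
  \<open>X 0 ^ q - c X 1 ^ r\<close>, and a nonconstant family fixing this form excludes \<open>q, r \<ge> 2\<close>.\<close>

theorem plane_automorphism_lead_terms: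
  fixes \<phi> :: "'k::field mpoly \<Rightarrow> 'k mpoly"
  assumes \<phi>: "\<phi> \<in> Aut_carrier 2"
  defines "F \<equiv> lead irr_weight (\<phi> (X 0))" and "G \<equiv> lead irr_weight (\<phi> (X 1))"
  shows "inv\<^bsub>Aut 2\<^esub> \<phi> \<in> Aff 2 \<or>
    (\<exists>c r. c \<noteq> 0 \<and> r \<ge> 1 \<and> (F = Const c * G ^ r \<or> G = Const c * F ^ r))"
proof -
  define \<psi> where "\<psi> = inv\<^bsub>Aut 2\<^esub> \<phi>"
  have inv: "\<psi> \<in> Aut_carrier 2" using \<psi>_def \<phi> Aut_inv_in by simp
  have X: "X i \<in> polys {..<2}" if "i < 2" for i using that by (simp add: X_in_polys)
  have pol: "\<phi> (X i) \<in> polys {0, 1}" "\<psi> (X i) \<in> polys {0, 1}" if "i < 2" for i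
    using Aut_apply_in[OF \<phi> X[OF that]] Aut_apply_in[OF inv X[OF that]] by (simp_all add: lessThan_2)
  have nz: "\<phi> (X i) \<noteq> 0" "\<psi> (X i) \<noteq> 0" if "i < 2" for i
    using wdeg_Aut_ge_1 \<phi> inv that by blast+
  define d where "d = wdeg irr_weight (\<phi> (X 0))"
  define k where "k = wdeg irr_weight (\<phi> (X 1))"
  have dk: "d \<ge> 1" "k \<ge> 1" unfolding d_def k_def using wdeg_Aut_ge_1(1)[OF \<phi>] by simp_all
  let ?v = "\<lambda>i::nat. if i = 0 then d else k"
  let ?FG = "\<lambda>i::nat. if i = 0 then F else G"
  have vi: "wle irr_weight (?v i) (\<phi> (X i))" "part irr_weight (?v i) (\<phi> (X i)) = ?FG i" if "i < 2" for i
    using that wle_wdeg by (auto simp: d_def k_def F_def G_def lead_def less_2_iff)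
  show ?thesis
  proof (cases "\<forall>e<2. subst ?FG (lead ?v (\<psi> (X e))) \<noteq> 0")
    case True
    have "wle (\<lambda>_. 1) 1 (\<psi> (X e))" if e: "e < 2" for e
    proof -
      let ?N = "wdeg ?v (\<psi> (X e))"
      have "part irr_weight ?N (subst (\<lambda>i. \<phi> (X i)) (\<psi> (X e)))
          = subst (\<lambda>i. part irr_weight (?v i) (\<phi> (X i))) (part ?v ?N (\<psi> (X e)))"
        by (rule part_subst[OF pol(2)[OF e] wle_wdeg], rule vi(1)) auto
      also have "\<dots> = subst ?FG (lead ?v (\<psi> (X e)))"
        unfolding lead_def by (rule subst_cong[OF part_in_polys[OF pol(2)[OF e]]], rule vi(2)) auto
      also have "\<dots> \<noteq> 0" using True e by blast
      also have "subst (\<lambda>i. \<phi> (X i)) (\<psi> (X e)) = X e"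
        using Aut_eq_subst[OF \<phi> Aut_apply_in[OF inv X[OF e]]] Aut_inv_apply(1)[OF \<phi> X[OF e]]
        by (simp add: \<psi>_def)
      finally have "part irr_weight ?N (X e :: 'k mpoly) \<noteq> 0" .
      then have "?N = irr_weight e" by (auto simp: X_def part_single split: if_splits)
      also have "\<dots> < 2" using real_sqrt_less_mono[of 2 4] by (simp add: irr_weight_def)
      finally have N: "?N < 2" .
      show ?thesis unfolding wle_def
      proof
        fix m assume m: "m \<in> keys (\<psi> (X e))"
        then have km: "keys m \<subseteq> {0, 1}" using pol(2)[OF e] by (auto simp: polys_def)
        have "real (lookup m 0) * 1 + real (lookup m 1) * 1 \<le> real (lookup m 0) * d + real (lookup m 1) * k"
          using dk by (intro add_mono mult_left_mono) auto
        also have "\<dots> = wt ?v m" using wt_pair[OF km, of ?v] by simp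
        also have "\<dots> \<le> ?N" using wle_wdeg[of ?v "\<psi> (X e)"] m by (simp add: wle_def)
        also note N
        finally have "lookup m 0 + lookup m 1 < 2" by simp
        then show "wt (\<lambda>_. 1) m \<le> 1" using wt_pair[OF km, of "\<lambda>_. 1"] by simp
      qed
    qed
    then have "\<psi> \<in> Aff 2" by (intro degree_one_in_Aff inv)
    then show ?thesis by (simp add: \<psi>_def)
  next
    case False
    then obtain e where e: "e < 2" and zero: "subst ?FG (lead ?v (\<psi> (X e))) = 0" by blast
    let ?H = "lead ?v (\<psi> (X e))"
    have H: "?H \<in> polys {0, 1}" "?H \<noteq> 0"
      using part_in_polys[OF pol(2)[OF e]] lead_neq_0[OF nz(2)[OF e]] unfolding lead_def by blast+
    obtain mF cF where F: "F = single mF cF" "cF \<noteq> 0" "keys mF \<subseteq> {0, 1}" "wt irr_weight mF = d"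
      using lead_irr_weight[OF pol(1)[of 0] nz(1)[of 0]] by (auto simp: F_def d_def)
    obtain mG cG where G: "G = single mG cG" "cG \<noteq> 0" "keys mG \<subseteq> {0, 1}" "wt irr_weight mG = k"
      using lead_irr_weight[OF pol(1)[of 1] nz(1)[of 1]] by (auto simp: G_def k_def)
    obtain q r c where qr: "q > 0" "r > 0" "coprime q r" "c \<noteq> 0" and FG: "F ^ q = Const c * G ^ r"
      and dvd: "X 0 ^ q - Const c * X 1 ^ r dvd ?H"
      by (rule monomials_dependent[OF F _ G _ H, where N = "wdeg ?v (\<psi> (X e))"])
        (use dk zero in \<open>auto simp: lead_def keys_part\<close>)
    have "\<not> (q \<ge> 2 \<and> r \<ge> 2)"
    proof
      assume ge: "q \<ge> 2 \<and> r \<ge> 2"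
      obtain U V where z: "subst (X(2 := 0)) U = X 0" "subst (X(2 := 0)) V = X 1"
        and jac: "Jac U V = 1"
        and HUV: "subst (\<lambda>i. if i = 0 then U else V) ?H = ?H"
        and moves: "\<not> (U \<in> polys (- {2}) \<and> V \<in> polys (- {2}))"
        using homogeneous_family[OF \<phi> e \<psi>_def, of ?v] .
      obtain R where R: "?H = (X 0 ^ q - Const c * X 1 ^ r) * R" using dvd ..
      have "(U ^ q - Const c * V ^ r) * subst (\<lambda>i. if i = 0 then U else V) R = ?H"
        using HUV unfolding R by (simp add: subst_simps)
      moreover have "?H \<in> polys (- {2})" using H(1) polys_mono[of "{0, 1}" "- {2::nat}"] by auto
      ultimately have free: "U ^ q - Const c * V ^ r \<in> polys (- {2})"
        using H(2) polys_factor by metis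
      have "U ^ q - Const c * V ^ r = subst (X(2 := 0)) (U ^ q - Const c * V ^ r)"
        by (rule subst_ident_on[OF free, symmetric]) auto
      also have "\<dots> = X 0 ^ q - Const c * X 1 ^ r" by (simp add: subst_simps z)
      finally show False
        using family_constant[OF jac _ qr(4,3)] ge moves by blast
    qed
    then consider "q = 1" | "r = 1" using qr by linarith
    then show ?thesis
    proof cases
      case 1
      then have "F = Const c * G ^ r" "r \<ge> 1" using FG qr by simp_all
      then show ?thesis using qr by blast
    next
      case 2
      have "Const (1 / c) * F ^ q = (Const (1 / c) * Const c) * G" using FG 2 by (simp add: mult.assoc)
      also have "\<dots> = G" using qr(4) by (simp flip: Const_mult)
      finally have "G = Const (1 / c) * F ^ q" ..
      moreover have "1 / c \<noteq> 0" "q \<ge> 1" using qr by simp_all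
      ultimately show ?thesis by blast
    qed
  qed
qed

section \<open>Plane automorphisms with constant Jacobian matrix\<close>

lemma Aut_hom:
  assumes "\<phi> \<in> Aut_carrier n" "f \<in> polys {..<n}" "g \<in> polys {..<n}"
  shows Aut_add: "\<phi> (f + g) = \<phi> f + \<phi> g" and Aut_diff: "\<phi> (f - g) = \<phi> f - \<phi> g"
    and Aut_times: "\<phi> (f * g) = \<phi> f * \<phi> g" and Aut_power: "\<phi> (f ^ e) = \<phi> f ^ e"
proof -
  have eq: "\<phi> h = subst (\<lambda>i. \<phi> (X i)) h" if "h \<in> polys {..<n}" for h
    by (rule Aut_eq_subst[OF assms(1) that])
  show "\<phi> (f + g) = \<phi> f + \<phi> g" "\<phi> (f - g) = \<phi> f - \<phi> g"
    "\<phi> (f * g) = \<phi> f * \<phi> g" "\<phi> (f ^ e) = \<phi> f ^ e"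
    using assms by (simp_all add: eq[OF assms(2)] eq[OF assms(3)] eq[of "f + g"] eq[of "f - g"]
        eq[of "f * g"] eq[of "f ^ e"] polys_intros subst_simps)
qed

lemma wdeg_lead: "f \<noteq> 0 \<Longrightarrow> wdeg w (lead w f) = wdeg w f"
proof (rule wdeg_eqI)
  assume "f \<noteq> 0"
  have "part w (wdeg w f) (lead w f) = lead w f"
    by (rule poly_mapping_eqI) (simp add: lead_def lookup_part)
  with lead_neq_0[OF \<open>f \<noteq> 0\<close>] show "part w (wdeg w f) (lead w f) \<noteq> 0" by simp
  show "wle w (wdeg w f) (lead w f)" by (auto simp: wle_def lead_def keys_part)
qed

lemma wdeg_diff_less:
  assumes "f \<noteq> 0" "g \<noteq> 0" "f - g \<noteq> 0" "lead w f = lead w g"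
  shows "wdeg w (f - g) < wdeg w f"
proof (rule wdeg_less)
  have e: "wdeg w g = wdeg w f" using assms wdeg_lead by metis
  show "wle w (wdeg w f) (f - g)" using wle_wdeg[of w f] wle_wdeg[of w g] by (auto simp: e intro: wle_diff)
  show "part w (wdeg w f) (f - g) = 0" using assms(4) by (simp add: part_minus lead_def e)
qed (rule assms(3))

lemma lead_Const_mult_power:
  assumes "c \<noteq> 0" "g \<noteq> 0"
  shows "lead w (Const c * g ^ r) = Const c * lead w g ^ r"
proof -
  have "lead w (Const c) = Const c" using assms(1) by (simp add: lead_def wdeg_Const part_Const)
  then show ?thesis using assms by (simp add: lead_mult lead_power)
qed

text \<open>The weights of monomials in two variables form a subset of the real numbers that is well-ordered
  with finite initial segments; \<open>rank f\<close> is the position of the degree of \<open>f\<close> in it.\<close>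

definition rank :: "'k::field mpoly \<Rightarrow> nat" where
  "rank f = card {(a, b). real a * 1 + real b * sqrt 2 < wdeg irr_weight f}"

lemma rank_less:
  assumes f: "f \<in> polys {0, 1}" "f \<noteq> 0" and lt: "wdeg irr_weight f < wdeg irr_weight g"
  shows "rank f < rank g"
  unfolding rank_def
proof (rule psubset_card_mono)
  let ?N = "nat \<lceil>wdeg irr_weight g\<rceil>"
  have "a \<le> ?N \<and> b \<le> ?N" if "real a * 1 + real b * sqrt 2 < wdeg irr_weight g" for a b
  proof -
    have "real b * 1 \<le> real b * sqrt 2" by (intro mult_left_mono) simp_all
    with that have "real a \<le> wdeg irr_weight g" "real b \<le> wdeg irr_weight g" by simp_all
    then show ?thesis by linarith
  qed
  then have "{(a, b). real a * 1 + real b * sqrt 2 < wdeg irr_weight g} \<subseteq> {..?N} \<times> {..?N}" by auto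
  then show "finite {(a, b). real a * 1 + real b * sqrt 2 < wdeg irr_weight g}"
    by (rule finite_subset) simp
  obtain m where m: "m \<in> keys f" "wt irr_weight m = wdeg irr_weight f" using wdeg_attained[OF f(2)] by blast
  then have "keys m \<subseteq> {0, 1}" using f by (auto simp: polys_def)
  from wt_pair[OF this, of irr_weight] have "real (lookup m 0) * 1 + real (lookup m 1) * sqrt 2 = wdeg irr_weight f"
    using m by (simp add: irr_weight_def)
  with lt have "(lookup m 0, lookup m 1) \<in> {(a, b). real a * 1 + real b * sqrt 2 < wdeg irr_weight g}"
    "(lookup m 0, lookup m 1) \<notin> {(a, b). real a * 1 + real b * sqrt 2 < wdeg irr_weight f}" by simp_all
  moreover have "{(a, b). real a * 1 + real b * sqrt 2 < wdeg irr_weight f}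
      \<subseteq> {(a, b). real a * 1 + real b * sqrt 2 < wdeg irr_weight g}" using lt by auto
  ultimately show "{(a, b). real a * 1 + real b * sqrt 2 < wdeg irr_weight f}
      \<subset> {(a, b). real a * 1 + real b * sqrt 2 < wdeg irr_weight g}" by blast
qed

text \<open>A nonconstant polynomial \<open>t\<close> in \<open>X 1\<close> of degree \<open>D\<close> is mapped to a polynomial of degree \<open>D\<close> times that of
  \<open>\<phi> (X 1)\<close>, as powers of the leading term of \<open>\<phi> (X 1)\<close> do not cancel.\<close>

lemma wdeg_univariate:
  assumes \<phi>: "\<phi> \<in> Aut_carrier 2" and t: "t \<in> polys {1}" "t \<notin> polys {}"
  shows "wdeg irr_weight (\<phi> (X 1)) \<le> wdeg irr_weight (\<phi> t)"
proof -
  let ?g = "\<phi> (X 1)"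
  let ?d = "wdeg irr_weight ?g"
  have d: "?d \<ge> 1" "?g \<noteq> 0" using wdeg_Aut_ge_1[OF \<phi>, of 1] by simp_all
  have t0: "t \<noteq> 0" using t(2) by auto
  have t2: "t \<in> polys {..<2}" using t(1) polys_mono[of "{1}" "{..<2::nat}"] by auto
  let ?N = "wdeg (\<lambda>_. ?d) t"
  have wt: "wt (\<lambda>_. ?d) m = real (lookup m 1) * ?d" if "m \<in> keys t" for m
    using wt_superset[of "{1}" m "\<lambda>_. ?d"] that t(1) by (simp add: polys_def)
  obtain m where m: "m \<in> keys t" "m \<noteq> 0"
    using t(2) by (auto simp: polys_def)
  moreover obtain i where "i \<in> keys m" using m(2) by (metis keys_eq_empty ex_in_conv)
  ultimately have "1 \<in> keys m" using t(1) by (auto simp: polys_def)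
  then have "lookup m 1 \<noteq> 0" by (simp add: in_keys_iff)
  then have "1 * ?d \<le> real (lookup m 1) * ?d" using d by (intro mult_right_mono) auto
  also have "\<dots> \<le> ?N" using wle_wdeg[of "\<lambda>_. ?d" t] m(1) unfolding wle_def wt[OF m(1), symmetric] by blast
  finally have N: "?d \<le> ?N" by simp
  obtain k where k: "k \<in> keys t" "wt (\<lambda>_. ?d) k = ?N" using wdeg_attained[OF t0] by blast
  have kk: "keys k \<subseteq> {1}" using k(1) t(1) by (simp add: polys_def)
  have "part (\<lambda>_. ?d) ?N t = single k (lookup t k)"
  proof (rule poly_mapping_eqI)
    fix l
    have "k = l" if "l \<in> keys t" "wt (\<lambda>_. ?d) l = ?N"
    proof (rule pair_eqI)
      have "keys l \<subseteq> {1}" using that(1) t(1) by (simp add: polys_def)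
      then have "0 \<notin> keys l" "0 \<notin> keys k" "keys l \<subseteq> {0, 1}" "keys k \<subseteq> {0, 1}" using kk by auto
      then show "keys l \<subseteq> {0, 1}" "lookup k 0 = lookup l 0" "keys k \<subseteq> {0, 1}"
        by (simp_all add: in_keys_iff)
      have "real (lookup k 1) * ?d = real (lookup l 1) * ?d"
        using that k wt[OF k(1)] wt[OF that(1)] by simp
      then show "lookup k 1 = lookup l 1" using d by simp
    qed
    then show "lookup (part (\<lambda>_. ?d) ?N t) l = lookup (single k (lookup t k)) l"
      using k by (auto simp: lookup_part lookup_single when_def in_keys_iff)
  qed
  note top = this
  have "part irr_weight ?N (subst (\<lambda>i. \<phi> (X i)) t)
      = subst (\<lambda>i. part irr_weight ?d (\<phi> (X i))) (part (\<lambda>_. ?d) ?N t)"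
    by (rule part_subst[OF t(1) wle_wdeg]) (simp add: wle_wdeg)
  also have "\<dots> = subst (\<lambda>i. part irr_weight ?d (\<phi> (X i))) (single k (lookup t k))" by (simp only: top)
  also have "\<dots> = Const (lookup t k) * lead irr_weight ?g ^ lookup k 1"
    using monom_eval_superset[of "{1}" k "\<lambda>i. part irr_weight ?d (\<phi> (X i))"] kk by (simp add: subst_single lead_def)
  also have "\<dots> \<noteq> 0" using k(1) lead_neq_0[OF d(2)] by (simp add: in_keys_iff)
  finally have "part irr_weight ?N (\<phi> t) \<noteq> 0" by (simp add: Aut_eq_subst[OF \<phi> t2])
  moreover have "wle irr_weight ?N (\<phi> t)"
    unfolding Aut_eq_subst[OF \<phi> t2] by (rule wle_subst[OF t(1) wle_wdeg]) (auto simp: wle_wdeg)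
  ultimately have "wdeg irr_weight (\<phi> t) = ?N" by (intro wdeg_eqI)
  with N show ?thesis by simp
qed

lemma subgroup_generate_Aff_BA:
  assumes "subgroup S (Aut n)"
  shows "subgroup (generate (Aut n) (Aff n \<union> (BA n \<inter> S))) (Aut n)"
  by (rule Aut.generate_is_subgroup) (use subgroup.subset[OF assms] in \<open>auto simp: Aff_def BA_def\<close>)

lemma Aut_mult_right_cancel:
  assumes "subgroup S (Aut n)" "\<phi> \<in> Aut_carrier n" "\<epsilon> \<in> S" "\<phi> \<otimes>\<^bsub>Aut n\<^esub> \<epsilon> \<in> S"
  shows "\<phi> \<in> S"
proof -
  have "\<epsilon> \<in> Aut_carrier n" using subgroup.mem_carrier[OF assms(1,3)] by simp
  then have "\<phi> = (\<phi> \<otimes>\<^bsub>Aut n\<^esub> \<epsilon>) \<otimes>\<^bsub>Aut n\<^esub> inv\<^bsub>Aut n\<^esub> \<epsilon>"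
    using assms(2) Aut.m_assoc[of \<phi> n \<epsilon> "inv\<^bsub>Aut n\<^esub> \<epsilon>"] Aut.inv_closed[of \<epsilon> n]
      Aut.r_inv[of \<epsilon> n] Aut.r_one[of \<phi> n] by simp
  also have "\<dots> \<in> S"
    using subgroup.m_closed[OF assms(1,4)] subgroup.m_inv_closed[OF assms(1,3)] by blast
  finally show ?thesis .
qed

text \<open>The induction step. Among all \<open>f - q(g)\<close> one of least rank, \<open>f'\<close>, is chosen. By its minimality the
  leading term of \<open>f'\<close> is not a multiple of a power of that of \<open>g\<close>. So either the inverse of the new
  automorphism is affine, or the degree of \<open>g\<close> is \<open>r \<ge> 2\<close> times that of \<open>f'\<close>.\<close>

lemma Aff_d_2_reduce:
  fixes \<phi> :: "'k::field mpoly \<Rightarrow> 'k mpoly"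
  defines "S \<equiv> generate (Aut 2) (Aff 2 \<union> (BA 2 \<inter> Aff_d 2))"
  assumes \<phi>: "\<phi> \<in> Aff_d 2" and le: "wdeg irr_weight (\<phi> (X 1)) \<le> wdeg irr_weight (\<phi> (X 0))"
    and IH: "\<And>\<psi>. \<psi> \<in> Aff_d 2 \<Longrightarrow> rank (\<psi> (X 0)) + rank (\<psi> (X 1)) < rank (\<phi> (X 0)) + rank (\<phi> (X 1)) \<Longrightarrow> \<psi> \<in> S"
  shows "\<phi> \<in> S"
proof -
  have S: "subgroup S (Aut 2)" unfolding S_def by (intro subgroup_generate_Aff_BA subgroup_Aff_d)
  have gen: "Aff 2 \<subseteq> S" "BA 2 \<inter> Aff_d 2 \<subseteq> S" unfolding S_def by (auto intro: generate.incl)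
  have c: "\<phi> \<in> Aut_carrier 2" using \<phi> by (simp add: Aff_d_def)
  have X: "X 0 \<in> polys {..<2}" "X 1 \<in> polys {..<2}" by (simp_all add: X_in_polys)
  have p1: "q \<in> polys {..<2}" if "q \<in> polys {1}" for q :: "'k mpoly"
    using that polys_mono[of "{1}" "{..<2::nat}"] by auto
  define f where "f = \<phi> (X 0)"
  define g where "g = \<phi> (X 1)"
  define \<epsilon> :: "'k mpoly \<Rightarrow> 'k mpoly \<Rightarrow> 'k mpoly" where "\<epsilon> q = elementary 2 0 (- q)" for q
  have \<epsilon>: "\<epsilon> q \<in> Aut_carrier 2" if "q \<in> polys {1}" for q
  proof -
    have "{..<2} - {0} = {1::nat}" by auto
    with that show ?thesis unfolding \<epsilon>_def by (intro elementary_in_Aut) (auto intro: polys_uminus)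
  qed
  have \<phi>\<epsilon>: "\<phi> \<otimes>\<^bsub>Aut 2\<^esub> \<epsilon> q \<in> Aut_carrier 2" "(\<phi> \<otimes>\<^bsub>Aut 2\<^esub> \<epsilon> q) (X 0) = f - \<phi> q"
    "(\<phi> \<otimes>\<^bsub>Aut 2\<^esub> \<epsilon> q) (X 1) = g" if "q \<in> polys {1}" for q
    using Aut_mult_in[OF c \<epsilon>[OF that]] Aut_mult_apply[OF c \<epsilon>[OF that] X(1)] Aut_mult_apply[OF c \<epsilon>[OF that] X(2)]
      Aut_diff[OF c X(1) p1[OF that]]
    by (simp_all add: \<epsilon>_def elementary_X f_def g_def)
  have BA: "\<epsilon> q \<in> BA 2" if q: "q \<in> polys {1}" for q
    using \<epsilon>[OF q] p1[OF q] unfolding BA_def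
    by (auto simp: \<epsilon>_def elementary_X less_2_iff atLeast0LessThan intro!: polys_diff X_in_polys)
  have "\<exists>q. q \<in> polys {1} \<and> (\<forall>q'. q' \<in> polys {1} \<longrightarrow> rank (f - \<phi> q) \<le> rank (f - \<phi> q'))"
    by (rule ex_has_least_nat[of _ 0]) simp
  then obtain q where q: "q \<in> polys {1}"
    and min: "\<And>q'. q' \<in> polys {1} \<Longrightarrow> rank (f - \<phi> q) \<le> rank (f - \<phi> q')" by blast
  define f' where "f' = f - \<phi> q"
  let ?\<phi> = "\<phi> \<otimes>\<^bsub>Aut 2\<^esub> \<epsilon> q"
  have comp: "?\<phi> (X 0) = f'" "?\<phi> (X 1) = g" using \<phi>\<epsilon>[OF q] by (simp_all add: f'_def)
  have deg: "wdeg irr_weight f' \<ge> 1" "f' \<noteq> 0" "wdeg irr_weight g \<ge> 1" "g \<noteq> 0"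
    using wdeg_Aut_ge_1[OF \<phi>\<epsilon>(1)[OF q], of 0] wdeg_Aut_ge_1[OF \<phi>\<epsilon>(1)[OF q], of 1] by (simp_all add: comp)
  have pol: "f' \<in> polys {0, 1}"
    using Aut_apply_in[OF \<phi>\<epsilon>(1)[OF q] X(1)] by (simp add: comp lessThan_2)
  have irreducible: False if "lead irr_weight f' = Const a * lead irr_weight g ^ r" "a \<noteq> 0" for a r
  proof -
    let ?q = "q + Const a * X 1 ^ r"
    have q': "?q \<in> polys {1}" using q by (auto intro!: polys_intros)
    have m: "Const a * X 1 ^ r \<in> polys {..<2}" by (auto intro!: polys_intros)
    have "\<phi> (Const a * X 1 ^ r) = Const a * g ^ r"
      using Aut_times[OF c Const_in_polys polys_power[OF X(2)]] Aut_power[OF c X(2) X(2)] Aut_Const[OF c]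
      by (simp add: g_def)
    then have e: "f - \<phi> ?q = f' - Const a * g ^ r"
      using Aut_add[OF c p1[OF q] m] by (simp add: f'_def)
    have "f - \<phi> ?q \<noteq> 0" using wdeg_Aut_ge_1(2)[OF \<phi>\<epsilon>(1)[OF q'], of 0] \<phi>\<epsilon>(2)[OF q'] by simp
    then have "wdeg irr_weight (f' - Const a * g ^ r) < wdeg irr_weight f'"
      using deg that by (intro wdeg_diff_less) (auto simp: e lead_Const_mult_power)
    moreover have "f' - Const a * g ^ r \<in> polys {0, 1}"
      using Aut_apply_in[OF \<phi>\<epsilon>(1)[OF q'] X(1)] \<phi>\<epsilon>(2)[OF q'] by (simp add: e lessThan_2)
    ultimately have "rank (f - \<phi> ?q) < rank f'" using \<open>f - \<phi> ?q \<noteq> 0\<close> by (intro rank_less) (auto simp: e)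
    with min[OF q'] show False by (simp add: f'_def)
  qed
  consider "inv\<^bsub>Aut 2\<^esub> ?\<phi> \<in> Aff 2"
    | a r where "a \<noteq> 0" "r \<ge> 1" "lead irr_weight f' = Const a * lead irr_weight g ^ r"
    | a r where "a \<noteq> 0" "r \<ge> 1" "lead irr_weight g = Const a * lead irr_weight f' ^ r"
    using plane_automorphism_lead_terms[OF \<phi>\<epsilon>(1)[OF q]] unfolding comp by blast
  then have "?\<phi> \<in> S \<and> \<epsilon> q \<in> Aff_d 2"
  proof cases
    case 1
    have inv: "inv\<^bsub>Aut 2\<^esub> (inv\<^bsub>Aut 2\<^esub> ?\<phi>) = ?\<phi>" using Aut.inv_inv[of ?\<phi> 2] \<phi>\<epsilon>(1)[OF q] by simp
    have "?\<phi> \<in> S" using subgroup.m_inv_closed[OF S, of "inv\<^bsub>Aut 2\<^esub> ?\<phi>"] 1 gen inv by auto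
    have d: "?\<phi> \<in> Aff_d 2"
      using subgroup.m_inv_closed[OF subgroup_Aff_d[of 2], of "inv\<^bsub>Aut 2\<^esub> ?\<phi>"] 1
        Aff_subset_Aff_d[of 2] inv by auto
    have "\<epsilon> q = inv\<^bsub>Aut 2\<^esub> \<phi> \<otimes>\<^bsub>Aut 2\<^esub> ?\<phi>"
      using Aut.inv_solve_left[of "\<epsilon> q" 2 \<phi> ?\<phi>] \<phi>\<epsilon>(1)[OF q] \<epsilon>[OF q] c by simp
    also have "\<dots> \<in> Aff_d 2"
      using subgroup.m_closed[OF subgroup_Aff_d subgroup.m_inv_closed[OF subgroup_Aff_d \<phi>] d] .
    finally show ?thesis using \<open>?\<phi> \<in> S\<close> by blast
  next
    case 2
    then show ?thesis using irreducible by blast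
  next
    case 3
    have "r \<noteq> 1"
    proof
      assume "r = 1"
      with 3 have "Const (1 / a) * lead irr_weight g = (Const (1 / a) * Const a) * lead irr_weight f'" by (simp add: mult.assoc)
      also have "\<dots> = lead irr_weight f'" using 3(1) by (simp flip: Const_mult)
      finally have "lead irr_weight f' = Const (1 / a) * lead irr_weight g ^ 1" by simp
      then show False using irreducible[of "1 / a" 1] 3(1) by simp
    qed
    with 3(2) have r: "r \<ge> 2" by simp
    have "wdeg irr_weight g = wdeg irr_weight (Const a * f' ^ r)"
      using 3 deg by (metis lead_Const_mult_power wdeg_lead mult_eq_0_iff power_not_zero Const_eq_0_iff)
    also have "\<dots> = real r * wdeg irr_weight f'" using 3(1) deg(2) by (simp add: wdeg_Const_mult wdeg_power)
    finally have "wdeg irr_weight g \<ge> 2 * wdeg irr_weight f'" using r deg(1) by (simp add: mult_right_mono)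
    with deg(1) have lt: "wdeg irr_weight f' < wdeg irr_weight g" by simp
    \<comment> \<open>Comparing partial derivatives shows that the derivative of \<open>q\<close> is constant.\<close>
    have "pdiff 1 q \<in> polys {}"
    proof (rule ccontr)
      assume nc: "pdiff 1 q \<notin> polys {}"
      have t: "pdiff 1 q \<in> polys {1}" using q by (rule pdiff_in_polys)
      have D: "\<exists>a. pdiff j (\<phi> (X i)) = Const a" if "i < 2" "j < 2" for i j
        using \<phi> Aff_d_iff[OF c] that by blast
      have "\<exists>j<2. pdiff j g \<noteq> 0"
      proof (rule ccontr)
        assume "\<not> ?thesis"
        then have "Jac (\<phi> (X 0)) (\<phi> (X 1)) = 0" by (simp add: Jac_def g_def)
        moreover obtain b where "Jac (\<phi> (X 0)) (\<phi> (X 1)) = Const b"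
          "Const b * Jac ((inv\<^bsub>Aut 2\<^esub> \<phi>) (X 0)) ((inv\<^bsub>Aut 2\<^esub> \<phi>) (X 1)) = 1"
          using Jac_Aut[OF c refl] .
        ultimately show False by simp
      qed
      then obtain j b where j: "j < 2" and b: "pdiff j g = Const b" "b \<noteq> 0"
        using D[of 1] by (metis Const_0 g_def one_less_numeral_iff semiring_norm(76))
      obtain d where d: "pdiff j f = Const d" using D[of 0 j] j by (auto simp: f_def)
      have "pdiff j (\<phi> q) = (\<Sum>k<2. \<phi> (pdiff k q) * pdiff j (\<phi> (X k)))"
        by (rule pdiff_Aut_compose[OF c p1[OF q]])
      also have "\<dots> = \<phi> (pdiff 1 q) * Const b"
        using pdiff_eq_0[OF q, of 0] Aut_Const[OF c, of 0] b by (simp add: lessThan_2 g_def)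
      finally have prod: "\<phi> (pdiff 1 q) * Const b = Const d - pdiff j f'"
        by (simp add: f'_def pdiff_diff d)
      have "Const (1 / b) * Const b = 1" using b(2) by (simp flip: Const_mult)
      then have "\<phi> (pdiff 1 q) = (Const (1 / b) * Const b) * \<phi> (pdiff 1 q)" by simp
      also have "\<dots> = Const (1 / b) * (\<phi> (pdiff 1 q) * Const b)" by (simp only: mult_ac)
      also have "\<dots> = Const (1 / b) * (Const d - pdiff j f')" by (simp only: prod)
      finally have quot: "\<phi> (pdiff 1 q) = Const (1 / b) * (Const d - pdiff j f')" .
      have "wle irr_weight (wdeg irr_weight f') (pdiff j f')"
        using wle_mono[OF wle_pdiff[OF wle_wdeg[of irr_weight f'], of j]] irr_weight_nonneg[of j] by simp
      then have "wle irr_weight (0 + wdeg irr_weight f') (Const (1 / b) * (Const d - pdiff j f'))"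
        using deg(1) by (intro wle_mult wle_diff wle_Const) auto
      then have w: "wle irr_weight (wdeg irr_weight f') (\<phi> (pdiff 1 q))" by (simp add: quot)
      have "wdeg irr_weight g \<le> wdeg irr_weight (\<phi> (pdiff 1 q))"
        unfolding g_def by (rule wdeg_univariate[OF c t nc])
      moreover have "\<phi> (pdiff 1 q) \<noteq> 0"
      proof
        assume "\<phi> (pdiff 1 q) = 0"
        then have "pdiff 1 q = (inv\<^bsub>Aut 2\<^esub> \<phi>) (Const 0)" using Aut_inv_apply(2)[OF c p1[OF t]] by simp
        also have "\<dots> = Const 0" by (rule Aut_Const[OF Aut_inv_in[OF c]])
        finally show False using nc by simp
      qed
      ultimately show False using wdeg_le[OF _ w] lt by simp
    qed
    then obtain b where b: "pdiff 1 q = Const b" by (auto simp: polys_empty_iff)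
    have "\<epsilon> q \<in> Aff_d 2"
      using pdiff_eq_0[OF q, of 0] b
      by (subst Aff_d_iff[OF \<epsilon>[OF q]])
        (auto simp: \<epsilon>_def elementary_X less_2_iff pdiff_diff pdiff_X
          intro: exI[of _ 1] exI[of _ 0] exI[of _ "- b"] simp: Const_uminus)
    moreover from this have "?\<phi> \<in> Aff_d 2" using subgroup.m_closed[OF subgroup_Aff_d \<phi>] by blast
    moreover have "rank f' < rank f"
      using pol deg(2) lt le by (intro rank_less) (auto simp: f_def g_def)
    ultimately show ?thesis using IH[of ?\<phi>] by (simp add: comp f_def g_def)
  qed
  then have "?\<phi> \<in> S" "\<epsilon> q \<in> S" using BA[OF q] gen by auto
  then show "\<phi> \<in> S" using Aut_mult_right_cancel[OF S c] by blast
qed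

lemma Aff_d_2_generated:
  "\<phi> \<in> Aff_d 2 \<Longrightarrow> \<phi> \<in> generate (Aut 2) (Aff 2 \<union> (BA 2 \<inter> Aff_d 2))"
proof (induction "rank (\<phi> (X 0)) + rank (\<phi> (X 1))" arbitrary: \<phi> rule: less_induct)
  case less
  let ?S = "generate (Aut 2) (Aff 2 \<union> (BA 2 \<inter> Aff_d 2)) :: ('a mpoly \<Rightarrow> 'a mpoly) set"
  show ?case
  proof (cases "wdeg irr_weight (\<phi> (X 1)) \<le> wdeg irr_weight (\<phi> (X 0))")
    case True
    show ?thesis by (rule Aff_d_2_reduce[OF less.prems True less.hyps])
  next
    case False
    have c: "\<phi> \<in> Aut_carrier 2" using less.prems by (simp add: Aff_d_def)
    let ?s = "swap 2 0 1 :: 'a mpoly \<Rightarrow> 'a mpoly"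
    have s: "?s \<in> Aff 2" "?s \<in> Aut_carrier 2" by (simp_all add: swap_in_Aff swap_in_Aut)
    have comp: "(\<phi> \<otimes>\<^bsub>Aut 2\<^esub> ?s) (X 0) = \<phi> (X 1)" "(\<phi> \<otimes>\<^bsub>Aut 2\<^esub> ?s) (X 1) = \<phi> (X 0)"
      using Aut_mult_apply[OF c s(2)] by (simp_all add: X_in_polys swap_X)
    have "\<phi> \<otimes>\<^bsub>Aut 2\<^esub> ?s \<in> Aff_d 2"
      using subgroup.m_closed[OF subgroup_Aff_d less.prems] s(1) Aff_subset_Aff_d by blast
    then have "\<phi> \<otimes>\<^bsub>Aut 2\<^esub> ?s \<in> ?S"
      by (rule Aff_d_2_reduce) (use False less.hyps in \<open>auto simp: comp add.commute\<close>)
    moreover have "?s \<in> ?S" using s(1) by (auto intro: generate.incl)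
    ultimately show ?thesis
      using Aut_mult_right_cancel[OF subgroup_generate_Aff_BA[OF subgroup_Aff_d] c] by blast
  qed
qed

lemma Aff_d_eq_generate:
  assumes "n \<in> {1, 2}"
  shows "Aff_d n = generate (Aut n) (Aff n \<union> (BA n \<inter> Aff_d n))"
proof (rule generate_Aut_eqI[OF subgroup_Aff_d])
  show "Aff n \<union> (BA n \<inter> Aff_d n) \<subseteq> Aff_d n" using Aff_subset_Aff_d by blast
  fix \<phi> :: "'a mpoly \<Rightarrow> 'a mpoly" assume \<phi>: "\<phi> \<in> Aff_d n"
  show "\<phi> \<in> generate (Aut n) (Aff n \<union> (BA n \<inter> Aff_d n))"
  proof (cases "n = 1")
    case True
    have c: "\<phi> \<in> Aut_carrier n" using \<phi> by (simp add: Aff_d_def)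
    then have "\<phi> (X 0) \<in> polys {0..<n}"
      using Aut_apply_in[OF c, of "X 0"] True by (simp add: X_in_polys atLeast0LessThan)
    with c True have "\<phi> \<in> BA n" by (simp add: BA_def)
    with \<phi> show ?thesis by (auto intro: generate.incl)
  next
    case False
    with assms \<phi> show ?thesis using Aff_d_2_generated by auto
  qed
qed

section \<open>Additive polynomials in positive characteristic\<close>

lemma CHAR_mpoly: "CHAR('k::field mpoly) = CHAR('k)"
proof (rule CHAR_eqI)
  have "of_nat (CHAR('k)) = Const (of_nat (CHAR('k)) :: 'k)" by (simp only: Const_of_nat)
  then show "of_nat (CHAR('k)) = (0 :: 'k mpoly)" by simp
  fix x assume "of_nat x = (0 :: 'k mpoly)"
  then have "Const (of_nat x :: 'k) = 0" by (simp add: Const_of_nat)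
  then show "CHAR('k) dvd x" by (simp add: of_nat_eq_0_iff_char_dvd)
qed

lemma single_eq_iff: "single i a = single j b \<longleftrightarrow> (i = j \<and> a = b) \<or> (a = 0 \<and> b = 0)"
  for a b :: nat
  by (metis lookup_single_eq lookup_single_not_eq single_zero)

lemma frobenius_sum:
  assumes "CHAR('k::field) > 0"
  shows "sum f A ^ (CHAR('k) ^ e) = (\<Sum>i\<in>A. (f i :: 'k mpoly) ^ (CHAR('k) ^ e))"
  by (rule freshmans_dream_sum') (use assms in \<open>simp_all add: CHAR_mpoly prime_CHAR_semidom\<close>)

lemma frobenius_add:
  assumes "CHAR('k::field) > 0"
  shows "(f + g :: 'k mpoly) ^ (CHAR('k) ^ e) = f ^ (CHAR('k) ^ e) + g ^ (CHAR('k) ^ e)"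
  by (rule freshmans_dream') (use assms in \<open>simp_all add: CHAR_mpoly prime_CHAR_semidom\<close>)

text \<open>Let \<open>d = p ^ e * d'\<close> with \<open>d'\<close> prime to \<open>p\<close>. The coefficient of \<open>X i ^ (p ^ e)\<close> in
  \<open>(X i + 1) ^ d = (X i ^ (p ^ e) + 1) ^ d'\<close> is \<open>d' \<noteq> 0\<close>, but the only monomials on the
  other side are \<open>X i ^ d\<close> and 1.\<close>

lemma binomial_additive_exponent:
  assumes p: "CHAR('k::field) > 0" and d: "d > 0" and eq: "(X i + 1) ^ d = X i ^ d + (1 :: 'k mpoly)"
  obtains e where "d = CHAR('k) ^ e"
proof -
  let ?p = "CHAR('k)"
  have pr: "prime ?p" using p by (rule prime_CHAR_semidom)
  obtain e d' where d': "d = ?p ^ e * d'" "\<not> ?p dvd d'"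
    using multiplicity_decompose'[of d ?p] d pr by (metis not_prime_unit not_gr0)
  have pos: "d' > 0" "?p ^ e > 0" using d d' p by (auto intro!: gr0I)
  have "d' = 1"
  proof (rule ccontr)
    assume "d' \<noteq> 1"
    let ?T = "X i ^ (?p ^ e) :: 'k mpoly"
    have T: "?T ^ k = single (single i (?p ^ e * k)) 1" for k
      by (simp only: power_mult[symmetric] X_power[of i "?p ^ e * k"])
    have "(?T + 1) ^ d' = (X i + 1) ^ d"
      using frobenius_add[OF p, of "X i" 1 e] by (simp add: d' power_mult)
    also have "\<dots> = ?T ^ d' + 1" by (simp add: eq) (simp add: d' power_mult)
    finally have "lookup ((?T + 1) ^ d') (single i (?p ^ e)) = lookup (?T ^ d' + 1) (single i (?p ^ e))"
      by simp
    moreover have "lookup (?T ^ d' + 1) (single i (?p ^ e)) = 0"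
    proof -
      have "?p ^ e * d' \<noteq> ?p ^ e" using \<open>d' \<noteq> 1\<close> pos by simp
      then show ?thesis using pos
        by (simp only: T lookup_add lookup_one lookup_single when_def single_eq_iff)
          (auto simp: single_eq_iff[of i _ i 0, simplified])
    qed
    moreover have "lookup ((?T + 1) ^ d') (single i (?p ^ e)) = of_nat d'"
    proof -
      have "(?T + 1) ^ d' = (\<Sum>k\<le>d'. Const (of_nat (d' choose k)) * ?T ^ k)"
        by (simp add: binomial_ring Const_of_nat)
      also have "lookup \<dots> (single i (?p ^ e)) = (\<Sum>k\<le>d'. if k = 1 then of_nat (d' choose k) else 0)"
        unfolding lookup_sum T Const_mult_single
        by (rule sum.cong) (use pos in \<open>auto simp: lookup_single when_def single_eq_iff\<close>)
      also have "\<dots> = of_nat d'" using pos by (simp add: choose_one)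
      finally show ?thesis .
    qed
    ultimately have "of_nat d' = (0 :: 'k)" by simp
    with d' show False by (simp add: of_nat_eq_0_iff_char_dvd)
  qed
  with d' that show thesis by simp
qed

text \<open>The \<open>p\<close>-polynomials, linear combinations of the \<open>X i ^ (p ^ e)\<close>: they turn out to be the additive
  polynomials.\<close>

definition p_polys :: "nat set \<Rightarrow> 'k::field mpoly set" where
  "p_polys V = {f. \<forall>m\<in>keys f. \<exists>i\<in>V. \<exists>e. m = single i (CHAR('k) ^ e)}"

lemma p_polys_add: "f \<in> p_polys V \<Longrightarrow> g \<in> p_polys V \<Longrightarrow> f + g \<in> p_polys V"
  using Poly_Mapping.keys_add[of f g] unfolding p_polys_def by blast

lemma p_polys_uminus: "f \<in> p_polys V \<Longrightarrow> - f \<in> p_polys V"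
  by (simp add: p_polys_def)

lemma p_polys_diff: "f \<in> p_polys V \<Longrightarrow> g \<in> p_polys V \<Longrightarrow> f - g \<in> p_polys V"
  unfolding diff_conv_add_uminus by (intro p_polys_add p_polys_uminus)

lemma p_polys_0 [simp]: "0 \<in> p_polys V" by (simp add: p_polys_def)

lemma p_polys_sum: "(\<And>i. i \<in> A \<Longrightarrow> f i \<in> p_polys V) \<Longrightarrow> sum f A \<in> p_polys V"
  by (induction A rule: infinite_finite_induct) (auto intro: p_polys_add)

lemma p_polys_single: "i \<in> V \<Longrightarrow> single (single i (CHAR('k) ^ e)) (c :: 'k::field) \<in> p_polys V"
  by (auto simp: p_polys_def)

lemma p_polys_X: "i \<in> V \<Longrightarrow> X i \<in> p_polys V"
  using p_polys_single[of i V 0 1] by (simp add: X_def)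

lemma keys_Const_mult: "keys (Const c * f) \<subseteq> keys f"
  using keys_mult[of "Const c" f] by (auto simp: Const_def split: if_splits)

lemma p_polys_Const_mult: "f \<in> p_polys V \<Longrightarrow> Const c * f \<in> p_polys V"
  using keys_Const_mult[of c f] unfolding p_polys_def by blast

lemma p_polys_frobenius:
  assumes p: "CHAR('k::field) > 0" and f: "f \<in> p_polys V"
  shows "(f :: 'k mpoly) ^ (CHAR('k) ^ e) \<in> p_polys V"
proof -
  have "f ^ (CHAR('k) ^ e) = (\<Sum>m\<in>keys f. single m (lookup f m)) ^ (CHAR('k) ^ e)"
    by (simp only: sum_single_lookup)
  also have "\<dots> = (\<Sum>m\<in>keys f. single m (lookup f m) ^ (CHAR('k) ^ e))"
    by (rule frobenius_sum[OF p])
  also have "\<dots> \<in> p_polys V"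
  proof (rule p_polys_sum)
    fix m assume "m \<in> keys f"
    then obtain i a where m: "i \<in> V" "m = single i (CHAR('k) ^ a)" using f by (auto simp: p_polys_def)
    have "single m (lookup f m) = Const (lookup f m) * X i ^ (CHAR('k) ^ a)"
      by (simp add: m X_power Const_mult_single)
    then have "single m (lookup f m) ^ (CHAR('k) ^ e)
        = Const (lookup f m ^ (CHAR('k) ^ e)) * X i ^ (CHAR('k) ^ (a + e))"
      by (simp add: power_mult_distrib Const_power power_add power_mult)
    then show "single m (lookup f m) ^ (CHAR('k) ^ e) \<in> p_polys V"
      using p_polys_single[OF m(1)] by (simp add: X_power Const_mult_single)
  qed
  finally show ?thesis .
qed

lemma p_polys_polys: "p_polys V \<subseteq> polys V"
proof
  fix f :: "'k::field mpoly" assume f: "f \<in> p_polys V"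
  have "keys m \<subseteq> V" if "m \<in> keys f" for m
  proof -
    obtain i e where "i \<in> V" "m = single i (CHAR('k) ^ e)" using f \<open>m \<in> keys f\<close> by (auto simp: p_polys_def)
    then show ?thesis by auto
  qed
  then show "f \<in> polys V" by (simp add: polys_def)
qed

lemma additive_if_p_polys:
  assumes p: "CHAR('k::field) > 0" and f: "f \<in> p_polys {..<n}"
  shows "additive_poly n (f :: 'k mpoly)"
proof -
  let ?S = "\<lambda>i. X i + X (n + i) :: 'k mpoly" and ?Z = "\<lambda>i. X (n + i) :: 'k mpoly"
  have "monom_eval ?S m = monom_eval X m + monom_eval ?Z m" if "m \<in> keys f" for m
  proof -
    obtain i e where "m = single i (CHAR('k) ^ e)" using f \<open>m \<in> keys f\<close> by (auto simp: p_polys_def)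
    then show ?thesis by (simp add: frobenius_add[OF p])
  qed
  then have "subst ?S f = subst X f + subst ?Z f"
    by (simp add: subst_sum_monom_eval sum.distrib[symmetric] distrib_left)
  with f p_polys_polys show ?thesis unfolding additive_poly_def by auto
qed

lemma lookup_subst_const_zero: "subst (\<lambda>_. 0) f = Const (lookup f 0)"
proof -
  have "monom_eval (\<lambda>_. 0) m = (if m = 0 then 1 else (0 :: 'a mpoly))" for m
  proof (cases "m = 0")
    case False
    then obtain i where "i \<in> keys m" by (metis keys_eq_empty ex_in_conv)
    then have "monom_eval (\<lambda>_. 0) m = (0 :: 'a mpoly)"
      unfolding monom_eval_def by (intro prod_zero) (auto simp: in_keys_iff intro!: bexI[of _ i])
    with False show ?thesis by simp
  qed simp
  then have "subst (\<lambda>_. 0) f = (\<Sum>m\<in>keys f. if m = 0 then Const (lookup f m) else 0)"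
    unfolding subst_sum_monom_eval by (intro sum.cong) auto
  then show ?thesis by (auto simp: in_keys_iff)
qed

text \<open>Distributing the variables between the two arguments splits an additive \<open>f\<close> as
  \<open>f(x) = f(0, .., x\<^sub>i, .., 0) + f(x\<^sub>1, .., 0, .., x\<^sub>n)\<close>, so each monomial involves only one variable. The
  homogeneous parts of \<open>f\<close> are additive as well, hence \<open>(x + y) ^ d = x ^ d + y ^ d\<close> for each exponent \<open>d\<close>
  that occurs, and \<open>d\<close> is a power of \<open>p\<close>.\<close>

lemma additive_imp_p_polys:
  assumes p: "CHAR('k::field) > 0" and f: "additive_poly n (f :: 'k mpoly)"
  shows "f \<in> p_polys {..<n}"
proof -
  let ?S = "\<lambda>i. X i + X (n + i) :: 'k mpoly" and ?Z = "\<lambda>i. X (n + i) :: 'k mpoly"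
  have pol: "f \<in> polys {..<n}" and add: "subst ?S f = subst X f + subst ?Z f"
    using f by (auto simp: additive_poly_def)
  have sub: "subst (\<lambda>j. \<tau> j + \<tau> (n + j)) g = subst \<tau> g + subst (\<lambda>j. \<tau> (n + j)) g"
    if "subst ?S g = subst X g + subst ?Z g" for g \<tau>
  proof -
    have "subst \<tau> (subst ?S g) = subst \<tau> (subst X g + subst ?Z g)" by (simp only: that)
    then show ?thesis by (simp add: subst_subst subst_simps)
  qed
  have zero: "lookup f 0 = 0"
  proof -
    have "Const (lookup f 0) = Const (lookup f 0) + Const (lookup f 0)"
      using sub[OF add, of "\<lambda>_. 0"] unfolding add_0_right lookup_subst_const_zero .
    then show ?thesis by (metis Const_eq_0_iff add_cancel_right_right)
  qed
  have one_variable: "keys m \<subseteq> {i}" if m: "m \<in> keys f" and i: "i \<in> keys m" for m i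
  proof -
    have "i < n" using m i pol by (auto simp: polys_def)
    \<comment> \<open>the first argument receives \<open>X i\<close>, the second one all other variables\<close>
    let ?t = "\<lambda>j. if j < n then if j = i then X i else 0 else if j = n + i then 0 else X (j - n) :: 'k mpoly"
    have "f = subst (\<lambda>j. ?t j + ?t (n + j)) f"
      by (rule subst_ident_on[OF pol, symmetric]) auto
    also have "\<dots> = subst ?t f + subst (\<lambda>j. ?t (n + j)) f" by (rule sub[OF add])
    also have "subst (\<lambda>j. ?t (n + j)) f = subst (X(i := 0)) f"
      by (rule subst_cong[OF pol]) auto
    finally have "lookup f m = lookup (subst ?t f + subst (X(i := 0)) f) m"
      by (rule arg_cong)
    then have "lookup f m = lookup (subst ?t f) m + lookup (subst (X(i := 0)) f) m"
      by (simp only: lookup_add)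
    then have "m \<in> keys (subst ?t f)" using m i by (simp add: lookup_subst_zero in_keys_iff)
    moreover have "subst ?t f \<in> polys {i}"
      using \<open>i < n\<close> by (intro subst_in_polys[OF pol]) (auto intro: X_in_polys)
    ultimately show ?thesis by (auto simp: polys_def)
  qed
  show ?thesis unfolding p_polys_def
  proof (intro CollectI ballI)
    fix m assume m: "m \<in> keys f"
    have "m \<noteq> 0" using m zero by (auto simp: in_keys_iff)
    then obtain i where i: "i \<in> keys m" by (metis keys_eq_empty ex_in_conv)
    then have "i < n" using m pol by (auto simp: polys_def)
    define d where "d = lookup m i"
    have md: "m = single i d"
    proof (rule poly_mapping_eqI)
      fix k
      show "lookup m k = lookup (single i d) k"
        using one_variable[OF m i] by (cases "k = i") (auto simp: d_def in_keys_iff lookup_single)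
    qed
    have d: "d > 0" using i by (simp add: d_def in_keys_iff)
    let ?g = "part (\<lambda>_. 1) (real d) f"
    \<comment> \<open>Homogeneous parts of additive polynomials are additive.\<close>
    have g: "subst ?S ?g = subst X ?g + subst ?Z ?g"
    proof -
      have p1: "part (\<lambda>_. 1) 1 (X j) = (X j :: 'k mpoly)" for j by (simp add: X_def part_single)
      then have h: "part (\<lambda>_. 1) (real d) (subst s f) = subst s ?g"
        if "s \<in> {?S, X, ?Z}" for s
        using that by (intro part_subst_homogeneous) (auto simp: part_add)
      show ?thesis
        using arg_cong[OF add, of "part (\<lambda>_. 1) (real d)"] h[of ?S] h[of X] h[of ?Z]
        by (simp add: part_add)
    qed
    let ?c = "lookup f m"
    have eval: "subst s ?g = Const ?c * s i ^ d" if s0: "\<And>j. j < n \<Longrightarrow> j \<noteq> i \<Longrightarrow> s j = 0" for s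
    proof -
      have "Const (lookup ?g k) * monom_eval s k = (if k = m then Const ?c * s i ^ d else 0)"
        if k: "k \<in> keys ?g" for k
      proof (cases "k = m")
        case True
        with k show ?thesis by (simp add: md keys_part lookup_part)
      next
        case False
        have kf: "k \<in> keys f" "wt (\<lambda>_. 1) k = real d" using k by (auto simp: keys_part)
        have "k \<noteq> 0" using kf zero by (auto simp: in_keys_iff)
        then obtain j where j: "j \<in> keys k" by (metis keys_eq_empty ex_in_conv)
        have kj: "keys k \<subseteq> {j}" using one_variable[OF kf(1) j] .
        have "wt (\<lambda>_. 1) k = real (lookup k j)" using wt_superset[OF _ kj, of "\<lambda>_. 1"] by simp
        then have "lookup k j = d" using kf by simp
        then have "k = single j d"
          using kj by (intro poly_mapping_eqI) (auto simp: lookup_single when_def in_keys_iff)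
        with False md have "j \<noteq> i" by auto
        moreover have "j < n" using j kf pol by (auto simp: polys_def)
        ultimately show ?thesis using s0[of j] d False by (simp add: \<open>k = single j d\<close>)
      qed
      then have "subst s ?g = (\<Sum>k\<in>keys ?g. if k = m then Const ?c * s i ^ d else 0)"
        unfolding subst_sum_monom_eval by (intro sum.cong) auto
      also have "\<dots> = Const ?c * s i ^ d"
        using m md by (simp add: keys_part)
      finally show ?thesis .
    qed
    let ?t = "\<lambda>j. if j = i then X i else if j = n + i then 1 else 0 :: 'k mpoly"
    have "Const ?c * (X i + 1) ^ d = Const ?c * X i ^ d + Const ?c * 1 ^ d"
      using sub[OF g, of ?t] eval[of "\<lambda>j. ?t j + ?t (n + j)"] eval[of ?t] eval[of "\<lambda>j. ?t (n + j)"] \<open>i < n\<close>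
      by simp
    then have "Const ?c * (X i + 1) ^ d = Const ?c * (X i ^ d + 1)" by (simp add: distrib_left)
    then have "(X i + 1) ^ d = X i ^ d + (1 :: 'k mpoly)" using m by (simp add: in_keys_iff)
    then obtain e where "d = CHAR('k) ^ e" using binomial_additive_exponent[OF p d] by blast
    with md \<open>i < n\<close> show "\<exists>i\<in>{..<n}. \<exists>e. m = single i (CHAR('k) ^ e)" by auto
  qed
qed

lemma Add_iff:
  assumes "CHAR('k::field) > 0"
  shows "\<phi> \<in> Add n \<longleftrightarrow> \<phi> \<in> Aut_carrier n \<and> (\<forall>i<n. (\<phi> (X i) :: 'k mpoly) \<in> p_polys {..<n})"
  using additive_if_p_polys[OF assms] additive_imp_p_polys[OF assms] by (auto simp: Add_def)

section \<open>Geometrically affine automorphisms\<close>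

lemma subgroup_Aff_g: "subgroup (Aff_g n) (Aut n)"
  unfolding Aff_g_def by (rule Aut.generate_is_subgroup) (auto simp: Translations_def Add_def)

lemma Add_subset_Aff_g: "Add n \<subseteq> Aff_g n"
  unfolding Aff_g_def by (auto intro: generate.incl)

lemma translation_form:
  assumes "affine_form n \<phi> (1\<^sub>m n) b" "j < n"
  shows "\<phi> (X j) = X j + Const (b $ j)"
proof -
  have "(\<Sum>i<n. X i * Const (1\<^sub>m n $$ (i, j))) = (\<Sum>i<n. if i = j then X j else 0)"
    by (rule sum.cong) (use assms in auto)
  then show ?thesis using assms by (simp add: affine_form_def)
qed

lemma Translations_subset_Aff: "Translations n \<subseteq> Aff n"
proof
  fix \<phi> :: "'a mpoly \<Rightarrow> 'a mpoly" assume "\<phi> \<in> Translations n"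
  then obtain b where \<phi>: "\<phi> \<in> Aut_carrier n" and b: "affine_form n \<phi> (1\<^sub>m n) b"
    by (auto simp: Translations_def)
  show "\<phi> \<in> Aff n"
    by (rule degree_one_in_Aff[OF \<phi>]) (auto simp: translation_form[OF b] intro!: wle_add wle_one_X wle_Const)
qed

text \<open>An affine automorphism is a translation followed by a linear automorphism. The latter is the
  quotient of two automorphisms, and its components are linear forms, hence additive.\<close>

lemma Aff_subset_Aff_g:
  assumes p: "CHAR('k::field) > 0"
  shows "Aff n \<subseteq> (Aff_g n :: ('k mpoly \<Rightarrow> 'k mpoly) set)"
proof
  fix \<phi> :: "'k mpoly \<Rightarrow> 'k mpoly" assume "\<phi> \<in> Aff n"
  then obtain M b where \<phi>: "\<phi> \<in> Aut_carrier n" and b: "b \<in> carrier_vec n" and aff: "affine_form n \<phi> M b"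
    by (auto simp: Aff_def)
  define T where "T = endo n (\<lambda>j. X j + Const (b $ j) :: 'k mpoly)"
  have T: "T \<in> Aut_carrier n" unfolding T_def
    by (rule endo_in_Aut[where t = "\<lambda>j. X j - Const (b $ j)"]) (auto simp: subst_simps intro!: polys_intros)
  have TX: "T (X j) = X j + Const (b $ j)" if "j < n" for j using that by (simp add: T_def endo_X)
  have "affine_form n T (1\<^sub>m n) b"
  proof -
    have "(\<Sum>i<n. X i * Const (1\<^sub>m n $$ (i, j))) = (\<Sum>i<n. if i = j then X j else (0 :: 'k mpoly))" if "j < n" for j
      by (rule sum.cong) (use that in auto)
    then show ?thesis by (simp add: affine_form_def TX)
  qed
  with T b have "T \<in> Translations n" by (auto simp: Translations_def)
  then have Tg: "T \<in> Aff_g n" unfolding Aff_g_def by (auto intro: generate.incl)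
  have iT: "(inv\<^bsub>Aut n\<^esub> T) (X j) = X j - Const (b $ j)" if "j < n" for j
  proof -
    have X: "X j \<in> polys {..<n}" using that by (simp add: X_in_polys)
    have "X j = (inv\<^bsub>Aut n\<^esub> T) (X j + Const (b $ j))"
      using Aut_inv_apply(2)[OF T X] TX[OF that] by simp
    also have "\<dots> = (inv\<^bsub>Aut n\<^esub> T) (X j) + Const (b $ j)"
      using Aut_add[OF Aut_inv_in[OF T] X Const_in_polys] Aut_Const[OF Aut_inv_in[OF T]] by simp
    finally show ?thesis by (simp add: algebra_simps)
  qed
  have iTg: "inv\<^bsub>Aut n\<^esub> T \<in> Aff_g n" by (rule subgroup.m_inv_closed[OF subgroup_Aff_g Tg])
  have "\<phi> \<otimes>\<^bsub>Aut n\<^esub> inv\<^bsub>Aut n\<^esub> T \<in> Add n"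
    unfolding Add_iff[OF p]
  proof (intro conjI allI impI)
    show "\<phi> \<otimes>\<^bsub>Aut n\<^esub> inv\<^bsub>Aut n\<^esub> T \<in> Aut_carrier n" by (rule Aut_mult_in[OF \<phi> Aut_inv_in[OF T]])
    fix j assume j: "j < n"
    then have X: "X j \<in> polys {..<n}" by (simp add: X_in_polys)
    have "(\<phi> \<otimes>\<^bsub>Aut n\<^esub> inv\<^bsub>Aut n\<^esub> T) (X j) = \<phi> (X j) - Const (b $ j)"
      using Aut_mult_apply[OF \<phi> Aut_inv_in[OF T] X] iT[OF j] Aut_diff[OF \<phi> X Const_in_polys] Aut_Const[OF \<phi>] by simp
    also have "\<dots> = (\<Sum>i<n. Const (M $$ (i, j)) * X i)"
      using aff j by (simp add: affine_form_def mult.commute)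
    also have "\<dots> \<in> p_polys {..<n}"
      by (intro p_polys_sum p_polys_Const_mult p_polys_X)
    finally show "(\<phi> \<otimes>\<^bsub>Aut n\<^esub> inv\<^bsub>Aut n\<^esub> T) (X j) \<in> p_polys {..<n}" .
  qed
  then show "\<phi> \<in> Aff_g n"
    using Aut_mult_right_cancel[OF subgroup_Aff_g \<phi> iTg] Add_subset_Aff_g by blast
qed

abbreviation Gen :: "nat \<Rightarrow> ('k::field mpoly \<Rightarrow> 'k mpoly) set" where
  "Gen n \<equiv> generate (Aut n) (Aff n \<union> (BA n \<inter> Aff_g n))"

text \<open>For \<open>i < j\<close> the automorphism is triangular, otherwise it is conjugate to such an automorphism by a
  transposition of variables.\<close>

lemma elementary_in_Gen:
  assumes p: "CHAR('k::field) > 0" and ij: "i < n" "j < n" "i \<noteq> j"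
  shows "elementary n i (Const c * X j ^ (CHAR('k) ^ e)) \<in> (Gen n :: ('k mpoly \<Rightarrow> 'k mpoly) set)"
proof -
  let ?E = "\<lambda>i j. elementary n i (Const c * X j ^ (CHAR('k) ^ e)) :: 'k mpoly \<Rightarrow> 'k mpoly"
  have E: "?E i j \<in> Aut_carrier n" if "i < n" "j < n" "i \<noteq> j" for i j
    using that by (intro elementary_in_Aut) (auto intro!: polys_intros)
  have Gen: "?E i j \<in> Gen n" if "i < j" "j < n" for i j
  proof -
    have i: "i < n" using that by simp
    have "?E i j \<in> BA n" unfolding BA_def
      using E[of i j] that by (auto simp: elementary_X intro!: polys_intros)
    moreover have "?E i j \<in> Add n"
      unfolding Add_iff[OF p] using E[of i j] that
      by (auto simp: elementary_X intro!: p_polys_add p_polys_X p_polys_Const_mult p_polys_frobenius[OF p])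
    ultimately show ?thesis using Add_subset_Aff_g by (auto intro: generate.incl)
  qed
  show ?thesis
  proof (cases "i < j")
    case True
    with Gen ij show ?thesis by blast
  next
    case False
    then have ji: "j < i" using ij by simp
    let ?s = "swap n i j :: 'k mpoly \<Rightarrow> 'k mpoly"
    have s: "?s \<in> Aut_carrier n" "?s \<in> Gen n"
      using ij by (auto intro!: swap_in_Aut generate.incl UnI1 swap_in_Aff)
    have Es: "?E j i \<otimes>\<^bsub>Aut n\<^esub> ?s \<in> Aut_carrier n" by (rule Aut_mult_in) (use E ij s in auto)
    have "?E i j = ?s \<otimes>\<^bsub>Aut n\<^esub> (?E j i \<otimes>\<^bsub>Aut n\<^esub> ?s)"
    proof (rule Aut_eqI)
      show "?E i j \<in> Aut_carrier n" using E ij by blast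
      show "?s \<otimes>\<^bsub>Aut n\<^esub> (?E j i \<otimes>\<^bsub>Aut n\<^esub> ?s) \<in> Aut_carrier n" using Aut_mult_in[OF s(1) Es] .
      fix k assume k: "k < n"
      have X: "X l \<in> polys {..<n}" if "l < n" for l using that by (simp add: X_in_polys)
      have t: "transpose i j k < n" using ij k by (auto simp: transpose_def)
      have "(?s \<otimes>\<^bsub>Aut n\<^esub> (?E j i \<otimes>\<^bsub>Aut n\<^esub> ?s)) (X k) = ?s (?E j i (X (transpose i j k)))"
        using Aut_mult_apply[OF s(1) Es X[OF k]] Aut_mult_apply[OF _ s(1) X[OF k], of "?E j i"] E[of j i] ij k
        by (simp add: swap_X)
      also have "\<dots> = ?E i j (X k)"
      proof (cases "k = i")
        case True
        have pol: "Const c * X i ^ (CHAR('k) ^ e) \<in> polys {..<n}" using ij by (auto intro!: polys_intros)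
        have "?s (X j + Const c * X i ^ (CHAR('k) ^ e)) = X i + Const c * X j ^ (CHAR('k) ^ e)"
          using Aut_add[OF s(1) X[OF ij(2)] pol] ij
            Aut_times[OF s(1) Const_in_polys polys_power[OF X[OF ij(1)]]] Aut_power[OF s(1) X[OF ij(1)] X[OF ij(1)]]
            Aut_Const[OF s(1)] by (simp add: swap_X)
        then show ?thesis using True ij by (simp add: elementary_X)
      next
        case False
        then have "transpose i j k \<noteq> j" by (auto simp: transpose_def split: if_splits)
        with False show ?thesis using t k by (simp add: elementary_X swap_X)
      qed
      finally show "?E i j (X k) = (?s \<otimes>\<^bsub>Aut n\<^esub> (?E j i \<otimes>\<^bsub>Aut n\<^esub> ?s)) (X k)" ..
    qed
    also have "\<dots> \<in> Gen n" using Gen[OF ji ij(1)] s by (intro generate.eng)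
    finally show ?thesis .
  qed
qed

text \<open>The degree in the single variable \<open>X k\<close>, as a natural number for use in termination arguments.\<close>

definition vdeg :: "nat \<Rightarrow> 'k::field mpoly \<Rightarrow> nat" where
  "vdeg k f = nat \<lfloor>wdeg (\<lambda>i. if i = k then 1 else 0) f\<rfloor>"

lemma wt_variable: "wt (\<lambda>i. if i = k then 1 else 0) m = real (lookup m k)"
proof -
  have "wt (\<lambda>i. if i = k then 1 else 0) m = (\<Sum>i\<in>keys m. if i = k then real (lookup m k) else 0)"
    unfolding wt_def by (rule sum.cong) auto
  then show ?thesis by (simp add: in_keys_iff)
qed

lemma wdeg_variable:
  assumes "f \<noteq> 0"
  shows "wdeg (\<lambda>i. if i = k then 1 else 0) f = real (vdeg k f)"
proof -
  obtain m where "wt (\<lambda>i. if i = k then 1 else 0) m = wdeg (\<lambda>i. if i = k then 1 else 0) f"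
    using wdeg_attained[OF assms] by blast
  then have "wdeg (\<lambda>i. if i = k then 1 else 0) f = real (lookup m k)" by (simp only: wt_variable)
  then show ?thesis by (simp add: vdeg_def)
qed

lemma vdeg_0_polys:
  assumes "f \<in> polys {k..<n}" "f \<noteq> 0" "vdeg k f = 0"
  shows "f \<in> polys {Suc k..<n}"
proof -
  have "lookup m k = 0" if "m \<in> keys f" for m
    using wle_wdeg[of "\<lambda>i. if i = k then 1 else 0" f] that
    by (simp add: wdeg_variable[OF assms(2)] assms(3) wle_def wt_variable)
  then have "k \<notin> keys m" if "m \<in> keys f" for m using that by (simp add: in_keys_iff)
  with assms(1) show ?thesis
    by (auto simp: polys_def) (metis atLeastLessThan_iff le_neq_implies_less subsetD Suc_leI)+
qed

lemma p_polys_lead: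
  fixes f :: "'k::field mpoly"
  assumes p: "CHAR('k) > 0" and f: "f \<in> p_polys {..<n}" "f \<noteq> 0" "vdeg k f > 0"
  obtains e c where "vdeg k f = CHAR('k) ^ e" "c \<noteq> 0"
    "lead (\<lambda>i. if i = k then 1 else 0) f = Const c * X k ^ (CHAR('k) ^ e)"
proof -
  let ?w = "\<lambda>i. if i = k then 1 else 0 :: real"
  have form: "m = single k (lookup m k) \<and> (\<exists>e. lookup m k = CHAR('k) ^ e)"
    if "m \<in> keys f" "lookup m k > 0" for m
  proof -
    obtain i e where "m = single i (CHAR('k) ^ e)" using f(1) \<open>m \<in> keys f\<close> by (auto simp: p_polys_def)
    with \<open>lookup m k > 0\<close> show ?thesis by (cases "i = k") (auto simp: lookup_single)
  qed
  obtain m where m: "m \<in> keys f" "wt ?w m = wdeg ?w f" using wdeg_attained[OF f(2)] by blast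
  then have v: "lookup m k = vdeg k f" by (simp add: wdeg_variable[OF f(2)] wt_variable)
  then obtain e where e: "m = single k (vdeg k f)" "vdeg k f = CHAR('k) ^ e"
    using form[OF m(1)] f(3) by auto
  have "lead ?w f = single m (lookup f m)"
  proof (rule poly_mapping_eqI)
    fix l
    have "l = m" if "l \<in> keys f" "lookup l k = vdeg k f" using form[OF that(1)] that f(3) e by auto
    then show "lookup (lead ?w f) l = lookup (single m (lookup f m)) l"
      using v by (auto simp: lead_def lookup_part wdeg_variable[OF f(2)] wt_variable lookup_single when_def in_keys_iff)
  qed
  also have "\<dots> = Const (lookup f m) * X k ^ (CHAR('k) ^ e)"
    by (simp add: X_power Const_mult_single flip: e)
  finally show thesis using that[OF e(2) _] m(1) by (simp add: in_keys_iff)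
qed

text \<open>The leading terms in \<open>X k\<close> are \<open>\<alpha> X k ^ (p ^ a)\<close> and \<open>\<beta> X k ^ (p ^ b)\<close> with \<open>b \<le> a\<close>, and the power
  \<open>g ^ (p ^ (a - b))\<close> of \<open>g\<close> is again a \<open>p\<close>-polynomial, with leading exponent \<open>p ^ a\<close>.\<close>

lemma division_step:
  fixes f g :: "'k::field mpoly"
  assumes p: "CHAR('k) > 0" and f: "f \<in> p_polys {..<n}" "f \<noteq> 0" and g: "g \<in> p_polys {..<n}" "g \<noteq> 0"
    and le: "0 < vdeg k g" "vdeg k g \<le> vdeg k f"
  obtains c e where "f - Const c * g ^ (CHAR('k) ^ e) = 0
      \<or> vdeg k (f - Const c * g ^ (CHAR('k) ^ e)) < vdeg k f"
proof -
  let ?p = "CHAR('k)"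
  let ?w = "\<lambda>i. if i = k then 1 else 0 :: real"
  have "vdeg k f > 0" using le by simp
  then obtain a \<alpha> where a: "vdeg k f = ?p ^ a" "\<alpha> \<noteq> 0" "lead ?w f = Const \<alpha> * X k ^ (?p ^ a)"
    using p_polys_lead[OF p f] by blast
  obtain b \<beta> where b: "vdeg k g = ?p ^ b" "\<beta> \<noteq> 0" "lead ?w g = Const \<beta> * X k ^ (?p ^ b)"
    using p_polys_lead[OF p g le(1)] by blast
  have "prime ?p" using p by (rule prime_CHAR_semidom)
  then have "b \<le> a" using le(2) a b by (simp add: prime_gt_1_nat power_increasing_iff)
  define e where "e = a - b"
  have ae: "a = b + e" using \<open>b \<le> a\<close> by (simp add: e_def)
  define c where "c = \<alpha> / \<beta> ^ (?p ^ e)"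
  have c: "c \<noteq> 0" "c * \<beta> ^ (?p ^ e) = \<alpha>" using a b by (simp_all add: c_def)
  have "lead ?w (Const c * g ^ (?p ^ e)) = Const c * (Const \<beta> * X k ^ (?p ^ b)) ^ (?p ^ e)"
    using lead_Const_mult_power[OF c(1) g(2)] b by simp
  also have "\<dots> = Const (c * \<beta> ^ (?p ^ e)) * X k ^ (?p ^ a)"
    by (simp only: ae power_add power_mult power_mult_distrib Const_mult Const_power mult.assoc)
  also have "\<dots> = lead ?w f" by (simp only: c a)
  finally have l: "lead ?w f = lead ?w (Const c * g ^ (?p ^ e))" ..
  have "vdeg k (f - Const c * g ^ (?p ^ e)) < vdeg k f" if "f - Const c * g ^ (?p ^ e) \<noteq> 0"
  proof -
    have "wdeg ?w (f - Const c * g ^ (?p ^ e)) < wdeg ?w f"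
      by (rule wdeg_diff_less) (use f g c l that in auto)
    then show ?thesis by (simp add: wdeg_variable[OF that] wdeg_variable[OF f(2)])
  qed
  then show thesis using that by blast
qed

text \<open>Euclid's algorithm on the matrix of \<open>p\<close>-polynomials: the components with index at least \<open>k\<close> no longer
  involve the variables before \<open>X k\<close>. As long as two of them involve \<open>X k\<close>, a division step lowers the
  sum of their degrees in \<open>X k\<close>.\<close>

lemma Add_triangularize:
  fixes \<phi> :: "'k::field mpoly \<Rightarrow> 'k mpoly"
  assumes p: "CHAR('k) > 0" and "k \<le> n" and "\<phi> \<in> Add n" and "\<And>i. i < n \<Longrightarrow> \<phi> (X i) \<in> polys {min i k..<n}"
  shows "\<phi> \<in> Gen n"
  using assms(2-)
proof (induction k arbitrary: \<phi> rule: inc_induct)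
  case base
  have "\<phi> (X i) \<in> polys {i..<n}" if "i < n" for i using base(2)[OF that] that by simp
  then have "\<phi> \<in> BA n" using base(1) by (simp add: BA_def Add_def)
  then show ?case using base(1) Add_subset_Aff_g by (auto intro: generate.incl)
next
  case (step k)
  have S: "subgroup (Gen n) (Aut n)" by (rule subgroup_generate_Aff_BA[OF subgroup_Aff_g])
  from step.prems show ?case
  proof (induction "\<Sum>i\<in>{k..<n}. vdeg k (\<phi> (X i))" arbitrary: \<phi> rule: less_induct)
    case less
    note \<phi> = less.prems
    have pp: "\<phi> (X i) \<in> p_polys {..<n}" if "i < n" for i
      using \<phi>(1) that unfolding Add_iff[OF p] by auto
    have c: "\<phi> \<in> Aut_carrier n" using \<phi>(1) unfolding Add_iff[OF p] by auto
    have X: "X i \<in> polys {..<n}" if "i < n" for i using that by (simp add: X_in_polys)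
    have nz: "\<psi> (X i) \<noteq> 0" if "\<psi> \<in> Aut_carrier n" "i < n" for \<psi> :: "'k mpoly \<Rightarrow> 'k mpoly" and i
      using wdeg_Aut_ge_1(2) that by blast
    have pol: "\<phi> (X i) \<in> polys {k..<n}" if "k \<le> i" "i < n" for i
      using \<phi>(2)[OF that(2)] that(1) by (simp add: min_absorb2)
    show ?case
    proof (cases "\<exists>i j. k \<le> i \<and> i < n \<and> k \<le> j \<and> j < n \<and> i \<noteq> j \<and> 0 < vdeg k (\<phi> (X j)) \<and> vdeg k (\<phi> (X j)) \<le> vdeg k (\<phi> (X i))")
      case True
      then obtain i j where i: "k \<le> i" "i < n" and j: "k \<le> j" "j < n" and ij: "i \<noteq> j"
        and d: "0 < vdeg k (\<phi> (X j))" "vdeg k (\<phi> (X j)) \<le> vdeg k (\<phi> (X i))" by blast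
      obtain a e where a: "\<phi> (X i) - Const a * \<phi> (X j) ^ (CHAR('k) ^ e) = 0
          \<or> vdeg k (\<phi> (X i) - Const a * \<phi> (X j) ^ (CHAR('k) ^ e)) < vdeg k (\<phi> (X i))"
        using division_step[OF p pp[OF i(2)] nz[OF c i(2)] pp[OF j(2)] nz[OF c j(2)] d] .
      let ?E = "elementary n i (Const (- a) * X j ^ (CHAR('k) ^ e)) :: 'k mpoly \<Rightarrow> 'k mpoly"
      have Eg: "?E \<in> Gen n" by (rule elementary_in_Gen[OF p i(2) j(2) ij])
      have E: "?E \<in> Aut_carrier n" using subgroup.mem_carrier[OF S Eg] by simp
      let ?\<psi> = "\<phi> \<otimes>\<^bsub>Aut n\<^esub> ?E"
      have \<psi>c: "?\<psi> \<in> Aut_carrier n" by (rule Aut_mult_in[OF c E])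
      have \<psi>i: "?\<psi> (X i) = \<phi> (X i) - Const a * \<phi> (X j) ^ (CHAR('k) ^ e)"
      proof -
        have pw: "X j ^ (CHAR('k) ^ e) \<in> polys {..<n}" by (rule polys_power[OF X[OF j(2)]])
        have "?\<psi> (X i) = \<phi> (X i + Const (- a) * X j ^ (CHAR('k) ^ e))"
          using Aut_mult_apply[OF c E X[OF i(2)]] i by (simp add: elementary_X)
        also have "\<dots> = \<phi> (X i) + Const (- a) * \<phi> (X j) ^ (CHAR('k) ^ e)"
          using Aut_add[OF c X[OF i(2)] polys_mult[OF Const_in_polys pw]] Aut_times[OF c Const_in_polys pw]
            Aut_power[OF c X[OF j(2)] X[OF j(2)]] Aut_Const[OF c] by simp
        finally show ?thesis by (simp add: Const_uminus)
      qed
      have \<psi>l: "?\<psi> (X l) = \<phi> (X l)" if "l < n" "l \<noteq> i" for l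
        using Aut_mult_apply[OF c E X[OF that(1)]] that by (simp add: elementary_X)
      have lt: "vdeg k (?\<psi> (X i)) < vdeg k (\<phi> (X i))"
        using a nz[OF \<psi>c i(2)] unfolding \<psi>i by blast
      have "(\<Sum>l\<in>{k..<n}. vdeg k (?\<psi> (X l))) < (\<Sum>l\<in>{k..<n}. vdeg k (\<phi> (X l)))"
      proof (rule sum_strict_mono_ex1)
        show "\<forall>l\<in>{k..<n}. vdeg k (?\<psi> (X l)) \<le> vdeg k (\<phi> (X l))"
          using lt \<psi>l by (metis atLeastLessThan_iff less_imp_le order_refl)
        show "\<exists>l\<in>{k..<n}. vdeg k (?\<psi> (X l)) < vdeg k (\<phi> (X l))" using lt i by auto
      qed simp
      moreover have "?\<psi> \<in> Add n"
        unfolding Add_iff[OF p]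
      proof (intro conjI allI impI \<psi>c)
        fix l assume "l < n"
        then show "?\<psi> (X l) \<in> p_polys {..<n}"
          using pp \<psi>l i j by (cases "l = i")
            (auto simp: \<psi>i intro!: p_polys_diff p_polys_Const_mult p_polys_frobenius[OF p])
      qed
      moreover have "?\<psi> (X l) \<in> polys {min l k..<n}" if "l < n" for l
      proof (cases "l = i")
        case True
        then show ?thesis using pol i j
          by (auto simp: \<psi>i min_absorb2 intro!: polys_diff polys_mult polys_power Const_in_polys)
      next
        case False
        then show ?thesis using \<psi>l[OF that] \<phi>(2)[OF that] by simp
      qed
      ultimately have "?\<psi> \<in> Gen n" by (rule less.hyps)
      then show ?thesis using Aut_mult_right_cancel[OF S c Eg] by blast
    next
      case False
      \<comment> \<open>At most one component still involves \<open>X k\<close>; a transposition moves it to position \<open>k\<close>.\<close>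
      obtain i where i: "k \<le> i" "i < n"
        and unique: "\<And>l. k \<le> l \<Longrightarrow> l < n \<Longrightarrow> l \<noteq> i \<Longrightarrow> vdeg k (\<phi> (X l)) = 0"
      proof (cases "\<exists>i. k \<le> i \<and> i < n \<and> 0 < vdeg k (\<phi> (X i))")
        case True
        then obtain i where "k \<le> i" "i < n" "0 < vdeg k (\<phi> (X i))" by blast
        then show thesis using that[of i] False by (metis gr0I nat_le_linear)
      next
        case False
        then show thesis using that[of k] step.hyps by auto
      qed
      let ?s = "swap n k i :: 'k mpoly \<Rightarrow> 'k mpoly"
      have kn: "k < n" using step.hyps by simp
      have s: "?s \<in> Aut_carrier n" "?s \<in> Gen n"
        using swap_in_Aut[OF kn i(2)] swap_in_Aff[OF kn i(2)] by (auto intro: generate.incl)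
      let ?\<psi> = "\<phi> \<otimes>\<^bsub>Aut n\<^esub> ?s"
      have tn: "transpose k i l < n" if "l < n" for l using that kn i by (auto simp: transpose_def)
      have \<psi>: "?\<psi> (X l) = \<phi> (X (transpose k i l))" if "l < n" for l
        using Aut_mult_apply[OF c s(1) X[OF that]] that by (simp add: swap_X)
      have "?\<psi> \<in> Add n"
        unfolding Add_iff[OF p] using Aut_mult_in[OF c s(1)] pp tn by (auto simp: \<psi>)
      moreover have "?\<psi> (X l) \<in> polys {min l (Suc k)..<n}" if l: "l < n" for l
      proof -
        consider "l < k" | "l = k" | "l > k" by linarith
        then show ?thesis
        proof cases
          case 1
          then have "transpose k i l = l" using i by (simp add: transpose_def)
          with 1 show ?thesis using \<phi>(2)[OF l] \<psi>[OF l] by simp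
        next
          case 2
          then show ?thesis using \<psi>[OF l] pol[OF i] by simp
        next
          case 3
          have t: "k \<le> transpose k i l" "transpose k i l \<noteq> i" using 3 i by (auto simp: transpose_def)
          have "\<phi> (X (transpose k i l)) \<in> polys {Suc k..<n}"
            using pol[OF t(1) tn[OF l]] nz[OF c tn[OF l]] unique[OF t(1) tn[OF l] t(2)] by (rule vdeg_0_polys)
          with 3 show ?thesis using \<psi>[OF l] by (simp add: min_absorb2)
        qed
      qed
      ultimately have "?\<psi> \<in> Gen n" by (rule step.IH)
      then show ?thesis using Aut_mult_right_cancel[OF S c s(2)] by blast
    qed
  qed
qed

lemma Aff_g_eq_generate:
  assumes p: "CHAR('k::field) > 0"
  shows "(Aff_g n :: ('k mpoly \<Rightarrow> 'k mpoly) set) = Gen n"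
proof (rule generate_Aut_eqI[OF subgroup_Aff_g])
  show "Aff n \<union> (BA n \<inter> Aff_g n) \<subseteq> (Aff_g n :: ('k mpoly \<Rightarrow> 'k mpoly) set)"
    using Aff_subset_Aff_g[OF p] by blast
  have "Add n \<subseteq> (Gen n :: ('k mpoly \<Rightarrow> 'k mpoly) set)"
  proof
    fix \<phi> :: "'k mpoly \<Rightarrow> 'k mpoly" assume \<phi>: "\<phi> \<in> Add n"
    then have "\<phi> (X i) \<in> polys {min i 0..<n}" if "i < n" for i
      using that by (auto simp: Add_def additive_poly_def atLeast0LessThan)
    then show "\<phi> \<in> Gen n" by (intro Add_triangularize[OF p _ \<phi>, of 0]) simp_all
  qed
  moreover have "Translations n \<subseteq> (Gen n :: ('k mpoly \<Rightarrow> 'k mpoly) set)"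
    using Translations_subset_Aff by (auto intro: generate.incl)
  ultimately have "(Aff_g n :: ('k mpoly \<Rightarrow> 'k mpoly) set) \<subseteq> Gen n"
    unfolding Aff_g_def[of n]
    by (intro Aut.generate_subgroup_incl subgroup_generate_Aff_BA[OF subgroup_Aff_g, unfolded Aff_g_def]) auto
  then show "\<phi> \<in> Gen n" if "\<phi> \<in> Aff_g n" for \<phi> :: "'k mpoly \<Rightarrow> 'k mpoly" using that by blast
qed

theorem proposition2p1:
  assumes "CHAR('k::field) = p" and "p > 0"
  shows "(\<forall>n\<ge>1. (Aff_g n :: ('k mpoly \<Rightarrow> 'k mpoly) set) =
            generate (Aut n) (Aff n \<union> (BA n \<inter> Aff_g n))) \<and>
         (\<forall>n\<in>{1, 2}. (Aff_d n :: ('k mpoly \<Rightarrow> 'k mpoly) set) =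
            generate (Aut n) (Aff n \<union> (BA n \<inter> Aff_d n)))"
proof (intro conjI allI ballI impI)
  fix n :: nat
  show "(Aff_g n :: ('k mpoly \<Rightarrow> 'k mpoly) set) = generate (Aut n) (Aff n \<union> (BA n \<inter> Aff_g n))"
    using assms by (intro Aff_g_eq_generate) simp
next
  fix n :: nat assume "n \<in> {1, 2}"
  then show "(Aff_d n :: ('k mpoly \<Rightarrow> 'k mpoly) set) = generate (Aut n) (Aff n \<union> (BA n \<inter> Aff_d n))"
    by (rule Aff_d_eq_generate)
qed

end
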